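(* Let $(R,\mathfrak{m})$ be a $d$-dimensional Cohen-Macaulay (noetherian) local ring which is Gorenstein on its punctured spectrum, and let $M$ be a finitely generated $R$-module of dimension $1$. Then $\operatorname{Supp}(\operatorname{Ext}^{d-1}_R(M,R))=\operatorname{Supp}(M)$. In particular, $\dim(\operatorname{Ext}^{d-1}_R(M,R))=1$.
   Context: "Gorenstein on its punctured spectrum" means that $R_{\mathfrak{p}}$ is Gorenstein for every prime ideal $\mathfrak{p}\neq\mathfrak{m}$. The dimension of a module is the Krull dimension of its support. *)

theory Defs
  imports "HOL-Algebra.Module" "HOL-Algebra.Ring_Divisibility" "HOL-Library.Extended_Nat"
begin

section \<open>Modules\<close>

text \<open>The library's record of modules extends the record of rings, but the locale
  \<^locale>\<open>module\<close> puts no condition on the two multiplicative fields. They are filled with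
  zeros here.\<close>

definition mk_module ::
    "'m set \<Rightarrow> 'm \<Rightarrow> ('m \<Rightarrow> 'm \<Rightarrow> 'm) \<Rightarrow> ('a \<Rightarrow> 'm \<Rightarrow> 'm) \<Rightarrow> ('a, 'm) module"
  where "mk_module C z a s =
    \<lparr>carrier = C, mult = (\<lambda>_ _. z), one = z, zero = z, add = a, smult = s\<rparr>"

definition self_module :: "('a, 'c) ring_scheme \<Rightarrow> ('a, 'a) module"
  where "self_module R = mk_module (carrier R) \<zero>\<^bsub>R\<^esub> (add R) (mult R)"

definition finitely_generated_module :: "('a, 'c) ring_scheme \<Rightarrow> ('a, 'm) module \<Rightarrow> bool"
  where "finitely_generated_module R M \<longleftrightarrow> module R M \<and>
    (\<exists>A \<subseteq> carrier M. finite A \<and> (\<forall>H. submodule H R M \<and> A \<subseteq> H \<longrightarrow> H = carrier M))"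

text \<open>Linear maps are taken to be extensional (equal to \<^term>\<open>undefined\<close> outside the
  carrier), so that equality of linear maps is equality of functions.\<close>

definition mod_hom ::
    "('a, 'c) ring_scheme \<Rightarrow> ('a, 'm) module \<Rightarrow> ('a, 'n) module \<Rightarrow> ('m \<Rightarrow> 'n) set"
  where "mod_hom R M N = {f \<in> carrier M \<rightarrow>\<^sub>E carrier N.
    (\<forall>x\<in>carrier M. \<forall>y\<in>carrier M. f (x \<oplus>\<^bsub>M\<^esub> y) = f x \<oplus>\<^bsub>N\<^esub> f y) \<and>
    (\<forall>a\<in>carrier R. \<forall>x\<in>carrier M. f (a \<odot>\<^bsub>M\<^esub> x) = a \<odot>\<^bsub>N\<^esub> f x)}"

definition hom_module ::
    "('a, 'c) ring_scheme \<Rightarrow> ('a, 'm) module \<Rightarrow> ('a, 'n) module \<Rightarrow> ('a, 'm \<Rightarrow> 'n) module"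
  where "hom_module R M N = mk_module (mod_hom R M N)
    (\<lambda>x\<in>carrier M. \<zero>\<^bsub>N\<^esub>)
    (\<lambda>f g. \<lambda>x\<in>carrier M. f x \<oplus>\<^bsub>N\<^esub> g x)
    (\<lambda>a f. \<lambda>x\<in>carrier M. a \<odot>\<^bsub>N\<^esub> f x)"

definition mod_ker :: "('a, 'm) module \<Rightarrow> ('a, 'n) module \<Rightarrow> ('m \<Rightarrow> 'n) \<Rightarrow> 'm set"
  where "mod_ker M N f = {x \<in> carrier M. f x = \<zero>\<^bsub>N\<^esub>}"

definition quot_module :: "('a, 'm) module \<Rightarrow> 'm set \<Rightarrow> ('a, 'm set) module"
  where "quot_module M H = mk_module (a_rcosets\<^bsub>M\<^esub> H) H (set_add M)
    (\<lambda>a X. \<Union>x\<in>X. H +>\<^bsub>M\<^esub> (a \<odot>\<^bsub>M\<^esub> x))"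

definition free_module :: "('a, 'c) ring_scheme \<Rightarrow> 'b set \<Rightarrow> ('a, 'b \<Rightarrow> 'a) module"
  where "free_module R B = mk_module
    {f. (\<forall>b\<in>B. f b \<in> carrier R) \<and> (\<forall>b. b \<notin> B \<longrightarrow> f b = \<zero>\<^bsub>R\<^esub>) \<and> finite {b. f b \<noteq> \<zero>\<^bsub>R\<^esub>}}
    (\<lambda>_. \<zero>\<^bsub>R\<^esub>)
    (\<lambda>f g b. f b \<oplus>\<^bsub>R\<^esub> g b)
    (\<lambda>a f b. a \<otimes>\<^bsub>R\<^esub> f b)"

section \<open>Localization\<close>

text \<open>The fraction \<open>m / s\<close> is the class of the pair \<open>(m, s)\<close>, where \<open>(m, s)\<close> and \<open>(n, t)\<close> are
  identified if \<open>u t m = u s n\<close> for some \<open>u\<close> in \<open>S\<close>.\<close>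

definition fraction :: "'a set \<Rightarrow> ('a, 'm) module \<Rightarrow> 'm \<Rightarrow> 'a \<Rightarrow> ('m \<times> 'a) set"
  where "fraction S M m s = {(n, t). n \<in> carrier M \<and> t \<in> S \<and>
    (\<exists>u\<in>S. u \<odot>\<^bsub>M\<^esub> (t \<odot>\<^bsub>M\<^esub> m) = u \<odot>\<^bsub>M\<^esub> (s \<odot>\<^bsub>M\<^esub> n))}"

definition loc_carrier :: "'a set \<Rightarrow> ('a, 'm) module \<Rightarrow> ('m \<times> 'a) set set"
  where "loc_carrier S M = {fraction S M m s | m s. m \<in> carrier M \<and> s \<in> S}"

definition loc_add ::
    "('a, 'c) ring_scheme \<Rightarrow> 'a set \<Rightarrow> ('a, 'm) module \<Rightarrow>
      ('m \<times> 'a) set \<Rightarrow> ('m \<times> 'a) set \<Rightarrow> ('m \<times> 'a) set"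
  where "loc_add R S M X Y =
    (\<Union>(m, s)\<in>X. \<Union>(n, t)\<in>Y. fraction S M (t \<odot>\<^bsub>M\<^esub> m \<oplus>\<^bsub>M\<^esub> s \<odot>\<^bsub>M\<^esub> n) (s \<otimes>\<^bsub>R\<^esub> t))"

definition loc_smult ::
    "('a, 'c) ring_scheme \<Rightarrow> 'a set \<Rightarrow> ('a, 'm) module \<Rightarrow>
      ('a \<times> 'a) set \<Rightarrow> ('m \<times> 'a) set \<Rightarrow> ('m \<times> 'a) set"
  where "loc_smult R S M X Y =
    (\<Union>(r, s)\<in>X. \<Union>(n, t)\<in>Y. fraction S M (r \<odot>\<^bsub>M\<^esub> n) (s \<otimes>\<^bsub>R\<^esub> t))"

definition loc_ring :: "('a, 'c) ring_scheme \<Rightarrow> 'a set \<Rightarrow> ('a \<times> 'a) set ring"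
  where "loc_ring R S =
    \<lparr>carrier = loc_carrier S (self_module R),
     mult = loc_smult R S (self_module R),
     one = fraction S (self_module R) \<one>\<^bsub>R\<^esub> \<one>\<^bsub>R\<^esub>,
     zero = fraction S (self_module R) \<zero>\<^bsub>R\<^esub> \<one>\<^bsub>R\<^esub>,
     add = loc_add R S (self_module R)\<rparr>"

definition loc_module ::
    "('a, 'c) ring_scheme \<Rightarrow> 'a set \<Rightarrow> ('a, 'm) module \<Rightarrow> (('a \<times> 'a) set, ('m \<times> 'a) set) module"
  where "loc_module R S M = mk_module (loc_carrier S M)
    (fraction S M \<zero>\<^bsub>M\<^esub> \<one>\<^bsub>R\<^esub>) (loc_add R S M) (loc_smult R S M)"

section \<open>Support and dimension\<close>

definition spec :: "('a, 'c) ring_scheme \<Rightarrow> 'a set set"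
  where "spec R = {P. primeideal P R}"

definition supp :: "('a, 'c) ring_scheme \<Rightarrow> ('a, 'm) module \<Rightarrow> 'a set set"
  where "supp R M = {P \<in> spec R.
    carrier (loc_module R (carrier R - P) M) \<noteq> {\<zero>\<^bsub>loc_module R (carrier R - P) M\<^esub>}}"

text \<open>Supremum of the lengths \<open>n\<close> of chains \<open>P 0 \<subset> \<dots> \<subset> P n\<close> in a set of primes. The supremum of
  the empty set is 0 in \<^typ>\<open>enat\<close>, so the empty set (hence the zero module) gets dimension 0
  rather than \<open>-\<infinity>\<close>.\<close>

definition chain_dim :: "'a set set \<Rightarrow> enat"
  where "chain_dim X = Sup {enat n | n.
    \<exists>P. (\<forall>i\<le>n. P i \<in> X) \<and> (\<forall>i<n. P i \<subset> P (Suc i))}"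

definition krull_dim :: "('a, 'c) ring_scheme \<Rightarrow> enat"
  where "krull_dim R = chain_dim (spec R)"

definition module_dim :: "('a, 'c) ring_scheme \<Rightarrow> ('a, 'm) module \<Rightarrow> enat"
  where "module_dim R M = chain_dim (supp R M)"

section \<open>Noetherian local rings, depth and the Cohen-Macaulay property\<close>

locale noetherian_local_ring = cring R + noetherian_ring R + maximalideal \<mm> R
  for \<mm> and R (structure) +
  assumes maximal_unique: "maximalideal J R \<Longrightarrow> J = \<mm>"

definition nonzerodivisor :: "('a, 'c) ring_scheme \<Rightarrow> 'a \<Rightarrow> bool"
  where "nonzerodivisor R x \<longleftrightarrow>
    x \<in> carrier R \<and> (\<forall>y\<in>carrier R. x \<otimes>\<^bsub>R\<^esub> y = \<zero>\<^bsub>R\<^esub> \<longrightarrow> y = \<zero>\<^bsub>R\<^esub>)"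

definition regular_sequence :: "('a, 'c) ring_scheme \<Rightarrow> 'a list \<Rightarrow> bool"
  where "regular_sequence R xs \<longleftrightarrow> set xs \<subseteq> carrier R \<and>
    (\<forall>i<length xs. let I = Idl\<^bsub>R\<^esub> (set (take i xs))
      in nonzerodivisor (R Quot I) (I +>\<^bsub>R\<^esub> (xs ! i))) \<and>
    Idl\<^bsub>R\<^esub> (set xs) \<noteq> carrier R"

definition depth :: "'a set \<Rightarrow> ('a, 'c) ring_scheme \<Rightarrow> enat"
  where "depth \<mm> R = Sup {enat (length xs) | xs. regular_sequence R xs \<and> set xs \<subseteq> \<mm>}"

definition cohen_macaulay_local_ring :: "'a set \<Rightarrow> ('a, 'c) ring_scheme \<Rightarrow> bool"
  where "cohen_macaulay_local_ring \<mm> R \<longleftrightarrow>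
    noetherian_local_ring \<mm> R \<and> depth \<mm> R = krull_dim R"

section \<open>Injective dimension and the Gorenstein property\<close>

text \<open>HOL cannot quantify over the types of the test modules inside a definition. The test modules
  \<open>B\<close> here have carriers in \<^typ>\<open>'a + 'u\<close>, hence include a copy of \<open>R\<close>; by Baer's criterion this
  is the same as testing against all modules.\<close>

definition injective_module :: "('a, 'c) ring_scheme \<Rightarrow> ('a, 'u) module \<Rightarrow> bool"
  where "injective_module R E \<longleftrightarrow> module R E \<and>
    (\<forall>(B :: ('a, 'a + 'u) module) A. module R B \<and> submodule A R B \<longrightarrow>
      (\<forall>f \<in> mod_hom R (B\<lparr>carrier := A\<rparr>) E. \<exists>g \<in> mod_hom R B E. \<forall>x\<in>A. g x = f x))"

definition injective_resolution ::
    "('a, 'c) ring_scheme \<Rightarrow> ('a, 'm) module \<Rightarrow>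
      (nat \<Rightarrow> ('a, 'u) module) \<Rightarrow> ('m \<Rightarrow> 'u) \<Rightarrow> (nat \<Rightarrow> 'u \<Rightarrow> 'u) \<Rightarrow> bool"
  where "injective_resolution R M E \<eta> \<delta> \<longleftrightarrow>
    (\<forall>i. injective_module R (E i)) \<and>
    \<eta> \<in> mod_hom R M (E 0) \<and> (\<forall>i. \<delta> i \<in> mod_hom R (E i) (E (Suc i))) \<and>
    inj_on \<eta> (carrier M) \<and>
    \<eta> ` carrier M = mod_ker (E 0) (E 1) (\<delta> 0) \<and>
    (\<forall>i. \<delta> i ` carrier (E i) = mod_ker (E (Suc i)) (E (Suc (Suc i))) (\<delta> (Suc i)))"

text \<open>Let \<open>k\<close> be the maximum of \<open>\<aleph>\<^sub>0\<close> and the cardinalities of \<open>R\<close> and \<open>M\<close>. The terms of the minimal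
  injective resolution of \<open>M\<close> have cardinality at most \<open>2\<^sup>k\<close>, so nothing is lost by
  taking the injective modules with carriers in the type below.\<close>

definition finite_injective_dimension :: "('a, 'c) ring_scheme \<Rightarrow> ('a, 'm) module \<Rightarrow> bool"
  where "finite_injective_dimension R M \<longleftrightarrow>
    (\<exists>(E :: nat \<Rightarrow> ('a, ('a + 'm) list set) module) \<eta> \<delta> n.
      injective_resolution R M E \<eta> \<delta> \<and> (\<forall>i>n. carrier (E i) = {\<zero>\<^bsub>E i\<^esub>}))"

definition gorenstein_local_ring :: "('a, 'c) ring_scheme \<Rightarrow> bool"
  where "gorenstein_local_ring R \<longleftrightarrow>
    (\<exists>\<mm>. noetherian_local_ring \<mm> R) \<and> finite_injective_dimension R (self_module R)"

definition gorenstein_on_punctured_spectrum :: "'a set \<Rightarrow> ('a, 'c) ring_scheme \<Rightarrow> bool"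
  where "gorenstein_on_punctured_spectrum \<mm> R \<longleftrightarrow>
    (\<forall>P \<in> spec R. P \<noteq> \<mm> \<longrightarrow> gorenstein_local_ring (loc_ring R (carrier R - P)))"

section \<open>Ext\<close>

text \<open>A free resolution with terms \<open>F i = free_module R (B i)\<close>, differentials \<open>\<delta> i\<close> from
  \<open>F (i + 1)\<close> to \<open>F i\<close> and augmentation \<open>\<epsilon>\<close> from \<open>F 0\<close> to \<open>M\<close>.\<close>

definition free_resolution ::
    "('a, 'c) ring_scheme \<Rightarrow> ('a, 'm) module \<Rightarrow>
      (nat \<Rightarrow> 'b set) \<Rightarrow> (('b \<Rightarrow> 'a) \<Rightarrow> 'm) \<Rightarrow> (nat \<Rightarrow> ('b \<Rightarrow> 'a) \<Rightarrow> ('b \<Rightarrow> 'a)) \<Rightarrow> bool"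
  where "free_resolution R M B \<epsilon> \<delta> \<longleftrightarrow> (let F = (\<lambda>i. free_module R (B i)) in
    \<epsilon> \<in> mod_hom R (F 0) M \<and> (\<forall>i. \<delta> i \<in> mod_hom R (F (Suc i)) (F i)) \<and>
    \<epsilon> ` carrier (F 0) = carrier M \<and>
    \<delta> 0 ` carrier (F 1) = mod_ker (F 0) M \<epsilon> \<and>
    (\<forall>i. \<delta> (Suc i) ` carrier (F (Suc (Suc i))) = mod_ker (F (Suc i)) (F i) (\<delta> i)))"

definition dual_differential ::
    "('a, 'c) ring_scheme \<Rightarrow> (nat \<Rightarrow> 'b set) \<Rightarrow> (nat \<Rightarrow> ('b \<Rightarrow> 'a) \<Rightarrow> ('b \<Rightarrow> 'a)) \<Rightarrow>
      nat \<Rightarrow> (('b \<Rightarrow> 'a) \<Rightarrow> 'n) \<Rightarrow> (('b \<Rightarrow> 'a) \<Rightarrow> 'n)"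
  where "dual_differential R B \<delta> i h = compose (carrier (free_module R (B (Suc i)))) h (\<delta> i)"

definition hom_cohomology ::
    "('a, 'c) ring_scheme \<Rightarrow> (nat \<Rightarrow> 'b set) \<Rightarrow> (nat \<Rightarrow> ('b \<Rightarrow> 'a) \<Rightarrow> ('b \<Rightarrow> 'a)) \<Rightarrow>
      ('a, 'n) module \<Rightarrow> nat \<Rightarrow> ('a, (('b \<Rightarrow> 'a) \<Rightarrow> 'n) set) module"
  where "hom_cohomology R B \<delta> N i = (let
      C = (\<lambda>i. hom_module R (free_module R (B i)) N);
      cocycles = mod_ker (C i) (C (Suc i)) (dual_differential R B \<delta> i);
      coboundaries = (case i of 0 \<Rightarrow> {\<zero>\<^bsub>C 0\<^esub>}
        | Suc j \<Rightarrow> dual_differential R B \<delta> j ` carrier (C j))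
    in quot_module ((C i)\<lparr>carrier := cocycles\<rparr>) coboundaries)"

text \<open>\<open>Ext\<close> is the cohomology of \<open>Hom(F, N)\<close> for a chosen free resolution \<open>F\<close> of \<open>M\<close>; up to
  isomorphism it does not depend on the choice. The basis type has the cardinality
  \<open>k\<close> described above (or more), and all syzygies of \<open>M\<close> can be generated by at most \<open>k\<close> elements,
  so every module has a free resolution with bases in this type.\<close>

definition Ext_module ::
    "('a, 'c) ring_scheme \<Rightarrow> ('a, 'm) module \<Rightarrow> ('a, 'n) module \<Rightarrow> nat \<Rightarrow>
      ('a, ((('a + 'm) list \<Rightarrow> 'a) \<Rightarrow> 'n) set) module"
  where "Ext_module R M N i =
    (case (SOME (B, \<delta>). \<exists>\<epsilon>. free_resolution R M B \<epsilon> \<delta>) of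
      (B :: nat \<Rightarrow> ('a + 'm) list set, \<delta>) \<Rightarrow> hom_cohomology R B \<delta> N i)"

end

theory Submission
  imports Defs
begin

text \<open>Put \<open>n = d - 1\<close>. If \<open>R/J\<close> has depth at least 2, then its
  associated primes have coheight at least 2, while the primes over \<open>I = ann M\<close> have coheight at most 1. So
  \<open>I\<close> contains a regular sequence \<open>x\<^sub>0, \<dots>, x\<^sub>n\<^sub>-\<^sub>1\<close>. The connecting homomorphisms embed
  \<open>Hom(M, R/(x))\<close> into \<open>Ext\<^sup>n(M, R)\<close>, because \<open>Ext\<^sup>i(M, R/(x\<^sub>0, \<dots>, x\<^sub>k\<^sub>-\<^sub>1)) = 0\<close> for \<open>i < n - k\<close>.
  A nonmaximal prime \<open>P\<close> in the support of \<open>M\<close> contains no regular sequence of length \<open>d\<close>, as this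
  would give a chain of primes of length \<open>d + 1\<close>. So \<open>P\<close> is associated to \<open>R/(x)\<close>, and there is a
  map \<open>M \<rightarrow> R/P \<rightarrow> R/(x)\<close> that is not annihilated by any element outside \<open>P\<close>. Hence
  \<open>P\<close> is in the support of \<open>Ext\<^sup>n(M, R)\<close>, and then so is the maximal ideal. Conversely, multiplication by an
  annihilator of \<open>M\<close> is null-homotopic on a free resolution, so it is zero on Ext.\<close>

section \<open>Nonzerodivisors and associated primes\<close>

text \<open>The obstacle is to place the regular sequence inside I. The Cohen-Macaulay hypothesis
  only yields some regular sequence in the maximal ideal, unrelated to I. It must be shown that
  dividing out a regular element of the maximal ideal lowers the depth by at most one, whichever
  element is taken. An exchange of elements proves this, in place of the description of depth by Ext
  of the residue field.

  The number d - 1 fits the threshold 2: before each of the n choices the remaining depth is at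
  least 2, so the associated primes avoid those over I. Afterwards depth 1 remains, which keeps the
  maximal ideal out of Ass(R/(x)).

  Neither R/(x) nor a long exact sequence occurs as an object. A map from a free module to R/J is
  represented by a map to R, and equalities become memberships in J. Likewise localization at P is
  replaced by multipliers outside P, so that "nonzero at P" means "not annihilated by any s outside
  P".\<close>

locale noetherian_cring = cring R + noetherian_ring R for R (structure)

context cring
begin

lemma idealD:
  assumes "ideal J R"
  shows ideal_subset: "J \<subseteq> carrier R"
    and ideal_carrier: "x \<in> J \<Longrightarrow> x \<in> carrier R"
    and ideal_zero: "\<zero> \<in> J"
    and ideal_add: "\<lbrakk>x \<in> J; y \<in> J\<rbrakk> \<Longrightarrow> x \<oplus> y \<in> J"
    and ideal_minus: "\<lbrakk>x \<in> J; y \<in> J\<rbrakk> \<Longrightarrow> x \<ominus> y \<in> J"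
    and ideal_uminus: "x \<in> J \<Longrightarrow> \<ominus> x \<in> J"
    and ideal_mult: "\<lbrakk>a \<in> carrier R; x \<in> J\<rbrakk> \<Longrightarrow> a \<otimes> x \<in> J"
    and ideal_mult': "\<lbrakk>a \<in> carrier R; x \<in> J\<rbrakk> \<Longrightarrow> x \<otimes> a \<in> J"
proof -
  interpret J: ideal J R by fact
  show "J \<subseteq> carrier R" "x \<in> J \<Longrightarrow> x \<in> carrier R" "\<zero> \<in> J"
    "\<lbrakk>x \<in> J; y \<in> J\<rbrakk> \<Longrightarrow> x \<oplus> y \<in> J" "\<lbrakk>x \<in> J; y \<in> J\<rbrakk> \<Longrightarrow> x \<ominus> y \<in> J" "x \<in> J \<Longrightarrow> \<ominus> x \<in> J"
    "\<lbrakk>a \<in> carrier R; x \<in> J\<rbrakk> \<Longrightarrow> a \<otimes> x \<in> J" "\<lbrakk>a \<in> carrier R; x \<in> J\<rbrakk> \<Longrightarrow> x \<otimes> a \<in> J"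
    using J.Icarr J.I_l_closed J.I_r_closed by (auto simp: a_minus_def)
qed

lemma ideal_add_cancel:
  assumes "ideal J R" "y \<in> J" "x \<in> carrier R"
  shows "x \<oplus> y \<in> J \<longleftrightarrow> x \<in> J" "y \<oplus> x \<in> J \<longleftrightarrow> x \<in> J"
proof -
  note JD = idealD[OF assms(1)]
  have y: "y \<in> carrier R" using JD assms by auto
  have eq: "(x \<oplus> y) \<ominus> y = x" using y assms(3) by algebra
  show 1: "x \<oplus> y \<in> J \<longleftrightarrow> x \<in> J"
    using JD(4)[of x y] JD(5)[of "x \<oplus> y" y] assms(2) eq by auto
  then show "y \<oplus> x \<in> J \<longleftrightarrow> x \<in> J" using a_comm[OF y assms(3)] by simp
qed

lemma cring_idealI:
  assumes "J \<subseteq> carrier R" "\<zero> \<in> J" "\<And>x y. \<lbrakk>x \<in> J; y \<in> J\<rbrakk> \<Longrightarrow> x \<oplus> y \<in> J"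
    and mult: "\<And>a x. \<lbrakk>a \<in> carrier R; x \<in> J\<rbrakk> \<Longrightarrow> a \<otimes> x \<in> J"
  shows "ideal J R"
proof (rule idealI[OF ring_axioms])
  show "subgroup J (add_monoid R)"
  proof (rule add.subgroupI)
    fix a assume a: "a \<in> J"
    then have "\<ominus> a = (\<ominus> \<one>) \<otimes> a" using assms(1) l_minus[of \<one> a] by auto
    then show "\<ominus> a \<in> J" using mult[of "\<ominus> \<one>" a] a by auto
  qed (use assms in auto)
next
  fix a x assume "a \<in> J" "x \<in> carrier R"
  then show "x \<otimes> a \<in> J" "a \<otimes> x \<in> J" using assms(1) mult m_comm[of a x] by auto
qed

text \<open>The annihilator of the class of \<open>u\<close> in R/J.\<close>

definition colon :: "'a set \<Rightarrow> 'a \<Rightarrow> 'a set"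
  where "colon J u = {r \<in> carrier R. r \<otimes> u \<in> J}"

text \<open>The sum J + xR, given by explicit elements so that membership directly supplies a
  coefficient of \<open>x\<close>.\<close>

definition ideal_insert :: "'a \<Rightarrow> 'a set \<Rightarrow> 'a set"
  where "ideal_insert x J = {j \<oplus> x \<otimes> a | j a. j \<in> J \<and> a \<in> carrier R}"

lemma ideal_insertI: "\<lbrakk>y = j \<oplus> x \<otimes> a; j \<in> J; a \<in> carrier R\<rbrakk> \<Longrightarrow> y \<in> ideal_insert x J"
  by (auto simp: ideal_insert_def)

text \<open>Injectivity of multiplication by \<open>x\<close> on R/J, expressed in R. The case J = R
  is allowed here; properness is recorded separately by \<open>depth_ge\<close>.\<close>

definition nzd_mod :: "'a set \<Rightarrow> 'a \<Rightarrow> bool"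
  where "nzd_mod J x \<longleftrightarrow> x \<in> carrier R \<and> (\<forall>a\<in>carrier R. x \<otimes> a \<in> J \<longrightarrow> a \<in> J)"

text \<open>Ass(R/J).\<close>

definition ass_primes :: "'a set \<Rightarrow> 'a set set"
  where "ass_primes J = {Q. primeideal Q R \<and> (\<exists>u\<in>carrier R. Q = colon J u)}"

lemma colon_ideal:
  assumes "ideal J R" "u \<in> carrier R"
  shows "ideal (colon J u) R"
proof (rule cring_idealI)
  note J = idealD[OF assms(1)]
  show "\<zero> \<in> colon J u" using assms J by (auto simp: colon_def)
  fix x y assume "x \<in> colon J u" "y \<in> colon J u"
  then show "x \<oplus> y \<in> colon J u" using assms J by (auto simp: colon_def l_distr)
next
  fix a x assume "a \<in> carrier R" "x \<in> colon J u"
  then show "a \<otimes> x \<in> colon J u" using assms idealD[OF assms(1)] by (auto simp: colon_def m_assoc)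
qed (auto simp: colon_def)

lemma ideal_insert_ideal:
  assumes J: "ideal J R" and x: "x \<in> carrier R"
  shows "ideal (ideal_insert x J) R"
proof (rule cring_idealI)
  note JD = idealD[OF J]
  show "ideal_insert x J \<subseteq> carrier R" using x JD by (auto simp: ideal_insert_def)
  have "\<zero> = \<zero> \<oplus> x \<otimes> \<zero>" using x by simp
  then show "\<zero> \<in> ideal_insert x J" by (rule ideal_insertI) (use JD in auto)
next
  note JD = idealD[OF J]
  fix y z assume "y \<in> ideal_insert x J" "z \<in> ideal_insert x J"
  then obtain j a k b where *: "j \<in> J" "a \<in> carrier R" "k \<in> J" "b \<in> carrier R"
    and yz: "y = j \<oplus> x \<otimes> a" "z = k \<oplus> x \<otimes> b" by (auto simp: ideal_insert_def)
  have "j \<in> carrier R" "k \<in> carrier R" using * JD by auto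
  then have "y \<oplus> z = (j \<oplus> k) \<oplus> x \<otimes> (a \<oplus> b)" unfolding yz using *(1-4) x by algebra
  then show "y \<oplus> z \<in> ideal_insert x J" by (rule ideal_insertI) (use * JD in auto)
next
  note JD = idealD[OF J]
  fix c y assume c: "c \<in> carrier R" and "y \<in> ideal_insert x J"
  then obtain j a where *: "j \<in> J" "a \<in> carrier R" "y = j \<oplus> x \<otimes> a" by (auto simp: ideal_insert_def)
  have "j \<in> carrier R" using * JD by auto
  then have "c \<otimes> y = c \<otimes> j \<oplus> x \<otimes> (c \<otimes> a)" unfolding *(3) using *(1,2) x c by algebra
  then show "c \<otimes> y \<in> ideal_insert x J" by (rule ideal_insertI) (use * JD c in auto)
qed

lemma subset_ideal_insert: "\<lbrakk>ideal J R; x \<in> carrier R\<rbrakk> \<Longrightarrow> J \<subseteq> ideal_insert x J"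
  by (auto intro!: ideal_insertI[where a = \<zero>] dest: ideal_carrier)

lemma elem_ideal_insert: "\<lbrakk>ideal J R; x \<in> carrier R\<rbrakk> \<Longrightarrow> x \<in> ideal_insert x J"
  by (rule ideal_insertI[where a = \<one> and j = \<zero>]) (auto dest: ideal_zero)

lemma ideal_insert_minimal:
  "\<lbrakk>ideal I R; J \<subseteq> I; x \<in> I\<rbrakk> \<Longrightarrow> ideal_insert x J \<subseteq> I"
  by (auto simp: ideal_insert_def intro!: idealD(4)[of I] idealD(8)[of I])

lemma ideal_insert_iff:
  assumes J: "ideal J R" and x: "x \<in> carrier R" and y: "y \<in> carrier R"
  shows "y \<in> ideal_insert x J \<longleftrightarrow> (\<exists>a\<in>carrier R. y \<ominus> x \<otimes> a \<in> J)"
proof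
  assume "y \<in> ideal_insert x J"
  then obtain j a where *: "j \<in> J" "a \<in> carrier R" "y = j \<oplus> x \<otimes> a" by (auto simp: ideal_insert_def)
  have "j \<in> carrier R" using * idealD[OF J] by auto
  then have "y \<ominus> x \<otimes> a = j" unfolding *(3) using *(2) x by algebra
  then show "\<exists>a\<in>carrier R. y \<ominus> x \<otimes> a \<in> J" using *(1,2) by metis
next
  assume "\<exists>a\<in>carrier R. y \<ominus> x \<otimes> a \<in> J"
  then obtain a where a: "a \<in> carrier R" "y \<ominus> x \<otimes> a \<in> J" by auto
  have "y = (y \<ominus> x \<otimes> a) \<oplus> x \<otimes> a" using a(1) x y by algebra
  then show "y \<in> ideal_insert x J" by (rule ideal_insertI) (use a in auto)
qed

lemma ideal_insert_commute:
  assumes J: "ideal J R" and x: "x \<in> carrier R" and y: "y \<in> carrier R"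
  shows "ideal_insert x (ideal_insert y J) = ideal_insert y (ideal_insert x J)"
proof -
  have *: "ideal_insert x (ideal_insert y J) \<subseteq> ideal_insert y (ideal_insert x J)"
    if "x \<in> carrier R" "y \<in> carrier R" for x y
  proof (intro ideal_insert_minimal ideal_insert_ideal J that)
    show "J \<subseteq> ideal_insert y (ideal_insert x J)"
      using subset_ideal_insert ideal_insert_ideal J that by blast
    show "y \<in> ideal_insert y (ideal_insert x J)" "x \<in> ideal_insert y (ideal_insert x J)"
      using elem_ideal_insert subset_ideal_insert ideal_insert_ideal J that by blast+
  qed
  show ?thesis using *[OF x y] *[OF y x] by (rule equalityI)
qed

text \<open>If x a = z b modulo J, then regularity of \<open>z\<close> modulo J + xR makes b a
  multiple of x modulo J, and x can be cancelled. This is the half of the permutability of regular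
  sequences that holds over any commutative ring.\<close>

lemma nzd_mod_swap:
  assumes J: "ideal J R" and x: "nzd_mod J x" and z: "nzd_mod (ideal_insert x J) z"
  shows "nzd_mod (ideal_insert z J) x"
  unfolding nzd_mod_def
proof (intro conjI ballI impI)
  have xR: "x \<in> carrier R" and zR: "z \<in> carrier R" using x z by (auto simp: nzd_mod_def)
  note JD = idealD[OF J]
  show "x \<in> carrier R" by fact
  fix a assume a: "a \<in> carrier R" "x \<otimes> a \<in> ideal_insert z J"
  then obtain b where b: "b \<in> carrier R" "x \<otimes> a \<ominus> z \<otimes> b \<in> J"
    using ideal_insert_iff[OF J zR] xR by auto
  have "z \<otimes> b = \<ominus> (x \<otimes> a \<ominus> z \<otimes> b) \<oplus> x \<otimes> a" using a(1) b(1) xR zR by algebra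
  then have "z \<otimes> b \<in> ideal_insert x J" by (rule ideal_insertI) (use JD b a in auto)
  then have "b \<in> ideal_insert x J" using z b by (auto simp: nzd_mod_def)
  then obtain c where c: "c \<in> carrier R" "b \<ominus> x \<otimes> c \<in> J"
    using ideal_insert_iff[OF J xR] b by auto
  have "x \<otimes> (a \<ominus> z \<otimes> c) = (x \<otimes> a \<ominus> z \<otimes> b) \<oplus> z \<otimes> (b \<ominus> x \<otimes> c)"
    using a(1) b(1) c(1) xR zR by algebra
  then have "x \<otimes> (a \<ominus> z \<otimes> c) \<in> J" using JD b c zR by auto
  then have "a \<ominus> z \<otimes> c \<in> J" using x a c zR by (auto simp: nzd_mod_def)
  then show "a \<in> ideal_insert z J" using ideal_insert_iff[OF J zR a(1)] c by auto
qed

section \<open>Prime ideals and prime avoidance\<close>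

lemma primeidealD:
  assumes "primeideal Q R"
  shows "ideal Q R" "\<one> \<notin> Q"
    "\<lbrakk>a \<in> carrier R; b \<in> carrier R; a \<otimes> b \<in> Q\<rbrakk> \<Longrightarrow> a \<in> Q \<or> b \<in> Q"
proof -
  interpret Q: primeideal Q R by fact
  show "ideal Q R" "\<one> \<notin> Q" using Q.is_ideal Q.I_notcarr Q.one_imp_carrier by auto
  show "\<lbrakk>a \<in> carrier R; b \<in> carrier R; a \<otimes> b \<in> Q\<rbrakk> \<Longrightarrow> a \<in> Q \<or> b \<in> Q" by (rule Q.I_prime)
qed

lemma prime_idealI:
  assumes "ideal Q R" "\<one> \<notin> Q"
    "\<And>a b. \<lbrakk>a \<in> carrier R; b \<in> carrier R; a \<otimes> b \<in> Q; a \<notin> Q\<rbrakk> \<Longrightarrow> b \<in> Q"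
  shows "primeideal Q R"
proof (rule primeidealI[OF assms(1) is_cring])
  show "carrier R \<noteq> Q" using assms(2) one_closed by metis
  fix a b assume "a \<in> carrier R" "b \<in> carrier R" "a \<otimes> b \<in> Q"
  then show "a \<in> Q \<or> b \<in> Q" using assms(3)[of a b] by argo
qed

text \<open>Multiply an element of I outside Q by one element of each P outside Q; the product stays
  outside Q because Q is prime.\<close>

lemma ex_mem_all_not_mem_prime:
  assumes "primeideal Q R" "ideal I R" "\<not> I \<subseteq> Q" "finite \<S>"
    and "\<And>P. P \<in> \<S> \<Longrightarrow> ideal P R \<and> \<not> P \<subseteq> Q"
  shows "\<exists>x\<in>I. x \<notin> Q \<and> (\<forall>P\<in>\<S>. x \<in> P)"
  using assms(4,5)
proof (induction \<S> rule: finite_induct)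
  case empty
  then show ?case using assms(3) by auto
next
  case (insert P \<S>)
  then obtain x where x: "x \<in> I" "x \<notin> Q" "\<forall>P\<in>\<S>. x \<in> P" by auto
  have P: "ideal P R" "\<not> P \<subseteq> Q" using insert.prems by auto
  then obtain p where p: "p \<in> P" "p \<notin> Q" by auto
  have c: "x \<in> carrier R" "p \<in> carrier R"
    using ideal_carrier[OF assms(2) x(1)] ideal_carrier[OF P(1) p(1)] .
  have "p \<otimes> x \<notin> Q" using primeidealD(3)[OF assms(1) c(2,1)] p x by auto
  moreover have "p \<otimes> x \<in> I" by (rule ideal_mult[OF assms(2) c(2) x(1)])
  moreover have "p \<otimes> x \<in> P'" if "P' \<in> insert P \<S>" for P'
  proof (cases "P' = P")
    case True
    then show ?thesis using ideal_mult'[OF P(1) c(1) p(1)] by simp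
  next
    case False
    then have "P' \<in> \<S>" using that by simp
    then have "ideal P' R" "x \<in> P'" using insert.prems x(3) by simp_all
    then show ?thesis using ideal_mult[OF _ c(2)] by simp
  qed
  ultimately show ?case by metis
qed

lemma prime_avoidance:
  assumes "finite \<P>" "\<And>Q. Q \<in> \<P> \<Longrightarrow> primeideal Q R" "ideal I R" "I \<subseteq> \<Union>\<P>"
  shows "\<exists>Q\<in>\<P>. I \<subseteq> Q"
  using assms(1,2,4)
proof (induction \<P> rule: finite_induct)
  case empty
  then show ?case using ideal_zero[OF assms(3)] by auto
next
  case (insert Q \<P>)
  have Q: "primeideal Q R" using insert.prems(1) by simp
  have primes: "primeideal P R" if "P \<in> \<P>" for P using insert.prems(1) that by simp
  show ?case
  proof (rule ccontr)
    assume none: "\<not> ?case"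
    then have "\<not> I \<subseteq> \<Union>\<P>" using insert.IH primes by auto
    then obtain y where y: "y \<in> I" "y \<notin> \<Union>\<P>" by (meson subsetI)
    then have yQ: "y \<in> Q" using insert.prems(2) by auto
    \<comment> \<open>Only the primes not inside Q need to contain \<open>x\<close>. The sum x + y
      is outside Q, since y is in Q and x is not, and so it is outside every prime contained in Q as
      well. For the other primes, x + y in P together with x in P would put y in P.\<close>
    let ?S = "{P \<in> \<P>. \<not> P \<subseteq> Q}"
    have "\<exists>x\<in>I. x \<notin> Q \<and> (\<forall>P\<in>?S. x \<in> P)"
      using none primeidealD(1)[OF primes] insert.hyps(1)
      by (intro ex_mem_all_not_mem_prime[OF Q assms(3)]) auto
    then obtain x where x: "x \<in> I" "x \<notin> Q" "\<And>P. \<lbrakk>P \<in> \<P>; \<not> P \<subseteq> Q\<rbrakk> \<Longrightarrow> x \<in> P" by auto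
    have c: "x \<in> carrier R" "y \<in> carrier R"
      using ideal_carrier[OF assms(3)] x(1) y(1) by auto
    have xyQ: "x \<oplus> y \<notin> Q"
      using ideal_add_cancel(1)[OF primeidealD(1)[OF Q] yQ c(1)] x(2) by simp
    have "x \<oplus> y \<in> I" by (rule ideal_add[OF assms(3) x(1) y(1)])
    then have "x \<oplus> y \<in> \<Union>(insert Q \<P>)" using insert.prems(2) by (rule rev_subsetD)
    then obtain P where P: "P \<in> \<P>" "x \<oplus> y \<in> P" using xyQ by auto
    then have "x \<in> P" using x(3) xyQ by auto
    then have "y \<in> P"
      using ideal_add_cancel(2)[OF primeidealD(1)[OF primes[OF P(1)]] _ c(2)] P(2) by simp
    then show False using y(2) P(1) by auto
  qed
qed

end

section \<open>Associated primes in noetherian rings\<close>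

context noetherian_cring
begin

lemma ex_maximal_ideal_in:
  assumes "\<S> \<noteq> {}" "\<And>I. I \<in> \<S> \<Longrightarrow> ideal I R"
  shows "\<exists>I\<in>\<S>. \<forall>J\<in>\<S>. I \<subseteq> J \<longrightarrow> J = I"
proof (rule subset_Zorn_nonempty[OF assms(1)])
  fix \<C> assume C: "\<C> \<noteq> {}" "subset.chain \<S> \<C>"
  then have "subset.chain {I. ideal I R} \<C>"
    using assms(2) by (auto simp: subset_chain_def)
  then have "\<Union>\<C> \<in> \<C>" using ideal_chain_is_trivial C by blast
  then show "\<Union>\<C> \<in> \<S>" using C by (auto simp: subset_chain_def)
qed

lemma noetherian_induct [consumes 1, case_names step]:
  assumes "ideal I R"
    and "\<And>I. \<lbrakk>ideal I R; \<And>J. \<lbrakk>ideal J R; I \<subset> J\<rbrakk> \<Longrightarrow> P J\<rbrakk> \<Longrightarrow> P I"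
  shows "P I"
proof (rule ccontr)
  assume "\<not> P I"
  let ?S = "{I. ideal I R \<and> \<not> P I}"
  have "\<exists>I\<in>?S. \<forall>J\<in>?S. I \<subseteq> J \<longrightarrow> J = I"
    by (rule ex_maximal_ideal_in) (use assms(1) \<open>\<not> P I\<close> in auto)
  then obtain K where K: "K \<in> ?S" and max: "\<forall>J\<in>?S. K \<subseteq> J \<longrightarrow> J = K" by blast
  have "P K"
  proof (rule assms(2))
    show "ideal K R" using K by simp
    fix J assume "ideal J R" "K \<subset> J"
    then show "P J" using max by blast
  qed
  then show False using K by simp
qed

text \<open>An ideal maximal among the annihilators of nonzero classes in R/J is prime.\<close>

lemma ex_ass_prime:
  assumes J: "ideal J R" and u: "u \<in> carrier R" "u \<notin> J"
  shows "\<exists>Q\<in>ass_primes J. colon J u \<subseteq> Q"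
proof -
  let ?S = "{colon J v | v. v \<in> carrier R \<and> v \<notin> J \<and> colon J u \<subseteq> colon J v}"
  have "?S \<noteq> {}" using u by auto
  then obtain I where I: "I \<in> ?S" "\<forall>I'\<in>?S. I \<subseteq> I' \<longrightarrow> I' = I"
    using ex_maximal_ideal_in[of ?S] colon_ideal[OF J] by blast
  then obtain v where v: "v \<in> carrier R" "v \<notin> J" "colon J u \<subseteq> colon J v" "I = colon J v" by auto
  have "primeideal (colon J v) R"
  proof (rule prime_idealI[OF colon_ideal[OF J v(1)]])
    show "\<one> \<notin> colon J v" using v by (auto simp: colon_def)
    fix a b assume ab: "a \<in> carrier R" "b \<in> carrier R" "a \<otimes> b \<in> colon J v" "a \<notin> colon J v"
    have sub: "colon J v \<subseteq> colon J (a \<otimes> v)"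
    proof
      fix r assume "r \<in> colon J v"
      moreover from this have "r \<otimes> (a \<otimes> v) = a \<otimes> (r \<otimes> v)"
        using ab v by (intro m_lcomm) (auto simp: colon_def)
      ultimately show "r \<in> colon J (a \<otimes> v)" using ab idealD[OF J] by (auto simp: colon_def)
    qed
    \<comment> \<open>So the class of a v is nonzero, and its annihilator contains that of v;
      maximality makes the two equal. Since b annihilates a v, it also annihilates v.\<close>
    have "a \<otimes> v \<notin> J" using ab by (auto simp: colon_def)
    then have "colon J (a \<otimes> v) \<in> ?S" using sub v ab by blast
    then have "colon J (a \<otimes> v) = colon J v" using I(2) v(4) sub by blast
    moreover have "b \<in> colon J (a \<otimes> v)" using ab v by (auto simp: colon_def m_assoc m_lcomm)
    ultimately show "b \<in> colon J v" by auto
  qed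
  then show ?thesis using v by (auto simp: ass_primes_def)
qed

text \<open>Noetherian induction along the exact sequence 0 -> R/Q -> R/J -> R/(J + vR) -> 0 with Q
  = (J : v): an associated prime of the middle term is Q or is associated to the last term.\<close>

lemma finite_ass_primes: "ideal J R \<Longrightarrow> finite (ass_primes J)"
proof (induction J rule: noetherian_induct)
  case (step J)
  note JD = idealD[OF step(1)]
  show ?case
  proof (cases "J = carrier R")
    case True
    then have "ass_primes J = {}"
      using primeidealD(2) by (fastforce simp: ass_primes_def colon_def)
    then show ?thesis by simp
  next
    case False
    then obtain u where "u \<in> carrier R" "u \<notin> J" using JD by auto
    then obtain Q where "Q \<in> ass_primes J" using ex_ass_prime[OF step(1)] by blast
    then obtain v where Q: "primeideal Q R" and v: "v \<in> carrier R" "Q = colon J v"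
      by (auto simp: ass_primes_def)
    let ?J' = "ideal_insert v J"
    have vJ: "v \<notin> J" using primeidealD(2)[OF Q] v by (auto simp: colon_def)
    have J': "ideal ?J' R" "J \<subset> ?J'"
      using ideal_insert_ideal subset_ideal_insert elem_ideal_insert step(1) v vJ by blast+
    have "ass_primes J \<subseteq> insert Q (ass_primes ?J')"
    proof
      fix P assume "P \<in> ass_primes J"
      then obtain w where P: "primeideal P R" and w: "w \<in> carrier R" "P = colon J w"
        by (auto simp: ass_primes_def)
      \<comment> \<open>Either some multiple b w is a nonzero class in the submodule generated by v,
        which is a copy of R/Q, or none is. In the first case b w has annihilator P, being a nonzero
        element of a copy of R/P, and annihilator Q, so P = Q. In the second case w has the same
        annihilator in R/(J + vR).\<close>
      show "P \<in> insert Q (ass_primes ?J')"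
      proof (cases "\<exists>b\<in>carrier R. b \<otimes> w \<in> ?J' \<and> b \<otimes> w \<notin> J")
        case True
        then obtain b where b: "b \<in> carrier R" "b \<otimes> w \<in> ?J'" "b \<otimes> w \<notin> J" by auto
        then obtain a where a: "a \<in> carrier R" "b \<otimes> w \<ominus> v \<otimes> a \<in> J"
          using ideal_insert_iff[OF step(1) v(1)] w by auto
        have bP: "b \<notin> P" using b w by (auto simp: colon_def)
        have "r \<in> P \<longleftrightarrow> r \<otimes> (b \<otimes> w) \<in> J" if r: "r \<in> carrier R" for r
        proof -
          have "r \<otimes> (b \<otimes> w) = (r \<otimes> b) \<otimes> w" using r b w by algebra
          then have "r \<otimes> (b \<otimes> w) \<in> J \<longleftrightarrow> r \<otimes> b \<in> P" using r b w by (auto simp: colon_def)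
          also have "\<dots> \<longleftrightarrow> r \<in> P"
            using primeidealD(3)[OF P r b(1)] bP idealD(8)[OF primeidealD(1)[OF P] b(1)] by blast
          finally show ?thesis by simp
        qed
        moreover have shift: "r \<otimes> (b \<otimes> w) \<in> J \<longleftrightarrow> r \<otimes> a \<in> Q" if r: "r \<in> carrier R" for r
        proof -
          let ?e = "r \<otimes> (b \<otimes> w \<ominus> v \<otimes> a)"
          have e: "?e \<in> J" using JD r a by auto
          have 1: "r \<otimes> (b \<otimes> w) = ?e \<oplus> (r \<otimes> a) \<otimes> v" using r a b(1) v(1) w(1) by algebra
          have "r \<otimes> (b \<otimes> w) \<in> J \<longleftrightarrow> (r \<otimes> a) \<otimes> v \<in> J"
            unfolding 1 using ideal_add_cancel(2)[OF step(1) e] r a v by simp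
          then show ?thesis using r a v by (auto simp: colon_def)
        qed
        moreover have "a \<notin> Q" using shift[of \<one>] b w a by auto
        then have "r \<otimes> a \<in> Q \<longleftrightarrow> r \<in> Q" if r: "r \<in> carrier R" for r
          using primeidealD(3)[OF Q r a(1)] idealD(8)[OF primeidealD(1)[OF Q] a(1)] by blast
        ultimately have "r \<in> P \<longleftrightarrow> r \<in> Q" if "r \<in> carrier R" for r using that by blast
        then have "P = Q"
          using idealD(1)[OF primeidealD(1)[OF P]] idealD(1)[OF primeidealD(1)[OF Q]] by blast
        then show ?thesis by simp
      next
        case False
        then have "P = colon ?J' w" using w J' by (auto simp: colon_def)
        then show ?thesis using P w by (auto simp: ass_primes_def)
      qed
    qed
    then show ?thesis using step(2)[OF J'] finite_subset by blast
  qed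
qed

lemma nzd_mod_iff_ass_primes:
  assumes J: "ideal J R" and x: "x \<in> carrier R"
  shows "nzd_mod J x \<longleftrightarrow> (\<forall>Q\<in>ass_primes J. x \<notin> Q)"
proof
  assume nz: "nzd_mod J x"
  show "\<forall>Q\<in>ass_primes J. x \<notin> Q"
  proof
    fix Q assume "Q \<in> ass_primes J"
    then obtain u where u: "primeideal Q R" "u \<in> carrier R" "Q = colon J u"
      by (auto simp: ass_primes_def)
    then have "u \<notin> J" using primeidealD(2)[OF u(1)] by (auto simp: colon_def)
    then show "x \<notin> Q" using nz u by (auto simp: nzd_mod_def colon_def)
  qed
next
  assume *: "\<forall>Q\<in>ass_primes J. x \<notin> Q"
  show "nzd_mod J x" unfolding nzd_mod_def
  proof (intro conjI ballI impI x)
    fix a assume a: "a \<in> carrier R" "x \<otimes> a \<in> J"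
    show "a \<in> J"
    proof (rule ccontr)
      assume "a \<notin> J"
      then obtain Q where "Q \<in> ass_primes J" "colon J a \<subseteq> Q" using ex_ass_prime[OF J] a by blast
      then show False using * a x by (auto simp: colon_def)
    qed
  qed
qed

text \<open>Prime avoidance for all associated primes of all members of the family at once. Families
  are allowed because the exchange argument in \<open>depth_ge_ideal_insert\<close> needs one
  element that is regular modulo three ideals.\<close>

lemma ex_nzd_mod:
  assumes "finite \<J>" "\<And>J. J \<in> \<J> \<Longrightarrow> ideal J R" "ideal I R"
    and "\<And>J Q. \<lbrakk>J \<in> \<J>; Q \<in> ass_primes J\<rbrakk> \<Longrightarrow> \<not> I \<subseteq> Q"
  shows "\<exists>z\<in>I. \<forall>J\<in>\<J>. nzd_mod J z"
proof -
  have "finite (\<Union>J\<in>\<J>. ass_primes J)" using assms finite_ass_primes by auto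
  moreover have "primeideal Q R" if "Q \<in> (\<Union>J\<in>\<J>. ass_primes J)" for Q
    using that by (auto simp: ass_primes_def)
  ultimately have "\<not> I \<subseteq> \<Union>(\<Union>J\<in>\<J>. ass_primes J)"
    using prime_avoidance[of "\<Union>J\<in>\<J>. ass_primes J" I] assms by blast
  then obtain z where z: "z \<in> I" "z \<notin> \<Union>(\<Union>J\<in>\<J>. ass_primes J)"
    by (meson subsetI)
  then have "\<forall>J\<in>\<J>. nzd_mod J z"
    using nzd_mod_iff_ass_primes idealD[OF assms(3)] assms(2) by auto
  then show ?thesis using z by auto
qed

text \<open>An ideal over \<open>J\<close> maximal among those disjoint from the products \<open>s a\<^sup>n\<close> with \<open>s \<notin> P\<close> is prime.\<close>

lemma ex_smaller_prime:
  assumes J: "ideal J R" and P: "primeideal P R" "J \<subseteq> P" and a: "nzd_mod J a" "a \<in> P"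
  shows "\<exists>Q. primeideal Q R \<and> J \<subseteq> Q \<and> Q \<subset> P"
proof -
  have aR: "a \<in> carrier R" using a by (auto simp: nzd_mod_def)
  note PD = idealD[OF primeidealD(1)[OF P(1)]]
  define S where "S = {s \<otimes> a [^] n | s (n::nat). s \<in> carrier R - P}"
  have nzd_pow: "s \<in> J" if "s \<in> carrier R" "s \<otimes> a [^] (n::nat) \<in> J" for s n
    using that(2)
  proof (induction n)
    case (Suc n)
    have "s \<otimes> a [^] Suc n = a \<otimes> (s \<otimes> a [^] n)" using that(1) aR by (simp add: m_ac)
    then have "a \<otimes> (s \<otimes> a [^] n) \<in> J" using Suc by simp
    then have "s \<otimes> a [^] n \<in> J" using a that(1) aR by (auto simp: nzd_mod_def)
    then show ?case by (rule Suc.IH)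
  qed (use that in auto)
  have SR: "S \<subseteq> carrier R" using aR by (auto simp: S_def)
  have S_mult: "x \<otimes> y \<in> S" if "x \<in> S" "y \<in> S" for x y
  proof -
    obtain s n t k where st: "s \<in> carrier R - P" "t \<in> carrier R - P"
      "x = s \<otimes> a [^] (n::nat)" "y = t \<otimes> a [^] (k::nat)" using \<open>x \<in> S\<close> \<open>y \<in> S\<close> by (auto simp: S_def)
    have "x \<otimes> y = (s \<otimes> t) \<otimes> a [^] (n + k)"
      using st aR by (auto simp: m_ac simp flip: nat_pow_mult)
    moreover have "s \<otimes> t \<in> carrier R - P" using primeidealD(3)[OF P(1), of s t] st by auto
    ultimately show ?thesis unfolding S_def by blast
  qed
  have "\<one> \<in> carrier R - P" using primeidealD(2)[OF P(1)] by auto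
  have SI: "y \<in> S" if "s \<in> carrier R - P" "y = s \<otimes> a [^] (n::nat)" for y s n
    using that by (auto simp: S_def)
  have notP_S: "s \<in> S" if "s \<in> carrier R - P" for s
    using SI[OF that, of s 0] that by simp
  have oneS: "\<one> \<in> S" using notP_S \<open>\<one> \<in> carrier R - P\<close> by blast
  have aS: "a \<in> S" using SI[OF \<open>\<one> \<in> carrier R - P\<close>, of a 1] aR by simp
  \<comment> \<open>Regularity of \<open>a\<close> enters here: if s a^n lies in J, then so does s,
    against J \<subseteq> P.\<close>
  have JS: "J \<inter> S = {}"
    using nzd_pow P(2) by (auto simp: S_def)
  let ?S = "{I. ideal I R \<and> J \<subseteq> I \<and> I \<inter> S = {}}"
  have "\<exists>I\<in>?S. \<forall>K\<in>?S. I \<subseteq> K \<longrightarrow> K = I"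
    by (rule ex_maximal_ideal_in) (use J JS in auto)
  then obtain Q where "Q \<in> ?S" and max': "\<forall>K\<in>?S. Q \<subseteq> K \<longrightarrow> K = Q" by blast
  then have Q: "ideal Q R" "J \<subseteq> Q" "Q \<inter> S = {}" by auto
  have max: "I = Q" if "ideal I R" "J \<subseteq> I" "I \<inter> S = {}" "Q \<subseteq> I" for I
    using max' that by simp
  note QD = idealD[OF Q(1)]
  have "primeideal Q R"
  proof (rule prime_idealI[OF Q(1)])
    show "\<one> \<notin> Q" using oneS Q by auto
    fix x y assume xy: "x \<in> carrier R" "y \<in> carrier R" "x \<otimes> y \<in> Q" "x \<notin> Q"
    show "y \<in> Q"
    proof (rule ccontr)
      assume "y \<notin> Q"
      have meet: "\<exists>s\<in>S. \<exists>q\<in>Q. \<exists>r\<in>carrier R. s = q \<oplus> z \<otimes> r" if z: "z \<in> carrier R" "z \<notin> Q" for z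
      proof -
        have "ideal_insert z Q \<noteq> Q" using elem_ideal_insert[OF Q(1) z(1)] z(2) by auto
        then have "ideal_insert z Q \<inter> S \<noteq> {}"
          using max ideal_insert_ideal[OF Q(1) z(1)] subset_ideal_insert[OF Q(1) z(1)] Q(2)
          by blast
        then show ?thesis by (auto simp: ideal_insert_def)
      qed
      obtain s q r where 1: "s \<in> S" "q \<in> Q" "r \<in> carrier R" "s = q \<oplus> x \<otimes> r"
        using meet[OF xy(1,4)] by auto
      obtain t p k where 2: "t \<in> S" "p \<in> Q" "k \<in> carrier R" "t = p \<oplus> y \<otimes> k"
        using meet[OF xy(2) \<open>y \<notin> Q\<close>] by auto
      have c: "q \<in> carrier R" "p \<in> carrier R" using 1 2 QD by auto
      have eq: "s \<otimes> t = t \<otimes> q \<oplus> (x \<otimes> r) \<otimes> p \<oplus> (r \<otimes> k) \<otimes> (x \<otimes> y)"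
        unfolding 1(4) 2(4) using c 1(3) 2(3) xy(1,2) by algebra
      have "t \<in> carrier R" using 2 SR by auto
      then have "t \<otimes> q \<in> Q" "(x \<otimes> r) \<otimes> p \<in> Q" "(r \<otimes> k) \<otimes> (x \<otimes> y) \<in> Q"
        using QD(7) 1(2,3) 2(2,3) xy by simp_all
      then have "s \<otimes> t \<in> Q" unfolding eq using QD(4) by simp
      then show False using S_mult[OF 1(1) 2(1)] Q by auto
    qed
  qed
  moreover have "Q \<subseteq> P"
  proof
    fix x assume "x \<in> Q"
    then show "x \<in> P" using notP_S[of x] Q(3) QD(2) by auto
  qed
  moreover have "a \<notin> Q" using aS Q by auto
  ultimately have "primeideal Q R \<and> J \<subseteq> Q \<and> Q \<subset> P" using Q(2) a(2) by auto
  then show ?thesis by (rule exI)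
qed

end

section \<open>Regular sequences and depth\<close>

sublocale noetherian_local_ring \<subseteq> noetherian_cring R
  by unfold_locales

context cring
begin

text \<open>The ideal generated by \<open>x 0\<close>, ..., \<open>x (k - 1)\<close>. Sequences are
  functions with a separate length, so that extending one at position k is the update
  \<open>x(k := z)\<close>, which leaves the ideals up to index k unchanged.\<close>

primrec seq_ideal :: "(nat \<Rightarrow> 'a) \<Rightarrow> nat \<Rightarrow> 'a set" where
  "seq_ideal x 0 = {\<zero>}"
| "seq_ideal x (Suc k) = ideal_insert (x k) (seq_ideal x k)"

lemma seq_ideal_ideal: "(\<And>i. i < k \<Longrightarrow> x i \<in> carrier R) \<Longrightarrow> ideal (seq_ideal x k) R"
  by (induction k) (simp_all add: zeroideal ideal_insert_ideal)

lemma seq_ideal_cong: "(\<And>i. i < k \<Longrightarrow> x i = y i) \<Longrightarrow> seq_ideal x k = seq_ideal y k"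
  by (induction k) simp_all

lemma seq_ideal_subset:
  assumes "ideal I R" "\<And>i. i < k \<Longrightarrow> x i \<in> I"
  shows "seq_ideal x k \<subseteq> I"
  using assms(2)
proof (induction k)
  case 0
  then show ?case using ideal_zero[OF assms(1)] by simp
next
  case (Suc k)
  then show ?case by (simp add: ideal_insert_minimal[OF assms(1)])
qed

lemma Idl_insert_eq_ideal_insert:
  assumes "A \<subseteq> carrier R" "x \<in> carrier R"
  shows "Idl (insert x A) = ideal_insert x (Idl A)"
proof (rule equalityI)
  have xA: "insert x A \<subseteq> carrier R" and A: "ideal (Idl A) R"
    using assms genideal_ideal by simp_all
  note self = genideal_self[OF xA] genideal_self[OF assms(1)]
  show "Idl (insert x A) \<subseteq> ideal_insert x (Idl A)"
    using elem_ideal_insert[OF A assms(2)] subset_ideal_insert[OF A assms(2)] self(2)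
    by (intro genideal_minimal ideal_insert_ideal A assms(2)) auto
  show "ideal_insert x (Idl A) \<subseteq> Idl (insert x A)"
    using self(1) by (intro ideal_insert_minimal genideal_ideal[OF xA] subset_Idl_subset[OF xA]) auto
qed

lemma nonzerodivisor_Quot_imp_nzd_mod:
  assumes I: "ideal I R" and x: "x \<in> carrier R" and nz: "nonzerodivisor (R Quot I) (I +> x)"
  shows "nzd_mod I x"
  unfolding nzd_mod_def
proof (intro conjI ballI impI x)
  interpret I: ideal I R by fact
  fix a assume a: "a \<in> carrier R" "x \<otimes> a \<in> I"
  have "(I +> x) \<otimes>\<^bsub>R Quot I\<^esub> (I +> a) = I +> (x \<otimes> a)"
    using I.rcoset_mult_add[OF x a(1)] by (simp add: FactRing_def)
  also have "\<dots> = \<zero>\<^bsub>R Quot I\<^esub>"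
    using I.a_rcos_const[OF a(2)] by (simp add: FactRing_def)
  finally have "I +> a = \<zero>\<^bsub>R Quot I\<^esub>"
    using nz a(1) a_rcosetsI[OF I.a_subset a(1)] by (simp add: nonzerodivisor_def FactRing_def)
  then show "a \<in> I" using I.rcos_const_imp_mem[OF a(1)] by (simp add: FactRing_def)
qed

lemma regular_sequence_imp_nzd_mod:
  assumes "regular_sequence R xs" "k < length xs"
  shows "nzd_mod (seq_ideal ((!) xs) k) (xs ! k)"
proof -
  have xs: "set xs \<subseteq> carrier R" using assms by (simp add: regular_sequence_def)
  have eq: "Idl (set (take i xs)) = seq_ideal ((!) xs) i" if "i \<le> length xs" for i
    using that
  proof (induction i)
    case 0
    have "Idl {} = {\<zero>}"
    proof (rule equalityI)
      show "Idl {} \<subseteq> {\<zero>}" by (rule genideal_minimal[OF zeroideal]) simp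
      show "{\<zero>} \<subseteq> Idl {}" using ideal_zero[OF genideal_ideal[of "{}"]] by simp
    qed
    then show ?case by simp
  next
    case (Suc i)
    then have "set (take (Suc i) xs) = insert (xs ! i) (set (take i xs))"
      by (simp add: take_Suc_conv_app_nth)
    moreover have "set (take i xs) \<subseteq> carrier R" using xs set_take_subset[of i xs] by (rule subset_trans[rotated])
    moreover have "xs ! i \<in> carrier R" using Suc xs nth_mem[of i xs] by auto
    ultimately show ?case using Suc Idl_insert_eq_ideal_insert by simp
  qed
  have "xs ! k \<in> carrier R" using assms xs nth_mem[of k xs] by auto
  moreover have "nonzerodivisor (R Quot Idl (set (take k xs))) (Idl (set (take k xs)) +> xs ! k)"
    using assms by (simp add: regular_sequence_def Let_def)
  then have "nonzerodivisor (R Quot seq_ideal ((!) xs) k) (seq_ideal ((!) xs) k +> xs ! k)"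
    using assms(2) eq[of k] by simp
  moreover have "ideal (seq_ideal ((!) xs) k) R"
  proof (rule seq_ideal_ideal)
    fix i assume "i < k"
    then show "xs ! i \<in> carrier R" using nth_mem[of i xs] assms(2) xs by auto
  qed
  ultimately show ?thesis using nonzerodivisor_Quot_imp_nzd_mod by simp
qed

end

text \<open>A prime containing a regular sequence of length n has height at least n. The chain is
  built downwards: the last element, regular modulo the others, allows P to be replaced by a smaller
  prime that still contains the others.\<close>

lemma (in noetherian_cring) ex_prime_chain:
  assumes "primeideal P R" "\<And>k. k < n \<Longrightarrow> x k \<in> P" "\<And>k. k < n \<Longrightarrow> nzd_mod (seq_ideal x k) (x k)"
  shows "\<exists>Q. (\<forall>i\<le>n. primeideal (Q i) R) \<and> (\<forall>i<n. Q i \<subset> Q (Suc i)) \<and> Q n = P"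
  using assms
proof (induction n arbitrary: P)
  case 0
  then show ?case by (intro exI[of _ "\<lambda>_. P"]) simp
next
  case (Suc n)
  note PI = primeidealD(1)[OF Suc.prems(1)]
  have J: "ideal (seq_ideal x n) R" "seq_ideal x n \<subseteq> P"
    using Suc.prems(2) ideal_carrier[OF PI] seq_ideal_subset[OF PI] by (auto intro: seq_ideal_ideal)
  have "nzd_mod (seq_ideal x n) (x n)" "x n \<in> P" using Suc.prems(2,3) by simp_all
  then obtain P' where P': "primeideal P' R" "seq_ideal x n \<subseteq> P'" "P' \<subset> P"
    using ex_smaller_prime[OF J(1) Suc.prems(1) J(2), of "x n"] by blast
  have "x k \<in> P'" if "k < n" for k
  proof -
    have sub: "seq_ideal x (Suc k) \<subseteq> seq_ideal x m" if "Suc k \<le> m" "m \<le> n" for m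
      using that
    proof (induction m rule: dec_induct)
      case (step m)
      have "ideal (seq_ideal x m) R" "x m \<in> carrier R"
        using Suc.prems(2) ideal_carrier[OF PI] step.prems by (auto intro: seq_ideal_ideal)
      then show ?case using subset_ideal_insert step by fastforce
    qed simp
    have "seq_ideal x (Suc k) \<subseteq> P'"
      by (rule subset_trans[OF sub[of n] P'(2)]) (use \<open>k < n\<close> in simp_all)
    moreover have "ideal (seq_ideal x k) R" "x k \<in> carrier R"
      using Suc.prems(2) ideal_carrier[OF PI] \<open>k < n\<close> by (auto intro: seq_ideal_ideal)
    ultimately show ?thesis using elem_ideal_insert by auto
  qed
  then obtain Q where Q: "\<forall>i\<le>n. primeideal (Q i) R" "\<forall>i<n. Q i \<subset> Q (Suc i)" "Q n = P'"
    using Suc.IH[OF P'(1)] Suc.prems(3) by auto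
  show ?case
    using Q P'(3) Suc.prems(1) by (intro exI[of _ "Q(Suc n := P)"]) (auto simp: le_Suc_eq less_Suc_eq)
qed

section \<open>Depth of R/J over a local ring\<close>

context noetherian_local_ring
begin

lemma max_ideal: "ideal \<mm> R"
  by (rule is_ideal)

lemma max_prime: "primeideal \<mm> R"
  by (rule maximalideal_prime[OF is_maximalideal])

lemma max_carrier: "x \<in> \<mm> \<Longrightarrow> x \<in> carrier R"
  by (rule ideal_carrier[OF max_ideal])

lemma proper_ideal_subset_max:
  assumes I: "ideal I R" "\<one> \<notin> I"
  shows "I \<subseteq> \<mm>"
proof -
  let ?S = "{K. ideal K R \<and> I \<subseteq> K \<and> \<one> \<notin> K}"
  have "\<exists>K\<in>?S. \<forall>L\<in>?S. K \<subseteq> L \<longrightarrow> L = K"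
    by (rule ex_maximal_ideal_in) (use I in auto)
  then obtain K where K: "K \<in> ?S" and max: "\<forall>L\<in>?S. K \<subseteq> L \<longrightarrow> L = K" by blast
  have "maximalideal K R"
  proof (rule maximalidealI)
    show "ideal K R" "carrier R \<noteq> K" using K one_closed by auto
    fix L assume L: "ideal L R" "K \<subseteq> L" "L \<subseteq> carrier R"
    show "L = K \<or> L = carrier R"
    proof (cases "\<one> \<in> L")
      case True
      then show ?thesis using ideal.one_imp_carrier[OF L(1)] by simp
    next
      case False
      then have "L \<in> ?S" using L K by auto
      then show ?thesis using max L(2) by simp
    qed
  qed
  then have "K = \<mm>" by (rule maximal_unique)
  then show ?thesis using K by simp
qed

lemma prime_subset_max: "primeideal P R \<Longrightarrow> P \<subseteq> \<mm>"
  using proper_ideal_subset_max primeidealD by simp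

text \<open>Here 1 - x is a unit, as it lies outside the maximal ideal. This takes the place of
  Nakayama's lemma in \<open>ass_prime_not_coheight_1\<close>.\<close>

lemma one_minus_max_cancel:
  assumes J: "ideal J R" and x: "x \<in> \<mm>" and v: "v \<in> carrier R" and "(\<one> \<ominus> x) \<otimes> v \<in> J"
  shows "v \<in> J"
proof -
  have xR: "x \<in> carrier R" using max_carrier x .
  let ?I = "ideal_insert (\<one> \<ominus> x) {\<zero>}"
  have c: "\<one> \<ominus> x \<in> carrier R" using xR by simp
  have I: "ideal ?I R" "\<one> \<ominus> x \<in> ?I"
    using ideal_insert_ideal[OF zeroideal c] elem_ideal_insert[OF zeroideal c] .
  have "\<one> \<in> ?I"
  proof (rule ccontr)
    assume "\<one> \<notin> ?I"
    then have "\<one> \<ominus> x \<in> \<mm>" using proper_ideal_subset_max[OF I(1)] I(2) by auto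
    moreover have "(\<one> \<ominus> x) \<oplus> x = \<one>" using xR by algebra
    ultimately have "\<one> \<in> \<mm>" using ideal_add[OF max_ideal _ x, of "\<one> \<ominus> x"] by simp
    then show False using primeidealD(2)[OF max_prime] by simp
  qed
  then obtain s where s: "s \<in> carrier R" "\<one> = (\<one> \<ominus> x) \<otimes> s" using c by (auto simp: ideal_insert_def)
  have "s \<otimes> ((\<one> \<ominus> x) \<otimes> v) = ((\<one> \<ominus> x) \<otimes> s) \<otimes> v" using s(1) v c by (simp add: m_ac)
  also have "\<dots> = v" using s(2)[symmetric] v by simp
  finally show ?thesis using ideal_mult[OF J s(1) assms(4)] by simp
qed

text \<open>Existence of a regular sequence of length n on R/J in the maximal ideal. The base clause
  says that the final quotient is nonzero. Each step is existential; that every regular element can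
  serve as the first one is the content of \<open>depth_ge_ideal_insert\<close>.\<close>

primrec depth_ge :: "nat \<Rightarrow> 'a set \<Rightarrow> bool" where
  "depth_ge 0 J \<longleftrightarrow> J \<subseteq> \<mm>"
| "depth_ge (Suc n) J \<longleftrightarrow> (\<exists>x\<in>\<mm>. nzd_mod J x \<and> depth_ge n (ideal_insert x J))"

lemma depth_ge_subset: "\<lbrakk>depth_ge n J; ideal J R\<rbrakk> \<Longrightarrow> J \<subseteq> \<mm>"
proof (induction n arbitrary: J)
  case (Suc n)
  then obtain x where x: "x \<in> \<mm>" "depth_ge n (ideal_insert x J)" by auto
  then have "ideal_insert x J \<subseteq> \<mm>"
    using Suc.IH ideal_insert_ideal[OF Suc.prems(2) max_carrier[OF x(1)]] by simp
  then show ?case using subset_ideal_insert[OF Suc.prems(2) max_carrier[OF x(1)]] by simp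
qed simp

lemma depth_ge_SucD: "\<lbrakk>depth_ge (Suc n) J; ideal J R\<rbrakk> \<Longrightarrow> depth_ge n J"
proof (induction n arbitrary: J)
  case 0
  from depth_ge_subset[OF 0(1,2)] show ?case by simp
next
  case (Suc n)
  then obtain x where x: "x \<in> \<mm>" "nzd_mod J x" "depth_ge (Suc n) (ideal_insert x J)" by auto
  then have "depth_ge n (ideal_insert x J)"
    using Suc.IH ideal_insert_ideal[OF Suc.prems(2) max_carrier[OF x(1)]] by simp
  then show ?case using x by auto
qed

lemma depth_ge_mono: "\<lbrakk>depth_ge n J; ideal J R; k \<le> n\<rbrakk> \<Longrightarrow> depth_ge k J"
  by (induction n) (auto simp: le_Suc_eq simp del: depth_ge.simps(2) dest: depth_ge_SucD)

lemma max_not_subset_ass_prime: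
  assumes "ideal J R" "nzd_mod J y" "y \<in> \<mm>" "Q \<in> ass_primes J"
  shows "\<not> \<mm> \<subseteq> Q"
  using assms nzd_mod_iff_ass_primes[OF assms(1) max_carrier[OF assms(3)]] by auto

text \<open>Positive depth of R/(J + xR) passes to R/(J + yR). Both socles are isomorphic to
  Ext^1(k, R/J) for the residue field k; explicitly, a class u killed by the maximal ideal modulo J
  + yR goes to the v with x u = y v modulo J, which is nonzero and killed by the maximal ideal
  modulo J + xR.\<close>

lemma max_not_subset_ass_prime_exchange:
  assumes J: "ideal J R" and x: "x \<in> \<mm>" "nzd_mod J x" and y: "y \<in> \<mm>" "nzd_mod J y"
    and w: "w \<in> \<mm>" "nzd_mod (ideal_insert x J) w" and Q: "Q \<in> ass_primes (ideal_insert y J)"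
  shows "\<not> \<mm> \<subseteq> Q"
proof
  assume mQ: "\<mm> \<subseteq> Q"
  note xR = max_carrier[OF x(1)] and yR = max_carrier[OF y(1)] and JD = idealD[OF J]
  obtain u where u: "u \<in> carrier R" "Q = colon (ideal_insert y J) u" and Qp: "primeideal Q R"
    using Q by (auto simp: ass_primes_def)
  then have uJ: "u \<notin> ideal_insert y J" using primeidealD(2)[OF Qp] by (auto simp: colon_def)
  have mu: "\<exists>t\<in>carrier R. r \<otimes> u \<ominus> y \<otimes> t \<in> J" if "r \<in> \<mm>" for r
    using that mQ u ideal_insert_iff[OF J yR] max_carrier[OF that] by (auto simp: colon_def)
  obtain v where v: "v \<in> carrier R" "x \<otimes> u \<ominus> y \<otimes> v \<in> J" using mu[OF x(1)] by auto
  \<comment> \<open>If v = x c modulo J, then x (u - y c) is in J. Cancelling x makes u zero modulo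
    J + yR, which was excluded.\<close>
  have "v \<notin> ideal_insert x J"
  proof
    assume "v \<in> ideal_insert x J"
    then obtain c where c: "c \<in> carrier R" "v \<ominus> x \<otimes> c \<in> J" using ideal_insert_iff[OF J xR v(1)] by auto
    have "x \<otimes> (u \<ominus> y \<otimes> c) = (x \<otimes> u \<ominus> y \<otimes> v) \<oplus> y \<otimes> (v \<ominus> x \<otimes> c)"
      using xR yR u(1) v(1) c(1) by algebra
    then have "x \<otimes> (u \<ominus> y \<otimes> c) \<in> J" using JD(4)[OF v(2) JD(7)[OF yR c(2)]] by simp
    then have "u \<ominus> y \<otimes> c \<in> J" using x(2) u(1) yR c(1) by (simp add: nzd_mod_def)
    then show False using uJ ideal_insert_iff[OF J yR u(1)] c(1) by auto
  qed
  then obtain Q' where Q': "Q' \<in> ass_primes (ideal_insert x J)" "colon (ideal_insert x J) v \<subseteq> Q'"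
    using ex_ass_prime[OF ideal_insert_ideal[OF J xR] v(1)] by auto
  \<comment> \<open>With r u = y t modulo J, both y (r v) and y (x t) equal r x u modulo J;
    cancelling y gives r v = x t.\<close>
  have "\<mm> \<subseteq> colon (ideal_insert x J) v"
  proof
    fix r assume r: "r \<in> \<mm>"
    note rR = max_carrier[OF r]
    obtain t where t: "t \<in> carrier R" "r \<otimes> u \<ominus> y \<otimes> t \<in> J" using mu[OF r] by auto
    have "y \<otimes> (r \<otimes> v \<ominus> x \<otimes> t) = x \<otimes> (r \<otimes> u \<ominus> y \<otimes> t) \<ominus> r \<otimes> (x \<otimes> u \<ominus> y \<otimes> v)"
      using xR yR u(1) v(1) rR t(1) by algebra
    then have "y \<otimes> (r \<otimes> v \<ominus> x \<otimes> t) \<in> J"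
      using JD(5)[OF JD(7)[OF xR t(2)] JD(7)[OF rR v(2)]] by simp
    then have "r \<otimes> v \<ominus> x \<otimes> t \<in> J" using y(2) xR v(1) rR t(1) by (simp add: nzd_mod_def)
    then show "r \<in> colon (ideal_insert x J) v"
      using ideal_insert_iff[OF J xR, of "r \<otimes> v"] t(1) rR v(1) by (auto simp: colon_def)
  qed
  then have "\<mm> \<subseteq> Q'" using Q' by simp
  then show False using max_not_subset_ass_prime[OF ideal_insert_ideal[OF J xR] w(2,1) Q'(1)] by simp
qed

text \<open>The nonzerodivisors \<open>x\<close> and \<open>y\<close> are compared through a third one that can be permuted with both.\<close>

lemma depth_ge_ideal_insert:
  "\<lbrakk>depth_ge (Suc n) J; ideal J R; y \<in> \<mm>; nzd_mod J y\<rbrakk> \<Longrightarrow> depth_ge n (ideal_insert y J)"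
proof (induction n arbitrary: J y)
  case 0
  then show ?case using depth_ge_subset[OF 0(1,2)] by (simp add: ideal_insert_minimal[OF max_ideal])
next
  case (Suc n)
  note J = \<open>ideal J R\<close> and y = \<open>y \<in> \<mm>\<close> \<open>nzd_mod J y\<close>
  obtain x where x: "x \<in> \<mm>" "nzd_mod J x" and dx: "depth_ge (Suc n) (ideal_insert x J)"
    using Suc.prems(1) by auto
  then obtain w where w: "w \<in> \<mm>" "nzd_mod (ideal_insert x J) w" by auto
  note xR = max_carrier[OF x(1)] and yR = max_carrier[OF y(1)]
  note Jx = ideal_insert_ideal[OF J xR] and Jy = ideal_insert_ideal[OF J yR]
  \<comment> \<open>The maximal ideal is associated to none of the three quotients: y is regular
    modulo J, w is regular modulo J + xR, and the case J + yR is the exchange lemma.\<close>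
  have "\<exists>z\<in>\<mm>. \<forall>K\<in>{J, ideal_insert x J, ideal_insert y J}. nzd_mod K z"
  proof (rule ex_nzd_mod[OF _ _ max_ideal])
    fix K Q assume "K \<in> {J, ideal_insert x J, ideal_insert y J}" and Q: "Q \<in> ass_primes K"
    then consider "K = J" | "K = ideal_insert x J" | "K = ideal_insert y J" by auto
    then show "\<not> \<mm> \<subseteq> Q"
      using max_not_subset_ass_prime[OF J y(2,1)] max_not_subset_ass_prime[OF Jx w(2,1)]
        max_not_subset_ass_prime_exchange[OF J x y w] Q by cases simp_all
  qed (use J Jx Jy in auto)
  then obtain z where z: "z \<in> \<mm>" "nzd_mod J z" "nzd_mod (ideal_insert x J) z" "nzd_mod (ideal_insert y J) z"
    by auto
  note zR = max_carrier[OF z(1)]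
  note Jz = ideal_insert_ideal[OF J zR]
  \<comment> \<open>Trade x for z, then z for y. The sequence x, z becomes z, x, which gives R/(J +
    zR) depth at least n + 1. The induction hypothesis then divides out y there, and z, y becomes y,
    z. The induction hypothesis is only applied to quotients by one more element, where the depth
    index is smaller.\<close>
  have "depth_ge n (ideal_insert z (ideal_insert x J))" by (rule Suc.IH[OF dx Jx z(1,3)])
  then have "depth_ge n (ideal_insert x (ideal_insert z J))" using ideal_insert_commute[OF J zR xR] by simp
  then have "depth_ge (Suc n) (ideal_insert z J)" using x(1) nzd_mod_swap[OF J x(2) z(3)] by auto
  then have "depth_ge n (ideal_insert y (ideal_insert z J))"
    using Suc.IH[OF _ Jz y(1)] nzd_mod_swap[OF J y(2) z(4)] by simp
  then have "depth_ge n (ideal_insert z (ideal_insert y J))" using ideal_insert_commute[OF J zR yR] by simp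
  then show ?case using z(1,4) by auto
qed

text \<open>The case of depth 2 of the inequality depth(R/J) \<le> dim(R/Q). Let U consist of the
  elements killed by Q modulo J. By a Nakayama argument U is not contained in J + xR, so some u in U
  is nonzero there. An associated prime of R/(J + xR) over the annihilator of u contains Q and x,
  hence is strictly larger than Q, and it is not the maximal ideal because w is regular modulo J +
  xR.\<close>

lemma ass_prime_not_coheight_1:
  assumes J: "ideal J R" and depth: "depth_ge 2 J" and Q: "Q \<in> ass_primes J"
  shows "\<exists>Q'. primeideal Q' R \<and> Q \<subset> Q' \<and> Q' \<subset> \<mm>"
proof -
  note JD = idealD[OF J]
  obtain x w where x: "x \<in> \<mm>" "nzd_mod J x" and w: "w \<in> \<mm>" "nzd_mod (ideal_insert x J) w"
    using depth by (auto simp: numeral_2_eq_2)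
  note xR = max_carrier[OF x(1)]
  note Jx = ideal_insert_ideal[OF J xR]
  obtain u0 where u0: "u0 \<in> carrier R" "Q = colon J u0" and Qp: "primeideal Q R"
    using Q by (auto simp: ass_primes_def)
  have u0J: "u0 \<notin> J" using u0 primeidealD(2)[OF Qp] by (auto simp: colon_def)
  have QR: "q \<in> carrier R" if "q \<in> Q" for q using ideal_carrier[OF primeidealD(1)[OF Qp] that] .
  define U where "U = {u \<in> carrier R. \<forall>q\<in>Q. q \<otimes> u \<in> J}"
  have "\<exists>u\<in>U. u \<notin> ideal_insert x J"
  proof (rule ccontr)
    assume none: "\<not> ?thesis"
    \<comment> \<open>Instead of Nakayama for U, take v in U outside J with J + vR maximal. Writing
      v = x v' modulo J puts v' in U, since x is regular, and enlarges the ideal; by maximality v'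
      is a multiple v a, so (1 - x a) v' lies in J.\<close>
    let ?S = "{ideal_insert v J | v. v \<in> U \<and> v \<notin> J}"
    have "u0 \<in> U" using u0 by (auto simp: U_def colon_def)
    then have "?S \<noteq> {}" using u0J by auto
    moreover have "ideal K R" if "K \<in> ?S" for K using that ideal_insert_ideal[OF J] by (auto simp: U_def)
    ultimately have "\<exists>K\<in>?S. \<forall>L\<in>?S. K \<subseteq> L \<longrightarrow> L = K" by (rule ex_maximal_ideal_in)
    then obtain v where v: "v \<in> U" "v \<notin> J"
      and max: "\<And>v'. \<lbrakk>v' \<in> U; v' \<notin> J; ideal_insert v J \<subseteq> ideal_insert v' J\<rbrakk> \<Longrightarrow>
        ideal_insert v' J = ideal_insert v J" by blast
    have vR: "v \<in> carrier R" using v by (simp add: U_def)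
    obtain j v' where v': "j \<in> J" "v' \<in> carrier R" "v = j \<oplus> x \<otimes> v'"
      using none v(1) by (auto simp: ideal_insert_def)
    have jR: "j \<in> carrier R" using JD(2) v'(1) .
    have "q \<otimes> v' \<in> J" if q: "q \<in> Q" for q
    proof -
      have "q \<otimes> v = q \<otimes> j \<oplus> x \<otimes> (q \<otimes> v')" unfolding v'(3) using xR jR v'(2) QR[OF q] by algebra
      moreover have "q \<otimes> v \<in> J" using v(1) q by (simp add: U_def)
      ultimately have "x \<otimes> (q \<otimes> v') \<in> J"
        using ideal_add_cancel(2)[OF J JD(7)[OF QR[OF q] v'(1)]] xR v'(2) QR[OF q] by simp
      then show ?thesis using x(2) v'(2) QR[OF q] by (simp add: nzd_mod_def)
    qed
    then have v'U: "v' \<in> U" using v'(2) by (simp add: U_def)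
    have v'J: "v' \<notin> J" using v(2) v' JD(4)[OF v'(1) JD(7)[OF xR]] by auto
    have Jv': "ideal (ideal_insert v' J) R" by (rule ideal_insert_ideal[OF J v'(2)])
    have "v \<in> ideal_insert v' J"
      by (rule ideal_insertI[where j = j and a = x]) (use v' xR in \<open>simp_all add: m_comm\<close>)
    then have "ideal_insert v J \<subseteq> ideal_insert v' J"
      by (rule ideal_insert_minimal[OF Jv' subset_ideal_insert[OF J v'(2)]])
    then have "v' \<in> ideal_insert v J" using max[OF v'U v'J] elem_ideal_insert[OF J v'(2)] by simp
    then obtain a where a: "a \<in> carrier R" "v' \<ominus> v \<otimes> a \<in> J" using ideal_insert_iff[OF J vR v'(2)] by auto
    have "(\<one> \<ominus> x \<otimes> a) \<otimes> v' = (v' \<ominus> v \<otimes> a) \<oplus> a \<otimes> j"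
      unfolding v'(3) using a(1) xR jR v'(2) by algebra
    then have "(\<one> \<ominus> x \<otimes> a) \<otimes> v' \<in> J" using JD(4)[OF a(2) JD(7)[OF a(1) v'(1)]] by simp
    then have "v' \<in> J" using one_minus_max_cancel[OF J ideal_mult'[OF max_ideal a(1) x(1)] v'(2)] by simp
    then show False using v'J by simp
  qed
  then obtain u where u: "u \<in> U" "u \<notin> ideal_insert x J" by auto
  then obtain Q' where Q': "Q' \<in> ass_primes (ideal_insert x J)" "colon (ideal_insert x J) u \<subseteq> Q'"
    using ex_ass_prime[OF Jx _ u(2)] by (auto simp: U_def)
  have "Q \<subseteq> Q'"
  proof
    fix q assume q: "q \<in> Q"
    then have "q \<otimes> u \<in> ideal_insert x J" using u(1) subset_ideal_insert[OF J xR] by (auto simp: U_def)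
    then show "q \<in> Q'" using Q'(2) QR[OF q] by (auto simp: colon_def)
  qed
  moreover have "x \<in> Q'"
  proof -
    have "u \<in> carrier R" using u by (simp add: U_def)
    then have "x \<otimes> u \<in> ideal_insert x J" using ideal_mult'[OF Jx _ elem_ideal_insert[OF J xR]] by simp
    then show ?thesis using Q'(2) xR by (auto simp: colon_def)
  qed
  moreover have "x \<notin> Q" using Q x(2) nzd_mod_iff_ass_primes[OF J xR] by simp
  moreover have "primeideal Q' R" using Q'(1) by (simp add: ass_primes_def)
  moreover have "\<not> \<mm> \<subseteq> Q'" by (rule max_not_subset_ass_prime[OF Jx w(2,1) Q'(1)])
  ultimately have "primeideal Q' R \<and> Q \<subset> Q' \<and> Q' \<subset> \<mm>" using prime_subset_max[of Q'] by auto
  then show ?thesis by (rule exI)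
qed

text \<open>The assumption \<open>dim\<close> says that primes over I have coheight at most 1. As
  long as the quotient has depth at least 2, none of them lies below an associated prime, so I
  contains a regular element. From depth n + 1 this permits n choices and leaves depth 1.\<close>

lemma ex_regular_seq_in_ideal:
  assumes I: "ideal I R" "I \<subseteq> \<mm>" and depth: "depth_ge (Suc n) {\<zero>}"
    and dim: "\<And>Q Q'. \<lbrakk>primeideal Q R; primeideal Q' R; I \<subseteq> Q; Q \<subset> Q'\<rbrakk> \<Longrightarrow> Q' = \<mm>"
  shows "\<exists>x. (\<forall>k<n. x k \<in> I \<and> nzd_mod (seq_ideal x k) (x k)) \<and> depth_ge 1 (seq_ideal x n)"
proof -
  have "\<exists>x. (\<forall>i<k. x i \<in> I \<and> nzd_mod (seq_ideal x i) (x i)) \<and> depth_ge (Suc n - k) (seq_ideal x k)"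
    if "k \<le> n" for k
    using that
  proof (induction k)
    case 0
    then show ?case using depth by simp
  next
    case (Suc k)
    then obtain x where x: "\<forall>i<k. x i \<in> I \<and> nzd_mod (seq_ideal x i) (x i)"
      and dx: "depth_ge (Suc n - k) (seq_ideal x k)" by auto
    let ?J = "seq_ideal x k"
    have J: "ideal ?J R" using x ideal_carrier[OF I(1)] by (auto intro: seq_ideal_ideal)
    \<comment> \<open>Since k < n, the remaining depth n + 1 - k is at least 2.\<close>
    have "depth_ge 2 ?J" using depth_ge_mono[OF dx J, of 2] Suc.prems by simp
    then have "\<not> I \<subseteq> Q" if "Q \<in> ass_primes ?J" for Q
      using ass_prime_not_coheight_1[OF J _ that] dim[of Q] that by (auto simp: ass_primes_def)
    then obtain z where z: "z \<in> I" "nzd_mod ?J z"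
      using ex_nzd_mod[of "{?J}" I] J I(1) by auto
    let ?x = "x(k := z)"
    have eq: "seq_ideal ?x i = seq_ideal x i" if "i \<le> k" for i
      using that by (intro seq_ideal_cong) auto
    have "depth_ge (Suc (n - k)) ?J" using dx Suc.prems by (simp add: Suc_diff_le del: depth_ge.simps)
    then have "depth_ge (n - k) (ideal_insert z ?J)"
      using depth_ge_ideal_insert[OF _ J _ z(2)] z(1) I(2) by auto
    then have "depth_ge (Suc n - Suc k) (seq_ideal ?x (Suc k))" using eq[of k] by simp
    moreover have "\<forall>i<Suc k. ?x i \<in> I \<and> nzd_mod (seq_ideal ?x i) (?x i)"
      using x z eq by (auto simp: less_Suc_eq)
    ultimately show ?case by blast
  qed
  from this[of n] show ?thesis by simp
qed

lemma depth_ge_of_seq: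
  assumes "\<And>k. k < n \<Longrightarrow> x k \<in> \<mm>" "\<And>k. k < n \<Longrightarrow> nzd_mod (seq_ideal x k) (x k)"
  shows "depth_ge n {\<zero>}"
proof -
  have "depth_ge k (seq_ideal x (n - k))" if "k \<le> n" for k
    using that
  proof (induction k)
    case 0
    then show ?case using seq_ideal_subset[OF max_ideal, of n x] assms(1) by simp
  next
    case (Suc k)
    define m where "m = n - Suc k"
    have m: "n - k = Suc m" "m < n" using Suc.prems by (auto simp: m_def)
    have "depth_ge k (seq_ideal x (Suc m))" using Suc.IH Suc.prems m(1) by simp
    then show ?case using assms m by (auto simp flip: m_def)
  qed
  from this[of n] show ?thesis by simp
qed

lemma ass_prime_of_regular_seq:
  assumes dim: "krull_dim R = enat (Suc n)"
    and seq: "\<And>k. k < n \<Longrightarrow> x k \<in> P" "\<And>k. k < n \<Longrightarrow> nzd_mod (seq_ideal x k) (x k)"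
    and depth: "depth_ge 1 (seq_ideal x n)"
    and P: "primeideal P R" "P \<noteq> \<mm>" "\<And>Q. \<lbrakk>primeideal Q R; P \<subset> Q\<rbrakk> \<Longrightarrow> Q = \<mm>"
  shows "P \<in> ass_primes (seq_ideal x n)"
proof -
  let ?J = "seq_ideal x n"
  note PI = primeidealD(1)[OF P(1)]
  have J: "ideal ?J R" using seq(1) ideal_carrier[OF PI] by (auto intro: seq_ideal_ideal)
  have "\<exists>Q\<in>ass_primes ?J. P \<subseteq> Q"
  proof (rule ccontr)
    assume "\<not> ?thesis"
    then obtain z where z: "z \<in> P" "nzd_mod ?J z" using ex_nzd_mod[of "{?J}" P] J PI by auto
    let ?x = "x(n := z)"
    have eq: "seq_ideal ?x i = seq_ideal x i" if "i \<le> n" for i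
      using that by (intro seq_ideal_cong) auto
    have "\<exists>Q. (\<forall>i\<le>Suc n. primeideal (Q i) R) \<and> (\<forall>i<Suc n. Q i \<subset> Q (Suc i)) \<and> Q (Suc n) = P"
      by (rule ex_prime_chain[OF P(1), of "Suc n" ?x]) (use seq z eq in \<open>auto simp: less_Suc_eq\<close>)
    then obtain Q where Q: "\<forall>i\<le>Suc n. primeideal (Q i) R" "\<forall>i<Suc n. Q i \<subset> Q (Suc i)" "Q (Suc n) = P"
      by blast
    \<comment> \<open>The chain \<open>Q\<close> has length n + 1 and ends in P; with the maximal
      ideal on top its length is n + 2, one more than the Krull dimension.\<close>
    let ?Q = "Q(Suc (Suc n) := \<mm>)"
    have "P \<subset> \<mm>" using prime_subset_max[OF P(1)] P(2) by auto
    then have "(\<forall>i\<le>Suc (Suc n). ?Q i \<in> spec R) \<and> (\<forall>i<Suc (Suc n). ?Q i \<subset> ?Q (Suc i))"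
      using Q max_prime by (auto simp: spec_def le_Suc_eq less_Suc_eq)
    then have "enat (Suc (Suc n)) \<le> krull_dim R"
      unfolding krull_dim_def chain_dim_def by (intro Sup_upper) blast
    then show False using dim by simp
  qed
  then obtain Q where Q: "Q \<in> ass_primes ?J" "P \<subseteq> Q" by auto
  obtain w where w: "w \<in> \<mm>" "nzd_mod ?J w" using depth by auto
  \<comment> \<open>Positive depth of R/(x) keeps the maximal ideal from being associated, and by
    assumption there is no other prime strictly above P.\<close>
  have "Q \<noteq> \<mm>" using max_not_subset_ass_prime[OF J w(2,1) Q(1)] by auto
  then have "P = Q" using P(3)[of Q] Q by (auto simp: ass_primes_def)
  then show ?thesis using Q by simp
qed

end

section \<open>Modules and linear maps\<close>

lemma mk_module_simps [simp]:
  "carrier (mk_module C z a s) = C" "zero (mk_module C z a s) = z"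
  "add (mk_module C z a s) = a" "smult (mk_module C z a s) = s"
  by (simp_all add: mk_module_def)

text \<open>No inverses are required: (-1) x is the negative of x, by \<open>s_add\<close>,
  \<open>s_one\<close> and \<open>s_zero\<close>.\<close>

lemma module_mk_moduleI:
  fixes R (structure)
  assumes R: "cring R"
    and z: "z \<in> C" and a: "\<And>x y. \<lbrakk>x \<in> C; y \<in> C\<rbrakk> \<Longrightarrow> a x y \<in> C"
    and s: "\<And>r x. \<lbrakk>r \<in> carrier R; x \<in> C\<rbrakk> \<Longrightarrow> s r x \<in> C"
    and assoc: "\<And>x y w. \<lbrakk>x \<in> C; y \<in> C; w \<in> C\<rbrakk> \<Longrightarrow> a (a x y) w = a x (a y w)"
    and comm: "\<And>x y. \<lbrakk>x \<in> C; y \<in> C\<rbrakk> \<Longrightarrow> a x y = a y x"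
    and zero: "\<And>x. x \<in> C \<Longrightarrow> a z x = x"
    and s_zero: "\<And>x. x \<in> C \<Longrightarrow> s \<zero> x = z" and s_one: "\<And>x. x \<in> C \<Longrightarrow> s \<one> x = x"
    and s_add: "\<And>r t x. \<lbrakk>r \<in> carrier R; t \<in> carrier R; x \<in> C\<rbrakk> \<Longrightarrow> s (r \<oplus> t) x = a (s r x) (s t x)"
    and s_sum: "\<And>r x y. \<lbrakk>r \<in> carrier R; x \<in> C; y \<in> C\<rbrakk> \<Longrightarrow> s r (a x y) = a (s r x) (s r y)"
    and s_assoc: "\<And>r t x. \<lbrakk>r \<in> carrier R; t \<in> carrier R; x \<in> C\<rbrakk> \<Longrightarrow> s (r \<otimes> t) x = s r (s t x)"
  shows "module R (mk_module C z a s)"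
proof (rule moduleI[OF R])
  interpret cring R by fact
  show "abelian_group (mk_module C z a s)"
  proof (rule abelian_groupI)
    fix x assume x: "x \<in> carrier (mk_module C z a s)"
    then have "a (s (\<ominus> \<one>) x) x = s (\<ominus> \<one> \<oplus> \<one>) x" using s_add[of "\<ominus> \<one>" \<one> x] by (simp add: s_one)
    also have "\<dots> = z" using x by (simp add: l_neg s_zero)
    finally show "\<exists>y\<in>carrier (mk_module C z a s). y \<oplus>\<^bsub>mk_module C z a s\<^esub> x = \<zero>\<^bsub>mk_module C z a s\<^esub>"
      using x s[of "\<ominus> \<one>" x] by auto
  qed (auto simp: z a zero assoc intro: comm)
qed (simp_all add: s s_add s_sum s_assoc s_one)

lemma self_module_simps [simp]:
  "carrier (self_module R) = carrier R" "zero (self_module R) = \<zero>\<^bsub>R\<^esub>"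
  "add (self_module R) = add R" "smult (self_module R) = mult R"
  by (simp_all add: self_module_def)

lemma module_self_module: "cring R \<Longrightarrow> module R (self_module R)"
proof -
  assume "cring R"
  then interpret cring R .
  show ?thesis unfolding self_module_def
    by (rule module_mk_moduleI[OF is_cring])
      (simp_all add: a_ac l_distr r_distr m_assoc)
qed

text \<open>This is \<open>mod_hom\<close> without extensionality, so that sums, multiples and
  composites written as plain lambda terms qualify without being restricted.\<close>

definition linear_map :: "('a, 'c) ring_scheme \<Rightarrow> ('a, 'm) module \<Rightarrow> ('a, 'n) module \<Rightarrow> ('m \<Rightarrow> 'n) \<Rightarrow> bool"
  where "linear_map R M N f \<longleftrightarrow> f \<in> carrier M \<rightarrow> carrier N \<and>
    (\<forall>x\<in>carrier M. \<forall>y\<in>carrier M. f (x \<oplus>\<^bsub>M\<^esub> y) = f x \<oplus>\<^bsub>N\<^esub> f y) \<and>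
    (\<forall>a\<in>carrier R. \<forall>x\<in>carrier M. f (a \<odot>\<^bsub>M\<^esub> x) = a \<odot>\<^bsub>N\<^esub> f x)"

lemma linear_mapD:
  assumes "linear_map R M N f"
  shows linear_map_closed: "x \<in> carrier M \<Longrightarrow> f x \<in> carrier N"
    and linear_map_add: "\<lbrakk>x \<in> carrier M; y \<in> carrier M\<rbrakk> \<Longrightarrow> f (x \<oplus>\<^bsub>M\<^esub> y) = f x \<oplus>\<^bsub>N\<^esub> f y"
    and linear_map_smult: "\<lbrakk>a \<in> carrier R; x \<in> carrier M\<rbrakk> \<Longrightarrow> f (a \<odot>\<^bsub>M\<^esub> x) = a \<odot>\<^bsub>N\<^esub> f x"
  using assms by (auto simp: linear_map_def)

lemma mod_hom_iff: "f \<in> mod_hom R M N \<longleftrightarrow> linear_map R M N f \<and> f \<in> extensional (carrier M)"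
  by (auto simp: mod_hom_def linear_map_def PiE_def)

lemma linear_map_cong:
  assumes "module R M" "\<And>x. x \<in> carrier M \<Longrightarrow> f x = g x"
  shows "linear_map R M N f \<longleftrightarrow> linear_map R M N g"
proof -
  interpret module R M by fact
  show ?thesis using assms(2) by (simp add: linear_map_def Pi_iff)
qed

lemma restrict_eq_iff: "restrict f A = restrict g A \<longleftrightarrow> (\<forall>x\<in>A. f x = g x)"
  by (auto simp: restrict_def fun_eq_iff)

lemma restrict_mod_hom:
  "\<lbrakk>module R M; linear_map R M N f\<rbrakk> \<Longrightarrow> restrict f (carrier M) \<in> mod_hom R M N"
  by (simp add: mod_hom_iff linear_map_cong[of R M "restrict f (carrier M)" f])

lemma linear_map_zero:
  assumes "module R M" "module R N" "linear_map R M N f"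
  shows "f \<zero>\<^bsub>M\<^esub> = \<zero>\<^bsub>N\<^esub>"
proof -
  interpret M: module R M by fact
  interpret N: module R N by fact
  have "f \<zero>\<^bsub>M\<^esub> = \<zero>\<^bsub>R\<^esub> \<odot>\<^bsub>N\<^esub> f \<zero>\<^bsub>M\<^esub>"
    using linear_map_smult[OF assms(3), of "\<zero>\<^bsub>R\<^esub>" "\<zero>\<^bsub>M\<^esub>"] by simp
  then show ?thesis using linear_map_closed[OF assms(3), of "\<zero>\<^bsub>M\<^esub>"] by simp
qed

lemma linear_map_minus:
  assumes "module R M" "module R N" "linear_map R M N f" "x \<in> carrier M" "y \<in> carrier M"
  shows "f (x \<ominus>\<^bsub>M\<^esub> y) = f x \<ominus>\<^bsub>N\<^esub> f y"
proof -
  interpret M: module R M by fact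
  interpret N: module R N by fact
  have "\<ominus>\<^bsub>M\<^esub> y = (\<ominus>\<^bsub>R\<^esub> \<one>\<^bsub>R\<^esub>) \<odot>\<^bsub>M\<^esub> y" using assms(5) by (simp add: M.smult_l_minus)
  then have "f (\<ominus>\<^bsub>M\<^esub> y) = (\<ominus>\<^bsub>R\<^esub> \<one>\<^bsub>R\<^esub>) \<odot>\<^bsub>N\<^esub> f y"
    using linear_map_smult[OF assms(3)] assms(5) by simp
  also have "\<dots> = \<ominus>\<^bsub>N\<^esub> f y" using linear_map_closed[OF assms(3,5)] by (simp add: N.smult_l_minus)
  finally show ?thesis using linear_map_add[OF assms(3)] assms(4,5) by (simp add: a_minus_def)
qed

lemma linear_map_comp:
  "\<lbrakk>linear_map R M N f; linear_map R N L g\<rbrakk> \<Longrightarrow> linear_map R M L (\<lambda>x. g (f x))"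
  by (auto simp: linear_map_def Pi_iff)

lemma linear_map_add_fun:
  assumes "module R N" "linear_map R M N f" "linear_map R M N g"
  shows "linear_map R M N (\<lambda>x. f x \<oplus>\<^bsub>N\<^esub> g x)"
proof -
  interpret N: module R N by fact
  note f = linear_mapD[OF assms(2)] and g = linear_mapD[OF assms(3)]
  show ?thesis unfolding linear_map_def
    using f g by (auto simp: N.M.a_ac N.smult_r_distr)
qed

lemma linear_map_smult_fun:
  assumes "module R N" "linear_map R M N f" "a \<in> carrier R"
  shows "linear_map R M N (\<lambda>x. a \<odot>\<^bsub>N\<^esub> f x)"
proof -
  interpret N: module R N by fact
  note f = linear_mapD[OF assms(2)]
  show ?thesis unfolding linear_map_def
    using f assms(3) by (auto simp: N.smult_r_distr N.R.m_comm simp flip: N.smult_assoc1)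
qed

lemma linear_map_zero_fun:
  assumes "module R N"
  shows "linear_map R M N (\<lambda>x. \<zero>\<^bsub>N\<^esub>)"
proof -
  interpret N: module R N by fact
  show ?thesis by (simp add: linear_map_def)
qed

lemma hom_module_simps [simp]:
  "carrier (hom_module R N L) = mod_hom R N L"
  "zero (hom_module R N L) = (\<lambda>x\<in>carrier N. \<zero>\<^bsub>L\<^esub>)"
  "add (hom_module R N L) = (\<lambda>f g. \<lambda>x\<in>carrier N. f x \<oplus>\<^bsub>L\<^esub> g x)"
  "smult (hom_module R N L) = (\<lambda>a f. \<lambda>x\<in>carrier N. a \<odot>\<^bsub>L\<^esub> f x)"
  by (simp_all add: hom_module_def)

lemma module_hom_module:
  assumes "module R M" "module R N"
  shows "module R (hom_module R M N)"
proof -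
  interpret M: module R M by fact
  interpret N: module R N by fact
  have lin: "linear_map R M N f" if "f \<in> mod_hom R M N" for f using that by (simp add: mod_hom_iff)
  have closed: "f x \<in> carrier N" if "f \<in> mod_hom R M N" "x \<in> carrier M" for f x
    using linear_map_closed[OF lin[OF that(1)] that(2)] .
  have ext: "f x = undefined" if "f \<in> mod_hom R M N" "x \<notin> carrier M" for f x
    using that by (simp add: mod_hom_iff extensional_def)
  show ?thesis unfolding hom_module_def
  proof (rule module_mk_moduleI[OF M.is_cring], goal_cases)
    case 1
    show ?case using restrict_mod_hom[OF assms(1) linear_map_zero_fun[OF assms(2)]] .
  next
    case (2 x y)
    then show ?case using restrict_mod_hom[OF assms(1) linear_map_add_fun[OF assms(2) lin lin]] by simp
  next
    case (3 r x)
    then show ?case using restrict_mod_hom[OF assms(1) linear_map_smult_fun[OF assms(2) lin]] by simp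
  qed (auto simp: fun_eq_iff closed ext N.M.a_ac N.smult_l_distr N.smult_r_distr N.smult_assoc1 restrict_def)
qed

lemma submodule_mod_ker:
  assumes "module R M" "module R N" "linear_map R M N f"
  shows "submodule (mod_ker M N f) R M"
proof -
  interpret M: module R M by fact
  interpret N: module R N by fact
  note f = linear_mapD[OF assms(3)] and f0 = linear_map_zero[OF assms]
  show ?thesis
  proof (rule M.submoduleI)
    fix x assume x: "x \<in> mod_ker M N f"
    then have "f (\<zero>\<^bsub>M\<^esub> \<ominus>\<^bsub>M\<^esub> x) = \<zero>\<^bsub>N\<^esub> \<ominus>\<^bsub>N\<^esub> \<zero>\<^bsub>N\<^esub>"
      using linear_map_minus[OF assms] f0 by (simp add: mod_ker_def)
    then show "\<ominus>\<^bsub>M\<^esub> x \<in> mod_ker M N f"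
      using x by (simp add: mod_ker_def a_minus_def)
  qed (use f f0 in \<open>auto simp: mod_ker_def\<close>)
qed

lemma submodule_image:
  assumes "module R M" "module R N" "linear_map R M N f"
  shows "submodule (f ` carrier M) R N"
proof -
  interpret M: module R M by fact
  interpret N: module R N by fact
  note f = linear_mapD[OF assms(3)] and f0 = linear_map_zero[OF assms]
  show ?thesis
  proof (rule N.submoduleI)
    show "\<zero>\<^bsub>N\<^esub> \<in> f ` carrier M" using f0 M.M.zero_closed by force
    fix x assume "x \<in> f ` carrier M"
    then obtain y where y: "y \<in> carrier M" "x = f y" by auto
    have "f (\<zero>\<^bsub>M\<^esub> \<ominus>\<^bsub>M\<^esub> y) = \<ominus>\<^bsub>N\<^esub> x"
      using linear_map_minus[OF assms _ y(1)] f0 f y by (simp add: a_minus_def)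
    then show "\<ominus>\<^bsub>N\<^esub> x \<in> f ` carrier M" using y by (metis M.M.minus_closed M.M.zero_closed imageI)
  next
    fix x y assume "x \<in> f ` carrier M" "y \<in> f ` carrier M"
    then show "x \<oplus>\<^bsub>N\<^esub> y \<in> f ` carrier M" by (auto simp flip: f(2))
  qed (use f in \<open>auto simp flip: f(3)\<close>)
qed

section \<open>Quotients and support\<close>

text \<open>The operations on modules in the definitions are restricted to the unextended record type.\<close>

locale plain_module = module R M for R :: "('a, 'c) ring_scheme" (structure) and M :: "('a, 'm) module" (structure)

lemma (in module) submodule_abelian_subgroup:
  assumes "submodule H R M"
  shows "abelian_subgroup H M"
  using submodule.axioms(1)[OF assms]
  by (intro abelian_subgroupI3 additive_subgroup.intro M.abelian_group_axioms)

text \<open>Changing y by an element h of H changes a y by a h, again in H. So all cosets in the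
  union that defines the scalar multiplication of the quotient coincide.\<close>

lemma (in module) quot_smult:
  assumes H: "submodule H R M" and "a \<in> carrier R" "x \<in> carrier M"
  shows "(\<Union>y\<in>H +>\<^bsub>M\<^esub> x. H +>\<^bsub>M\<^esub> (a \<odot>\<^bsub>M\<^esub> y)) = H +>\<^bsub>M\<^esub> (a \<odot>\<^bsub>M\<^esub> x)"
proof -
  interpret H: abelian_subgroup H M by (rule submodule_abelian_subgroup[OF H])
  have "H +>\<^bsub>M\<^esub> (a \<odot>\<^bsub>M\<^esub> y) = H +>\<^bsub>M\<^esub> (a \<odot>\<^bsub>M\<^esub> x)" if y: "y \<in> H +>\<^bsub>M\<^esub> x" for y
  proof -
    obtain h where h: "h \<in> H" "y = h \<oplus>\<^bsub>M\<^esub> x" using y by (auto simp: a_r_coset_def r_coset_def)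
    have "h \<in> carrier M" using h H.a_subset by auto
    then have "a \<odot>\<^bsub>M\<^esub> y = a \<odot>\<^bsub>M\<^esub> h \<oplus>\<^bsub>M\<^esub> a \<odot>\<^bsub>M\<^esub> x" using h assms by (simp add: smult_r_distr)
    moreover have "a \<odot>\<^bsub>M\<^esub> h \<in> H" using submoduleE(4)[OF H] assms h by simp
    ultimately have "a \<odot>\<^bsub>M\<^esub> y \<in> H +>\<^bsub>M\<^esub> (a \<odot>\<^bsub>M\<^esub> x)" by (auto simp: a_r_coset_def r_coset_def)
    then show ?thesis using H.a_repr_independence'[of "a \<odot>\<^bsub>M\<^esub> y" "a \<odot>\<^bsub>M\<^esub> x"] assms by simp
  qed
  moreover have "x \<in> H +>\<^bsub>M\<^esub> x" using H.a_rcos_self assms by simp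
  ultimately show ?thesis by blast
qed

lemma (in plain_module) module_quot_module:
  assumes H: "submodule H R M"
  shows "module R (quot_module M H)"
proof -
  interpret H: abelian_subgroup H M by (rule submodule_abelian_subgroup[OF H])
  have rep: "\<exists>x\<in>carrier M. X = H +>\<^bsub>M\<^esub> x" if "X \<in> a_rcosets\<^bsub>M\<^esub> H" for X
    using that by (auto simp: A_RCOSETS_def RCOSETS_def a_r_coset_def)
  have sum: "set_add M (H +>\<^bsub>M\<^esub> x) (H +>\<^bsub>M\<^esub> y) = H +>\<^bsub>M\<^esub> (x \<oplus>\<^bsub>M\<^esub> y)"
    if "x \<in> carrier M" "y \<in> carrier M" for x y using H.a_rcos_sum that by simp
  have cos: "H +>\<^bsub>M\<^esub> x \<in> a_rcosets\<^bsub>M\<^esub> H" if "x \<in> carrier M" for x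
    using M.a_rcosetsI[OF H.a_subset that] .
  have H0: "H +>\<^bsub>M\<^esub> \<zero>\<^bsub>M\<^esub> = H" using H.a_rcos_const[of "\<zero>\<^bsub>M\<^esub>"] by simp
  note smul = quot_smult[OF H]
  show ?thesis unfolding quot_module_def
  proof (rule module_mk_moduleI[OF R.is_cring], goal_cases)
    case 1
    show ?case using cos[of "\<zero>\<^bsub>M\<^esub>"] H0 by simp
  next
    case (2 X Y)
    then show ?case by (auto dest!: rep simp: sum cos)
  next
    case (3 r X)
    then show ?case by (auto dest!: rep simp: smul cos)
  next
    case (4 X Y W)
    then show ?case by (auto dest!: rep simp: sum M.a_assoc)
  next
    case (5 X Y)
    then show ?case by (auto dest!: rep simp: sum M.a_comm)
  next
    case (6 X)
    then obtain x where "x \<in> carrier M" "X = H +>\<^bsub>M\<^esub> x" using rep by auto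
    moreover from this have "set_add M (H +>\<^bsub>M\<^esub> \<zero>\<^bsub>M\<^esub>) (H +>\<^bsub>M\<^esub> x) = H +>\<^bsub>M\<^esub> (\<zero>\<^bsub>M\<^esub> \<oplus>\<^bsub>M\<^esub> x)"
      using sum M.zero_closed by blast
    ultimately show ?case unfolding H0 by simp
  next
    case (7 X)
    then obtain x where x: "x \<in> carrier M" "X = H +>\<^bsub>M\<^esub> x" using rep by auto
    have "(\<Union>y\<in>X. H +>\<^bsub>M\<^esub> (\<zero> \<odot>\<^bsub>M\<^esub> y)) = H +>\<^bsub>M\<^esub> (\<zero> \<odot>\<^bsub>M\<^esub> x)"
      unfolding x(2) using x(1) by (intro smul) simp_all
    also have "\<dots> = H" unfolding smult_l_null[OF x(1)] by (rule H0)
    finally show ?case .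
  next
    case (8 X)
    then obtain x where x: "x \<in> carrier M" "X = H +>\<^bsub>M\<^esub> x" using rep by auto
    show ?case unfolding x(2) smul[OF R.one_closed x(1)] smult_one[OF x(1)] ..
  next
    case (9 r t X)
    then obtain x where x: "x \<in> carrier M" "X = H +>\<^bsub>M\<^esub> x" using rep by auto
    show ?case using 9(1,2) x(1) unfolding x(2) by (simp add: smul sum smult_l_distr)
  next
    case (10 r X Y)
    then obtain x y where x: "x \<in> carrier M" "X = H +>\<^bsub>M\<^esub> x"
      and y: "y \<in> carrier M" "Y = H +>\<^bsub>M\<^esub> y" using rep by metis
    show ?case using 10(1) x(1) y(1) unfolding x(2) y(2) by (simp add: smul sum smult_r_distr)
  next
    case (11 r t X)
    then obtain x where x: "x \<in> carrier M" "X = H +>\<^bsub>M\<^esub> x" using rep by auto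
    show ?case using 11(1,2) x(1) unfolding x(2) by (simp add: smul smult_assoc1)
  qed
qed

section \<open>Supports described by elements\<close>

context plain_module
begin

text \<open>Fractions are sets of pairs, so equality must be checked on all representatives. A
  witness for one membership is multiplied by the element u that kills m, and where necessary by s,
  to give a witness for the other.\<close>

lemma fraction_eq_zero_iff:
  assumes S: "S \<subseteq> carrier R" "\<one> \<in> S" "\<And>s t. \<lbrakk>s \<in> S; t \<in> S\<rbrakk> \<Longrightarrow> s \<otimes> t \<in> S"
    and m: "m \<in> carrier M" "s \<in> S"
  shows "fraction S M m s = fraction S M \<zero>\<^bsub>M\<^esub> \<one> \<longleftrightarrow> (\<exists>u\<in>S. u \<odot>\<^bsub>M\<^esub> m = \<zero>\<^bsub>M\<^esub>)"
proof
  have SR: "s \<in> carrier R" if "s \<in> S" for s using S that by auto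
  assume "fraction S M m s = fraction S M \<zero>\<^bsub>M\<^esub> \<one>"
  moreover have "(m, s) \<in> fraction S M m s" using m S by (auto simp: fraction_def)
  ultimately have "(m, s) \<in> fraction S M \<zero>\<^bsub>M\<^esub> \<one>" by simp
  then obtain u where "u \<in> S" "u \<odot>\<^bsub>M\<^esub> (s \<odot>\<^bsub>M\<^esub> \<zero>\<^bsub>M\<^esub>) = u \<odot>\<^bsub>M\<^esub> (\<one> \<odot>\<^bsub>M\<^esub> m)" by (auto simp: fraction_def)
  then show "\<exists>u\<in>S. u \<odot>\<^bsub>M\<^esub> m = \<zero>\<^bsub>M\<^esub>" using m SR by (intro bexI[of _ u]) auto
next
  have SR: "s \<in> carrier R" if "s \<in> S" for s using S that by auto
  assume "\<exists>u\<in>S. u \<odot>\<^bsub>M\<^esub> m = \<zero>\<^bsub>M\<^esub>"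
  then obtain u where u: "u \<in> S" "u \<odot>\<^bsub>M\<^esub> m = \<zero>\<^bsub>M\<^esub>" by auto
  have um: "(u \<otimes> r) \<odot>\<^bsub>M\<^esub> m = \<zero>\<^bsub>M\<^esub>" if "r \<in> carrier R" for r
    using that u SR m smult_assoc1[of r u m] by (simp add: R.m_comm)
  show "fraction S M m s = fraction S M \<zero>\<^bsub>M\<^esub> \<one>"
  proof (intro equalityI subsetI)
    fix z assume "z \<in> fraction S M m s"
    then obtain n t v where z: "z = (n, t)" "n \<in> carrier M" "t \<in> S" "v \<in> S"
      "v \<odot>\<^bsub>M\<^esub> (t \<odot>\<^bsub>M\<^esub> m) = v \<odot>\<^bsub>M\<^esub> (s \<odot>\<^bsub>M\<^esub> n)" by (auto simp: fraction_def)
    note c = SR[OF u(1)] SR[OF z(3)] SR[OF z(4)] SR[OF m(2)]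
    have "((u \<otimes> v) \<otimes> s) \<odot>\<^bsub>M\<^esub> n = u \<odot>\<^bsub>M\<^esub> (v \<odot>\<^bsub>M\<^esub> (s \<odot>\<^bsub>M\<^esub> n))"
      using c z(2) by (simp add: smult_assoc1)
    also have "\<dots> = (u \<otimes> (v \<otimes> t)) \<odot>\<^bsub>M\<^esub> m"
      using c m(1) by (simp add: smult_assoc1 flip: z(5))
    also have "\<dots> = \<zero>\<^bsub>M\<^esub>" using um c by simp
    finally have "((u \<otimes> v) \<otimes> s) \<odot>\<^bsub>M\<^esub> n = \<zero>\<^bsub>M\<^esub>" .
    moreover have "(u \<otimes> v) \<otimes> s \<in> S" using S(3) u(1) z(4) m(2) by simp
    ultimately show "z \<in> fraction S M \<zero>\<^bsub>M\<^esub> \<one>"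
      unfolding z(1) fraction_def using z(2,3) SR c by (auto intro!: bexI[of _ "(u \<otimes> v) \<otimes> s"])
  next
    fix z assume "z \<in> fraction S M \<zero>\<^bsub>M\<^esub> \<one>"
    then obtain n t v where z: "z = (n, t)" "n \<in> carrier M" "t \<in> S" "v \<in> S"
      "v \<odot>\<^bsub>M\<^esub> (t \<odot>\<^bsub>M\<^esub> \<zero>\<^bsub>M\<^esub>) = v \<odot>\<^bsub>M\<^esub> (\<one> \<odot>\<^bsub>M\<^esub> n)" by (auto simp: fraction_def)
    note c = SR[OF u(1)] SR[OF z(3)] SR[OF z(4)] SR[OF m(2)]
    have vn: "v \<odot>\<^bsub>M\<^esub> n = \<zero>\<^bsub>M\<^esub>" using z c by simp
    have "(u \<otimes> v) \<odot>\<^bsub>M\<^esub> (t \<odot>\<^bsub>M\<^esub> m) = (u \<otimes> (v \<otimes> t)) \<odot>\<^bsub>M\<^esub> m"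
      using c m(1) by (simp add: smult_assoc1)
    also have "\<dots> = \<zero>\<^bsub>M\<^esub>" using um c by simp
    also have "\<dots> = ((u \<otimes> s) \<otimes> v) \<odot>\<^bsub>M\<^esub> n" using c z(2) by (simp add: smult_assoc1 vn)
    also have "(u \<otimes> s) \<otimes> v = (u \<otimes> v) \<otimes> s" using c by (simp add: m_ac)
    also have "((u \<otimes> v) \<otimes> s) \<odot>\<^bsub>M\<^esub> n = (u \<otimes> v) \<odot>\<^bsub>M\<^esub> (s \<odot>\<^bsub>M\<^esub> n)"
      using c z(2) by (simp add: smult_assoc1)
    finally show "z \<in> fraction S M m s"
      unfolding z(1) fraction_def using z(2-4) u(1) S(3) by (auto intro!: bexI[of _ "u \<otimes> v"])
  qed
qed

text \<open>Eliminates the localization: m/s vanishes exactly if some element outside P kills m, so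
  P is in the support exactly if some m has its annihilator inside P.\<close>

lemma supp_iff:
  "P \<in> supp R M \<longleftrightarrow> primeideal P R \<and> (\<exists>m\<in>carrier M. \<forall>s\<in>carrier R - P. s \<odot>\<^bsub>M\<^esub> m \<noteq> \<zero>\<^bsub>M\<^esub>)"
proof (cases "primeideal P R")
  case True
  then interpret P: primeideal P R .
  let ?S = "carrier R - P"
  have S: "?S \<subseteq> carrier R" "\<one> \<in> ?S" "s \<otimes> t \<in> ?S" if "s \<in> ?S" "t \<in> ?S" for s t
    using that P.I_prime[of s t] P.one_imp_carrier P.I_notcarr by auto
  have one: "\<one> \<in> ?S" using P.one_imp_carrier P.I_notcarr by auto
  have eq: "fraction ?S M m s = fraction ?S M \<zero>\<^bsub>M\<^esub> \<one> \<longleftrightarrow> (\<exists>u\<in>?S. u \<odot>\<^bsub>M\<^esub> m = \<zero>\<^bsub>M\<^esub>)"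
    if "m \<in> carrier M" "s \<in> ?S" for m s
    using fraction_eq_zero_iff[of ?S m s] S one that by auto
  have "P \<in> supp R M \<longleftrightarrow> loc_carrier ?S M \<noteq> {fraction ?S M \<zero>\<^bsub>M\<^esub> \<one>}"
    using True by (simp add: supp_def spec_def loc_module_def)
  also have "\<dots> \<longleftrightarrow> (\<exists>m\<in>carrier M. \<exists>s\<in>?S. fraction ?S M m s \<noteq> fraction ?S M \<zero>\<^bsub>M\<^esub> \<one>)"
    using one by (auto simp: loc_carrier_def)
  also have "\<dots> \<longleftrightarrow> (\<exists>m\<in>carrier M. \<forall>s\<in>?S. s \<odot>\<^bsub>M\<^esub> m \<noteq> \<zero>\<^bsub>M\<^esub>)"
    using eq one by auto
  finally show ?thesis using True by simp
qed (simp add: supp_def spec_def)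

definition annihilator :: "'a set"
  where "annihilator = {a \<in> carrier R. \<forall>m\<in>carrier M. a \<odot>\<^bsub>M\<^esub> m = \<zero>\<^bsub>M\<^esub>}"

lemma annihilator_subset_supp: "P \<in> supp R M \<Longrightarrow> annihilator \<subseteq> P"
  by (auto simp: supp_iff annihilator_def)

lemma supp_quot_module_iff:
  assumes H: "submodule H R M"
  shows "P \<in> supp R (quot_module M H) \<longleftrightarrow>
    primeideal P R \<and> (\<exists>m\<in>carrier M. \<forall>s\<in>carrier R - P. s \<odot>\<^bsub>M\<^esub> m \<notin> H)"
proof -
  interpret Q: plain_module R "quot_module M H" 
    using module_quot_module[OF H] by (rule plain_module.intro)
  interpret H: abelian_subgroup H M by (rule submodule_abelian_subgroup[OF H])
  have car: "carrier (quot_module M H) = (\<lambda>m. H +>\<^bsub>M\<^esub> m) ` carrier M"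
    by (auto simp: quot_module_def A_RCOSETS_def RCOSETS_def a_r_coset_def)
  have "s \<odot>\<^bsub>quot_module M H\<^esub> (H +>\<^bsub>M\<^esub> m) = \<zero>\<^bsub>quot_module M H\<^esub> \<longleftrightarrow> s \<odot>\<^bsub>M\<^esub> m \<in> H"
    if "s \<in> carrier R" "m \<in> carrier M" for s m
  proof -
    have "s \<odot>\<^bsub>quot_module M H\<^esub> (H +>\<^bsub>M\<^esub> m) = H +>\<^bsub>M\<^esub> (s \<odot>\<^bsub>M\<^esub> m)"
      using quot_smult[OF H that] by (simp add: quot_module_def)
    moreover have "H +>\<^bsub>M\<^esub> (s \<odot>\<^bsub>M\<^esub> m) = H \<longleftrightarrow> s \<odot>\<^bsub>M\<^esub> m \<in> H"
      using H.a_rcos_const H.a_rcos_self[of "s \<odot>\<^bsub>M\<^esub> m"] that by auto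
    ultimately show ?thesis by (simp add: quot_module_def)
  qed
  then show ?thesis unfolding Q.supp_iff car by auto
qed

end

section \<open>Free modules\<close>

lemma free_module_iff:
  "f \<in> carrier (free_module R B) \<longleftrightarrow> (\<forall>b\<in>B. f b \<in> carrier R) \<and> (\<forall>b. b \<notin> B \<longrightarrow> f b = \<zero>\<^bsub>R\<^esub>) \<and>
    finite {b. f b \<noteq> \<zero>\<^bsub>R\<^esub>}"
  by (simp add: free_module_def)

lemma free_module_simps [simp]:
  "zero (free_module R B) = (\<lambda>_. \<zero>\<^bsub>R\<^esub>)"
  "add (free_module R B) = (\<lambda>f g b. f b \<oplus>\<^bsub>R\<^esub> g b)"
  "smult (free_module R B) = (\<lambda>a f b. a \<otimes>\<^bsub>R\<^esub> f b)"
  by (simp_all add: free_module_def)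

definition basis_vec :: "('a, 'c) ring_scheme \<Rightarrow> 'b \<Rightarrow> 'b \<Rightarrow> 'a"
  where "basis_vec R b = (\<lambda>c. if c = b then \<one>\<^bsub>R\<^esub> else \<zero>\<^bsub>R\<^esub>)"

context cring
begin

lemma free_module_coeff:
  "f \<in> carrier (free_module R B) \<Longrightarrow> f b \<in> carrier R"
  by (cases "b \<in> B") (auto simp: free_module_iff)

lemma module_free_module: "module R (free_module R B)"
proof -
  have eq: "free_module R B = mk_module (carrier (free_module R B))
    (\<lambda>_. \<zero>) (\<lambda>f g b. f b \<oplus> g b) (\<lambda>a f b. a \<otimes> f b)"
    by (simp add: free_module_def)
  note c = free_module_coeff
  show ?thesis
  proof (subst eq, rule module_mk_moduleI[OF is_cring], goal_cases)
    case 1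
    show ?case by (simp add: free_module_iff)
  next
    case (2 x y)
    have "{b. x b \<oplus> y b \<noteq> \<zero>} \<subseteq> {b. x b \<noteq> \<zero>} \<union> {b. y b \<noteq> \<zero>}" by auto
    then have "finite {b. x b \<oplus> y b \<noteq> \<zero>}" using 2 by (auto simp: free_module_iff intro: finite_subset)
    then show ?case using 2 by (auto simp: free_module_iff)
  next
    case (3 r x)
    then have "{b. r \<otimes> x b \<noteq> \<zero>} \<subseteq> {b. x b \<noteq> \<zero>}" by auto
    then have "finite {b. r \<otimes> x b \<noteq> \<zero>}" using 3 by (auto simp: free_module_iff intro: finite_subset)
    then show ?case using 3 by (auto simp: free_module_iff)
  qed (auto simp: fun_eq_iff l_distr r_distr m_assoc a_assoc c intro!: a_comm)
qed

lemma basis_vec_in_free_module: "b \<in> B \<Longrightarrow> basis_vec R b \<in> carrier (free_module R B)"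
  by (auto simp: basis_vec_def free_module_iff)

lemma free_module_induct [consumes 1, case_names zero add]:
  assumes y: "y \<in> carrier (free_module R B)"
    and zero: "P \<zero>\<^bsub>free_module R B\<^esub>"
    and add: "\<And>y a b. \<lbrakk>y \<in> carrier (free_module R B); a \<in> carrier R; b \<in> B; P y\<rbrakk> \<Longrightarrow>
      P (y \<oplus>\<^bsub>free_module R B\<^esub> a \<odot>\<^bsub>free_module R B\<^esub> basis_vec R b)"
  shows "P y"
proof -
  have "P y" if "finite S" "y \<in> carrier (free_module R B)" "{b. y b \<noteq> \<zero>} \<subseteq> S" for S y
    using that
  proof (induction S arbitrary: y rule: finite_induct)
    case empty
    then have "y = \<zero>\<^bsub>free_module R B\<^esub>" by auto
    then show ?case using zero by simp
  next
    case (insert c S)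
    show ?case
    proof (cases "c \<in> B")
      case True
      let ?z = "y(c := \<zero>)"
      have "{b. ?z b \<noteq> \<zero>} \<subseteq> {b. y b \<noteq> \<zero>}" by auto
      then have "finite {b. ?z b \<noteq> \<zero>}" using insert.prems(1) by (auto simp: free_module_iff intro: finite_subset)
      then have z: "?z \<in> carrier (free_module R B)" using insert.prems(1) by (auto simp: free_module_iff)
      moreover have "{b. ?z b \<noteq> \<zero>} \<subseteq> S" using insert.prems(2) by auto
      ultimately have "P ?z" using insert.IH by blast
      then have "P (?z \<oplus>\<^bsub>free_module R B\<^esub> y c \<odot>\<^bsub>free_module R B\<^esub> basis_vec R c)"
        using add[OF z _ True] free_module_coeff[OF insert.prems(1)] by blast
      moreover have "?z \<oplus>\<^bsub>free_module R B\<^esub> y c \<odot>\<^bsub>free_module R B\<^esub> basis_vec R c = y"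
        using free_module_coeff[OF insert.prems(1)] by (auto simp: fun_eq_iff basis_vec_def)
      ultimately show ?thesis by simp
    next
      case False
      then have "{b. y b \<noteq> \<zero>} \<subseteq> S" using insert.prems by (auto simp: free_module_iff)
      then show ?thesis using insert.IH insert.prems(1) by blast
    qed
  qed
  then show ?thesis using y by (auto simp: free_module_iff)
qed

end

lemma (in plain_module) ex_linear_map_free_module:
  assumes v: "\<And>b. b \<in> B \<Longrightarrow> v b \<in> carrier M"
  shows "\<exists>g. linear_map R (free_module R B) M g \<and> (\<forall>b\<in>B. g (basis_vec R b) = v b)"
proof -
  interpret F: module R "free_module R B" by (rule module_free_module)
  define g where "g y = (\<Oplus>\<^bsub>M\<^esub>b\<in>{b. y b \<noteq> \<zero>}. y b \<odot>\<^bsub>M\<^esub> v b)" for y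
  have coeff: "y b \<odot>\<^bsub>M\<^esub> v b \<in> carrier M" if "y \<in> carrier (free_module R B)" "b \<in> B" for y b
    using smult_closed[OF free_module_coeff[OF that(1)] v[OF that(2)]] .
  have supp: "finite {b. y b \<noteq> \<zero>}" "{b. y b \<noteq> \<zero>} \<subseteq> B" if "y \<in> carrier (free_module R B)" for y
    using that by (auto simp: free_module_iff)
  \<comment> \<open>The sum may run over any finite set between the support and B. This is needed
    because y, z and y + z have different supports.\<close>
  have g_eq: "g y = (\<Oplus>\<^bsub>M\<^esub>b\<in>S. y b \<odot>\<^bsub>M\<^esub> v b)"
    if y: "y \<in> carrier (free_module R B)" and S: "finite S" "{b. y b \<noteq> \<zero>} \<subseteq> S" "S \<subseteq> B" for y S
    unfolding g_def
  proof (rule M.add.finprod_mono_neutral_cong_left[OF S(1,2), simplified])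
    fix b assume b: "b \<in> S \<and> y b = \<zero>"
    then show "y b \<odot>\<^bsub>M\<^esub> v b = \<zero>\<^bsub>M\<^esub>" using v[of b] S(3) by auto
  next
    show "(\<lambda>b. y b \<odot>\<^bsub>M\<^esub> v b) \<in> S \<rightarrow> carrier M"
      by (intro funcsetI coeff[OF y]) (rule subsetD[OF S(3)])
  qed simp
  have "linear_map R (free_module R B) M g"
    unfolding linear_map_def
  proof (intro conjI ballI funcsetI)
    fix y assume y: "y \<in> carrier (free_module R B)"
    let ?S = "{b. y b \<noteq> \<zero>}"
    note S = supp[OF y]
    have c: "(\<lambda>b. y b \<odot>\<^bsub>M\<^esub> v b) \<in> ?S \<rightarrow> carrier M"
      by (intro funcsetI coeff[OF y]) (rule subsetD[OF S(2)])
    then show "g y \<in> carrier M" unfolding g_def by (rule M.finsum_closed)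
    fix a assume a: "a \<in> carrier R"
    have ay: "a \<odot>\<^bsub>free_module R B\<^esub> y \<in> carrier (free_module R B)" using a y by (rule F.smult_closed)
    have "{b. a \<otimes> y b \<noteq> \<zero>} \<subseteq> ?S" using a by auto
    then have "g (a \<odot>\<^bsub>free_module R B\<^esub> y) = (\<Oplus>\<^bsub>M\<^esub>b\<in>?S. (a \<otimes> y b) \<odot>\<^bsub>M\<^esub> v b)"
      using g_eq[OF ay S(1) _ S(2)] by simp
    also have "\<dots> = (\<Oplus>\<^bsub>M\<^esub>b\<in>?S. a \<odot>\<^bsub>M\<^esub> (y b \<odot>\<^bsub>M\<^esub> v b))"
    proof (rule M.finsum_cong'[OF refl])
      fix b assume "b \<in> ?S"
      then have "v b \<in> carrier M" using v subsetD[OF S(2)] by simp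
      then show "(a \<otimes> y b) \<odot>\<^bsub>M\<^esub> v b = a \<odot>\<^bsub>M\<^esub> (y b \<odot>\<^bsub>M\<^esub> v b)"
        by (rule smult_assoc1[OF a free_module_coeff[OF y]])
    next
      show "(\<lambda>b. a \<odot>\<^bsub>M\<^esub> (y b \<odot>\<^bsub>M\<^esub> v b)) \<in> ?S \<rightarrow> carrier M"
        by (intro funcsetI smult_closed[OF a] coeff[OF y]) (rule subsetD[OF S(2)])
    qed
    also have "\<dots> = a \<odot>\<^bsub>M\<^esub> g y"
      unfolding g_def by (rule finsum_smult_ldistr[OF S(1) a c, symmetric])
    finally show "g (a \<odot>\<^bsub>free_module R B\<^esub> y) = a \<odot>\<^bsub>M\<^esub> g y" .
  next
    fix y z assume y: "y \<in> carrier (free_module R B)" and z: "z \<in> carrier (free_module R B)"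
    let ?S = "{b. y b \<noteq> \<zero>} \<union> {b. z b \<noteq> \<zero>}"
    have S: "finite ?S" "?S \<subseteq> B" using supp[OF y] supp[OF z] by simp_all
    have c: "(\<lambda>b. y b \<odot>\<^bsub>M\<^esub> v b) \<in> ?S \<rightarrow> carrier M" "(\<lambda>b. z b \<odot>\<^bsub>M\<^esub> v b) \<in> ?S \<rightarrow> carrier M"
      by (intro funcsetI coeff[OF y] coeff[OF z], rule subsetD[OF S(2)], assumption)+
    have sum: "y \<oplus>\<^bsub>free_module R B\<^esub> z \<in> carrier (free_module R B)" using y z by (rule F.add.m_closed)
    have "{b. y b \<oplus> z b \<noteq> \<zero>} \<subseteq> ?S" by auto
    then have "g (y \<oplus>\<^bsub>free_module R B\<^esub> z) = (\<Oplus>\<^bsub>M\<^esub>b\<in>?S. (y b \<oplus> z b) \<odot>\<^bsub>M\<^esub> v b)"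
      using g_eq[OF sum S(1) _ S(2)] by simp
    also have "\<dots> = (\<Oplus>\<^bsub>M\<^esub>b\<in>?S. y b \<odot>\<^bsub>M\<^esub> v b \<oplus>\<^bsub>M\<^esub> z b \<odot>\<^bsub>M\<^esub> v b)"
    proof (rule M.finsum_cong'[OF refl])
      fix b assume "b \<in> ?S"
      then have "v b \<in> carrier M" using v subsetD[OF S(2)] by blast
      then show "(y b \<oplus> z b) \<odot>\<^bsub>M\<^esub> v b = y b \<odot>\<^bsub>M\<^esub> v b \<oplus>\<^bsub>M\<^esub> z b \<odot>\<^bsub>M\<^esub> v b"
        by (rule smult_l_distr[OF free_module_coeff[OF y] free_module_coeff[OF z]])
    next
      show "(\<lambda>b. y b \<odot>\<^bsub>M\<^esub> v b \<oplus>\<^bsub>M\<^esub> z b \<odot>\<^bsub>M\<^esub> v b) \<in> ?S \<rightarrow> carrier M"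
        using c by (simp add: Pi_iff)
    qed
    also have "\<dots> = (\<Oplus>\<^bsub>M\<^esub>b\<in>?S. y b \<odot>\<^bsub>M\<^esub> v b) \<oplus>\<^bsub>M\<^esub> (\<Oplus>\<^bsub>M\<^esub>b\<in>?S. z b \<odot>\<^bsub>M\<^esub> v b)"
      by (rule M.finsum_addf[OF c])
    also have "\<dots> = g y \<oplus>\<^bsub>M\<^esub> g z"
      using g_eq[OF y S(1) _ S(2)] g_eq[OF z S(1) _ S(2)] by simp
    finally show "g (y \<oplus>\<^bsub>free_module R B\<^esub> z) = g y \<oplus>\<^bsub>M\<^esub> g z" .
  qed
  moreover have "g (basis_vec R b) = v b" if b: "b \<in> B" for b
  proof -
    have "g (basis_vec R b) = (\<Oplus>\<^bsub>M\<^esub>c\<in>{b}. basis_vec R b c \<odot>\<^bsub>M\<^esub> v c)"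
      by (rule g_eq[OF basis_vec_in_free_module[OF b]]) (use b in \<open>auto simp: basis_vec_def\<close>)
    also have "\<dots> = v b" using v[OF b] by (simp add: basis_vec_def)
    finally show ?thesis .
  qed
  ultimately show ?thesis by blast
qed

text \<open>Projectivity of free modules, for a linear relation in place of a surjection.\<close>

lemma (in plain_module) free_module_relation_lift:
  assumes zero: "r \<zero>\<^bsub>free_module R B\<^esub> \<zero>\<^bsub>M\<^esub>"
    and add: "\<And>y z v w. \<lbrakk>y \<in> carrier (free_module R B); z \<in> carrier (free_module R B);
      v \<in> carrier M; w \<in> carrier M; r y v; r z w\<rbrakk> \<Longrightarrow> r (y \<oplus>\<^bsub>free_module R B\<^esub> z) (v \<oplus>\<^bsub>M\<^esub> w)"
    and smult: "\<And>a y v. \<lbrakk>a \<in> carrier R; y \<in> carrier (free_module R B); v \<in> carrier M; r y v\<rbrakk> \<Longrightarrow>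
      r (a \<odot>\<^bsub>free_module R B\<^esub> y) (a \<odot>\<^bsub>M\<^esub> v)"
    and ex: "\<And>y. y \<in> carrier (free_module R B) \<Longrightarrow> \<exists>v\<in>carrier M. r y v"
  shows "\<exists>g. linear_map R (free_module R B) M g \<and> (\<forall>y\<in>carrier (free_module R B). r y (g y))"
proof -
  interpret F: module R "free_module R B" by (rule module_free_module)
  define v where "v b = (SOME v. v \<in> carrier M \<and> r (basis_vec R b) v)" for b
  have v: "v b \<in> carrier M" "r (basis_vec R b) (v b)" if "b \<in> B" for b
    using someI_ex[of "\<lambda>v. v \<in> carrier M \<and> r (basis_vec R b) v"] ex[OF basis_vec_in_free_module[OF that]]
    unfolding v_def by auto
  obtain g where g: "linear_map R (free_module R B) M g" "\<forall>b\<in>B. g (basis_vec R b) = v b"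
    using ex_linear_map_free_module[of B v] v(1) by auto
  have "r y (g y)" if "y \<in> carrier (free_module R B)" for y
    using that
  proof (induction rule: free_module_induct)
    case zero
    then show ?case
      using linear_map_zero[OF F.module_axioms module_axioms g(1)] assms(1) by simp
  next
    case (add y a b)
    note e = basis_vec_in_free_module[OF add(3)]
    have ae: "a \<odot>\<^bsub>free_module R B\<^esub> basis_vec R b \<in> carrier (free_module R B)"
      using add(2) e by (rule F.smult_closed)
    have "r (a \<odot>\<^bsub>free_module R B\<^esub> basis_vec R b) (a \<odot>\<^bsub>M\<^esub> v b)"
      by (rule smult[OF add(2) e v(1,2)]) (rule add(3))+
    moreover have "a \<odot>\<^bsub>M\<^esub> v b = g (a \<odot>\<^bsub>free_module R B\<^esub> basis_vec R b)"
      using linear_map_smult[OF g(1) add(2) e] g(2) add(3) by simp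
    ultimately have "r (a \<odot>\<^bsub>free_module R B\<^esub> basis_vec R b) (g (a \<odot>\<^bsub>free_module R B\<^esub> basis_vec R b))"
      by simp
    then show ?case
      using assms(2)[OF add(1) ae linear_map_closed[OF g(1) add(1)] linear_map_closed[OF g(1) ae] add(4)]
        linear_map_add[OF g(1) add(1) ae] by simp
  qed
  then show ?thesis using g by blast
qed

text \<open>All of K serves as its own generating set. The injection \<open>c\<close> moves it into
  the prescribed type of basis elements, which has to stay the same throughout a resolution.\<close>

lemma (in plain_module) ex_free_cover:
  fixes c :: "_ \<Rightarrow> 'b"
  assumes K: "submodule K R M" and c: "inj_on c K"
  shows "\<exists>(B :: 'b set) g. linear_map R (free_module R B) M g \<and> g ` carrier (free_module R B) = K"
proof -
  let ?F = "free_module R (c ` K)"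
  interpret F: module R ?F by (rule module_free_module)
  have KM: "K \<subseteq> carrier M" using submoduleE(1)[OF K] .
  have "inv_into K c b \<in> carrier M" if "b \<in> c ` K" for b using subsetD[OF KM inv_into_into[OF that]] .
  then obtain g where g: "linear_map R ?F M g" "\<forall>b\<in>c ` K. g (basis_vec R b) = inv_into K c b"
    using ex_linear_map_free_module[of "c ` K" "inv_into K c"] by auto
  have "g y \<in> K" if "y \<in> carrier ?F" for y
    using that
  proof (induction rule: free_module_induct)
    case zero
    have "\<zero>\<^bsub>M\<^esub> \<in> K" using subgroup.one_closed[OF submodule.axioms(1)[OF K]] by simp
    then show ?case using linear_map_zero[OF F.module_axioms module_axioms g(1)] by simp
  next
    case (add y a b)
    note e = basis_vec_in_free_module[OF add(3)]
    have ae: "a \<odot>\<^bsub>?F\<^esub> basis_vec R b \<in> carrier ?F" using add(2) e by (rule F.smult_closed)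
    have "g (a \<odot>\<^bsub>?F\<^esub> basis_vec R b) = a \<odot>\<^bsub>M\<^esub> inv_into K c b"
      using linear_map_smult[OF g(1) add(2) e] g(2) add(3) by simp
    then have "g (a \<odot>\<^bsub>?F\<^esub> basis_vec R b) \<in> K"
      using submoduleE(4)[OF K add(2)] inv_into_into[OF add(3)] by simp
    then show ?case using linear_map_add[OF g(1) add(1) ae] submoduleE(5)[OF K add(4)] by simp
  qed
  moreover have "k \<in> g ` carrier ?F" if k: "k \<in> K" for k
  proof -
    have "g (basis_vec R (c k)) = k" using g(2) k inv_into_f_f[OF c k] by simp
    then show ?thesis using basis_vec_in_free_module[of "c k" "c ` K"] k by (metis imageI)
  qed
  ultimately show ?thesis using g(1) by (intro exI[of _ "c ` K"] exI[of _ g]) auto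
qed

section \<open>Existence of free resolutions\<close>

text \<open>A prefix code for p \<noteq> q: p announces a letter and q ends the word, so a
  concatenation of coded words can be parsed in one way only.\<close>

fun word_code :: "'c \<Rightarrow> 'c \<Rightarrow> 'c list \<Rightarrow> 'c list" where
  "word_code p q [] = [q]"
| "word_code p q (x # xs) = p # x # word_code p q xs"

lemma word_code_append_eq:
  "p \<noteq> q \<Longrightarrow> word_code p q xs @ us = word_code p q ys @ vs \<longleftrightarrow> xs = ys \<and> us = vs"
proof (induction xs arbitrary: ys)
  case Nil
  then show ?case by (cases ys) auto
next
  case (Cons x xs)
  then show ?case by (cases ys) auto
qed

lemma inj_concat_word_code:
  assumes "p \<noteq> q"
  shows "inj (\<lambda>xss. concat (map (word_code p q) xss))"
proof (rule injI)
  fix xss yss :: "'a list list"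
  assume "concat (map (word_code p q) xss) = concat (map (word_code p q) yss)"
  then show "xss = yss"
  proof (induction xss arbitrary: yss)
    case Nil
    then show ?case by (cases yss; cases "hd yss") auto
  next
    case (Cons xs xss)
    show ?case
    proof (cases yss)
      case Nil
      then show ?thesis using Cons.prems by (cases xs) auto
    next
      case (Cons ys yss')
      then show ?thesis using Cons.IH Cons.prems word_code_append_eq[OF assms] by auto
    qed
  qed
qed

text \<open>A finitely supported function is determined by its finite graph. The pair of b and f b
  becomes the word \<open>Inl (f b) # b\<close>, a list of these words represents the graph, and the
  prefix code turns that list into one word. The two summands of the type provide distinct markers.
  So a free module with basis in this type injects into the basis type, and its submodules can again
  be covered by free modules of that kind.\<close>

lemma ex_inj_finite_support:
  "\<exists>c :: (('a + 'm) list \<Rightarrow> 'a) \<Rightarrow> ('a + 'm) list. inj_on c {f. finite {b. f b \<noteq> z}}"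
proof -
  define G :: "(('a + 'm) list \<Rightarrow> 'a) \<Rightarrow> ('a + 'm) list set"
    where "G f = (\<lambda>b. Inl (f b) # b) ` {b. f b \<noteq> z}" for f
  have "\<exists>xs. set xs = G f" if "finite {b. f b \<noteq> z}" for f
    using that by (intro finite_list) (simp add: G_def)
  then obtain L where L: "\<And>f. finite {b. f b \<noteq> z} \<Longrightarrow> set (L f) = G f" by metis
  have G_inj: "f = g" if "G f = G g" for f g
  proof (rule ext)
    fix b
    have "Inl x # b \<in> G h \<longleftrightarrow> h b = x \<and> x \<noteq> z" for x and h by (auto simp: G_def)
    then show "f b = g b" using that by metis
  qed
  have "inj_on (\<lambda>f. concat (map (word_code (Inl undefined) (Inr undefined)) (L f))) {f. finite {b. f b \<noteq> z}}"
  proof (rule inj_onI)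
    fix f g assume fg: "f \<in> {f. finite {b. f b \<noteq> z}}" "g \<in> {f. finite {b. f b \<noteq> z}}"
      and "concat (map (word_code (Inl undefined) (Inr undefined)) (L f)) =
        concat (map (word_code (Inl undefined) (Inr undefined)) (L g))"
    then have "L f = L g" using injD[OF inj_concat_word_code[of "Inl undefined" "Inr undefined"]] by simp
    then show "f = g" using L fg G_inj by (metis mem_Collect_eq)
  qed
  then show ?thesis by blast
qed

lemma (in plain_module) ex_free_resolution:
  "\<exists>(B :: nat \<Rightarrow> ('a + 'm) list set) \<delta> \<epsilon>. free_resolution R M B \<epsilon> \<delta>"
proof -
  let ?F = "\<lambda>B :: ('a + 'm) list set. free_module R B"
  obtain c :: "(('a + 'm) list \<Rightarrow> 'a) \<Rightarrow> ('a + 'm) list" where c: "inj_on c {f. finite {b. f b \<noteq> \<zero>}}"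
    using ex_inj_finite_support by (rule exE)
  have inj: "inj_on (\<lambda>m. [Inr m :: 'a + 'm]) (carrier M)" by (auto simp: inj_on_def)
  then obtain B0 :: "('a + 'm) list set" and e where e: "linear_map R (?F B0) M e"
    "e ` carrier (?F B0) = carrier M"
    using ex_free_cover[OF carrier_is_submodule inj] by (elim exE conjE)
  have step: "\<exists>B' g. linear_map R (?F B') (?F B) g \<and> g ` carrier (?F B') = K" if "submodule K R (?F B)" for B K
  proof -
    interpret F: plain_module R "?F B" by (intro plain_module.intro module_free_module)
    have "K \<subseteq> {f. finite {b. f b \<noteq> \<zero>}}" using F.submoduleE(1)[OF that] by (auto simp: free_module_iff)
    then show ?thesis using F.ex_free_cover[OF that inj_on_subset[OF c]] by simp
  qed
  \<comment> \<open>The state is a basis together with the kernel that the next free module has to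
    cover. The clause for n = 0 fixes the start of the sequence, since
    \<open>dependent_nat_choice\<close> only guarantees that some admissible start is used.\<close>
  let ?P = "\<lambda>n (B, K). (n = (0::nat) \<longrightarrow> B = B0 \<and> K = mod_ker (?F B0) M e) \<and> submodule K R (?F B)"
  let ?Q = "\<lambda>n (B, K) (B', K'). \<exists>g. linear_map R (?F B') (?F B) g \<and> g ` carrier (?F B') = K \<and>
    K' = mod_ker (?F B') (?F B) g"
  have "\<exists>f. \<forall>n. ?P n (f n) \<and> ?Q n (f n) (f (Suc n))"
  proof (rule dependent_nat_choice)
    show "\<exists>x. ?P 0 x"
      using submodule_mod_ker[OF module_free_module module_axioms e(1)] by auto
    fix x n assume "?P n x"
    then obtain B K where x: "x = (B, K)" "submodule K R (?F B)" by (cases x) simp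
    obtain B' g where g: "linear_map R (?F B') (?F B) g" "g ` carrier (?F B') = K"
      using step[OF x(2)] by (elim exE conjE)
    have "submodule (mod_ker (?F B') (?F B) g) R (?F B')"
      using submodule_mod_ker[OF module_free_module module_free_module g(1)] .
    then have "?P (Suc n) (B', mod_ker (?F B') (?F B) g)" by simp
    moreover have "?Q n x (B', mod_ker (?F B') (?F B) g)"
      unfolding x(1) prod.case using g by (intro exI[of _ g] conjI refl)
    ultimately show "\<exists>y. ?P (Suc n) y \<and> ?Q n x y" by (intro exI conjI)
  qed
  then obtain f where all: "\<forall>n. ?P n (f n) \<and> ?Q n (f n) (f (Suc n))" by (rule exE)
  have f: "?P n (f n)" "?Q n (f n) (f (Suc n))" for n using conjunct1[OF spec[OF all]] conjunct2[OF spec[OF all]] by this+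
  define B where "B n = fst (f n)" for n
  have f0: "f 0 = (B0, mod_ker (?F B0) M e)" using f(1)[of 0] by (cases "f 0") auto
  have "\<exists>g. linear_map R (?F (B (Suc n))) (?F (B n)) g \<and> g ` carrier (?F (B (Suc n))) = snd (f n) \<and>
    snd (f (Suc n)) = mod_ker (?F (B (Suc n))) (?F (B n)) g" for n
    using f(2)[of n] by (simp add: B_def case_prod_beta)
  then obtain d where d: "\<And>n. linear_map R (?F (B (Suc n))) (?F (B n)) (d n)"
    "\<And>n. d n ` carrier (?F (B (Suc n))) = snd (f n)"
    "\<And>n. snd (f (Suc n)) = mod_ker (?F (B (Suc n))) (?F (B n)) (d n)" by metis
  let ?\<delta> = "\<lambda>n. restrict (d n) (carrier (?F (B (Suc n))))" and ?\<epsilon> = "restrict e (carrier (?F B0))"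
  have ker: "mod_ker (?F (B (Suc n))) (?F (B n)) (?\<delta> n) = mod_ker (?F (B (Suc n))) (?F (B n)) (d n)" for n
    by (auto simp: mod_ker_def)
  have ker0: "mod_ker (?F B0) M ?\<epsilon> = mod_ker (?F B0) M e"
    by (auto simp: mod_ker_def)
  have B0: "B 0 = B0" using f0 by (simp add: B_def)
  have "free_resolution R M B ?\<epsilon> ?\<delta>"
    unfolding free_resolution_def Let_def
    using restrict_mod_hom[OF module_free_module e(1)] restrict_mod_hom[OF module_free_module d(1)]
      e(2) d(2)[of 0] f0 d(2)[of "Suc _"] d(3) ker ker0
    by (simp add: B0)
  then show ?thesis by blast
qed

section \<open>Cohomology of the dual of a free resolution\<close>

text \<open>The resolution is arbitrary, so the results apply to whichever one the choice operator
  in \<open>Ext_module\<close> returns.\<close>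

locale resolved_module = plain_module R M
  for R :: "('a, 'c) ring_scheme" (structure) and M :: "('a, 'm) module" (structure) +
  fixes B :: "nat \<Rightarrow> 'b set" and \<epsilon> :: "('b \<Rightarrow> 'a) \<Rightarrow> 'm" and \<delta> :: "nat \<Rightarrow> ('b \<Rightarrow> 'a) \<Rightarrow> 'b \<Rightarrow> 'a"
  assumes resolution: "free_resolution R M B \<epsilon> \<delta>"
begin

abbreviation F :: "nat \<Rightarrow> ('a, 'b \<Rightarrow> 'a) module"
  where "F i \<equiv> free_module R (B i)"

abbreviation cochain :: "nat \<Rightarrow> (('b \<Rightarrow> 'a) \<Rightarrow> 'a) \<Rightarrow> bool"
  where "cochain i f \<equiv> linear_map R (F i) (self_module R) f"

lemma plain_module_F: "plain_module R (F i)"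
  by (rule plain_module.intro[OF module_free_module])

lemma plain_module_self: "plain_module R (self_module R)"
  by (rule plain_module.intro[OF module_self_module[OF is_cring]])

lemma linear_eps: "linear_map R (F 0) M \<epsilon>"
  using resolution by (simp add: free_resolution_def Let_def mod_hom_iff)

lemma linear_delta: "linear_map R (F (Suc i)) (F i) (\<delta> i)"
  using resolution by (simp add: free_resolution_def Let_def mod_hom_iff)

lemma eps_image: "\<epsilon> ` carrier (F 0) = carrier M"
  using resolution by (simp add: free_resolution_def Let_def)

lemma ker_eps: "\<delta> 0 ` carrier (F (Suc 0)) = mod_ker (F 0) M \<epsilon>"
  using resolution by (simp add: free_resolution_def Let_def)

lemma ker_delta: "\<delta> (Suc i) ` carrier (F (Suc (Suc i))) = mod_ker (F (Suc i)) (F i) (\<delta> i)"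
  using resolution by (simp add: free_resolution_def Let_def)

lemmas delta_closed = linear_map_closed[OF linear_delta]

lemma exact_eps:
  assumes "y \<in> carrier (F 0)" "\<epsilon> y = \<zero>\<^bsub>M\<^esub>"
  shows "\<exists>z\<in>carrier (F (Suc 0)). \<delta> 0 z = y"
proof -
  have "y \<in> \<delta> 0 ` carrier (F (Suc 0))" unfolding ker_eps using assms by (simp add: mod_ker_def)
  then show ?thesis by auto
qed

lemma exact_delta:
  assumes "y \<in> carrier (F (Suc i))" "\<delta> i y = \<zero>\<^bsub>F i\<^esub>"
  shows "\<exists>z\<in>carrier (F (Suc (Suc i))). \<delta> (Suc i) z = y"
proof -
  have "y \<in> \<delta> (Suc i) ` carrier (F (Suc (Suc i)))" unfolding ker_delta using assms by (simp add: mod_ker_def)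
  then show ?thesis by auto
qed

lemma eps_delta: "z \<in> carrier (F (Suc 0)) \<Longrightarrow> \<epsilon> (\<delta> 0 z) = \<zero>\<^bsub>M\<^esub>"
  using imageI[of z "carrier (F (Suc 0))" "\<delta> 0"] unfolding ker_eps by (simp add: mod_ker_def)

lemma delta_delta: "z \<in> carrier (F (Suc (Suc i))) \<Longrightarrow> \<delta> i (\<delta> (Suc i) z) = \<zero>\<^bsub>F i\<^esub>"
  using imageI[of z "carrier (F (Suc (Suc i)))" "\<delta> (Suc i)"] unfolding ker_delta by (simp add: mod_ker_def)

lemma cochainD:
  assumes "cochain i f"
  shows cochain_closed: "y \<in> carrier (F i) \<Longrightarrow> f y \<in> carrier R"
    and cochain_smult: "\<lbrakk>a \<in> carrier R; y \<in> carrier (F i)\<rbrakk> \<Longrightarrow> f (a \<odot>\<^bsub>F i\<^esub> y) = a \<otimes> f y"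
    and cochain_add: "\<lbrakk>y \<in> carrier (F i); z \<in> carrier (F i)\<rbrakk> \<Longrightarrow> f (y \<oplus>\<^bsub>F i\<^esub> z) = f y \<oplus> f z"
    and cochain_zero: "f \<zero>\<^bsub>F i\<^esub> = \<zero>"
    and cochain_minus: "\<lbrakk>y \<in> carrier (F i); z \<in> carrier (F i)\<rbrakk> \<Longrightarrow> f (y \<ominus>\<^bsub>F i\<^esub> z) = f y \<ominus> f z"
proof -
  note self = module_self_module[OF is_cring]
  show "y \<in> carrier (F i) \<Longrightarrow> f y \<in> carrier R"
    using linear_map_closed[OF assms, of y] by simp
  show "\<lbrakk>a \<in> carrier R; y \<in> carrier (F i)\<rbrakk> \<Longrightarrow> f (a \<odot>\<^bsub>F i\<^esub> y) = a \<otimes> f y"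
    using linear_map_smult[OF assms, of a y] by simp
  show "\<lbrakk>y \<in> carrier (F i); z \<in> carrier (F i)\<rbrakk> \<Longrightarrow> f (y \<oplus>\<^bsub>F i\<^esub> z) = f y \<oplus> f z"
    using linear_map_add[OF assms, of y z] by simp
  show "f \<zero>\<^bsub>F i\<^esub> = \<zero>"
    using linear_map_zero[OF module_free_module self assms] by simp
  show "\<lbrakk>y \<in> carrier (F i); z \<in> carrier (F i)\<rbrakk> \<Longrightarrow> f (y \<ominus>\<^bsub>F i\<^esub> z) = f y \<ominus> f z"
    using linear_map_minus[OF module_free_module self assms, of y z]
    by (simp add: a_minus_def a_inv_def m_inv_def)
qed

lemma cochain_comb:
  assumes "cochain i f" "cochain i g" "a \<in> carrier R" "b \<in> carrier R"
  shows "cochain i (\<lambda>y. a \<otimes> f y \<oplus> b \<otimes> g y)"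
proof -
  note self = module_self_module[OF is_cring]
  show ?thesis
    using linear_map_add_fun[OF self linear_map_smult_fun[OF self assms(1,3)] linear_map_smult_fun[OF self assms(2,4)]]
    by simp
qed

lemma cochain_scale: "\<lbrakk>cochain i f; a \<in> carrier R\<rbrakk> \<Longrightarrow> cochain i (\<lambda>y. a \<otimes> f y)"
  using linear_map_smult_fun[OF module_self_module[OF is_cring], of "F i" f a] by simp

lemma cochain_delta: "cochain i f \<Longrightarrow> cochain (Suc i) (\<lambda>y. f (\<delta> i y))"
  by (rule linear_map_comp[OF linear_delta])

text \<open>Cocycles and coboundaries of \<open>Hom(F, R/J)\<close>, represented by maps to \<open>R\<close>. This is possible since
  the \<open>F i\<close> are free.\<close>

definition cocycle :: "'a set \<Rightarrow> nat \<Rightarrow> (('b \<Rightarrow> 'a) \<Rightarrow> 'a) \<Rightarrow> bool"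
  where "cocycle J i f \<longleftrightarrow> cochain i f \<and> (\<forall>y\<in>carrier (F (Suc i)). f (\<delta> i y) \<in> J)"

definition coboundary :: "'a set \<Rightarrow> nat \<Rightarrow> (('b \<Rightarrow> 'a) \<Rightarrow> 'a) \<Rightarrow> bool"
  where "coboundary J i f \<longleftrightarrow> (case i of 0 \<Rightarrow> \<forall>y\<in>carrier (F 0). f y \<in> J
    | Suc j \<Rightarrow> \<exists>g. cochain j g \<and> (\<forall>y\<in>carrier (F (Suc j)). f y \<ominus> g (\<delta> j y) \<in> J))"

lemma coboundary_0: "coboundary J 0 f \<longleftrightarrow> (\<forall>y\<in>carrier (F 0). f y \<in> J)"
  by (simp add: coboundary_def)

lemma coboundary_Suc:
  "coboundary J (Suc j) f \<longleftrightarrow> (\<exists>g. cochain j g \<and> (\<forall>y\<in>carrier (F (Suc j)). f y \<ominus> g (\<delta> j y) \<in> J))"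
  by (simp add: coboundary_def)

text \<open>Multiplication by x maps R onto (J + xR)/J, and a map from a free module to the target
  lifts along this surjection.\<close>

lemma cochain_divide:
  assumes J: "ideal J R" and x: "x \<in> carrier R" and h: "cochain i h"
    and hx: "\<And>y. y \<in> carrier (F i) \<Longrightarrow> h y \<in> ideal_insert x J"
  shows "\<exists>g. cochain i g \<and> (\<forall>y\<in>carrier (F i). h y \<ominus> x \<otimes> g y \<in> J)"
proof -
  note hD = cochainD[OF h]
  show ?thesis
  proof (rule plain_module.free_module_relation_lift[OF plain_module_self], goal_cases)
    case 1
    show ?case using hD(4) x ideal_zero[OF J] by (simp add: a_minus_def)
  next
    case (2 y z v w)
    have c: "h y \<in> carrier R" "h z \<in> carrier R" "v \<in> carrier R" "w \<in> carrier R"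
      using 2 hD(1) by simp_all
    have "h (y \<oplus>\<^bsub>F i\<^esub> z) \<ominus> x \<otimes> (v \<oplus> w) = (h y \<ominus> x \<otimes> v) \<oplus> (h z \<ominus> x \<otimes> w)"
      unfolding hD(3)[OF 2(1,2)] using c x by algebra
    then show ?case using ideal_add[OF J 2(5,6)] by simp
  next
    case (3 a y v)
    have c: "h y \<in> carrier R" "v \<in> carrier R" using 3 hD(1) by simp_all
    have "h (a \<odot>\<^bsub>F i\<^esub> y) \<ominus> x \<otimes> (a \<otimes> v) = a \<otimes> (h y \<ominus> x \<otimes> v)"
      unfolding hD(2)[OF 3(1,2)] using c x 3(1) by algebra
    then show ?case using ideal_mult[OF J 3(1,4)] by simp
  next
    case (4 y)
    then show ?case using ideal_insert_iff[OF J x hD(1)[OF 4]] hx[OF 4] by simp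
  qed
qed

section \<open>Multiplication by an annihilator of M is null-homotopic\<close>

lemma homotopy_0:
  assumes x: "x \<in> annihilator"
  shows "\<exists>s. linear_map R (F 0) (F (Suc 0)) s \<and> (\<forall>y\<in>carrier (F 0). \<delta> 0 (s y) = x \<odot>\<^bsub>F 0\<^esub> y)"
proof -
  interpret F0: plain_module R "F 0" by (rule plain_module_F)
  have xR: "x \<in> carrier R" using x by (simp add: annihilator_def)
  note d = linear_mapD[OF linear_delta[of 0]]
  show ?thesis
  proof (rule plain_module.free_module_relation_lift[OF plain_module_F], goal_cases)
    case 1
    show ?case using linear_map_zero[OF module_free_module module_free_module linear_delta[of 0]] F0.smult_r_null[OF xR]
      by simp
  next
    case (2 y z v w)
    have "\<delta> 0 (v \<oplus>\<^bsub>F (Suc 0)\<^esub> w) = x \<odot>\<^bsub>F 0\<^esub> y \<oplus>\<^bsub>F 0\<^esub> x \<odot>\<^bsub>F 0\<^esub> z"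
      using d(2)[OF 2(3,4)] 2(5,6) by simp
    then show ?case using F0.smult_r_distr[OF xR 2(1,2)] by simp
  next
    case (3 a y v)
    have "\<delta> 0 (a \<odot>\<^bsub>F (Suc 0)\<^esub> v) = (a \<otimes> x) \<odot>\<^bsub>F 0\<^esub> y"
      using d(3)[OF 3(1,3)] 3(4) F0.smult_assoc1[OF 3(1) xR 3(2)] by simp
    also have "\<dots> = x \<odot>\<^bsub>F 0\<^esub> (a \<odot>\<^bsub>F 0\<^esub> y)"
      using F0.smult_assoc1[OF xR 3(1,2)] m_comm[OF xR 3(1)] by simp
    finally show ?case .
  next
    case (4 y)
    \<comment> \<open>Since x kills M, the multiple x y lies in the kernel of the augmentation,
      hence is a boundary.\<close>
    have "\<epsilon> (x \<odot>\<^bsub>F 0\<^esub> y) = \<zero>\<^bsub>M\<^esub>"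
      using linear_map_smult[OF linear_eps xR 4] linear_map_closed[OF linear_eps 4] x
      by (simp add: annihilator_def)
    then show ?case by (rule exact_eps[OF F0.smult_closed[OF xR 4]])
  qed
qed

text \<open>The next map t must satisfy \<delta> t = x - s \<delta>, which is solvable because the
  right side consists of cycles. For this the homotopy identity for s is needed only on boundaries,
  where its other term vanishes as \<delta> \<delta> = 0.\<close>

lemma homotopy_Suc:
  assumes x: "x \<in> carrier R" and s: "linear_map R (F i) (F (Suc i)) s"
    and sx: "\<forall>z\<in>carrier (F (Suc i)). \<delta> i (s (\<delta> i z)) = x \<odot>\<^bsub>F i\<^esub> \<delta> i z"
  shows "\<exists>t. linear_map R (F (Suc i)) (F (Suc (Suc i))) t \<and>
    (\<forall>y\<in>carrier (F (Suc i)). \<delta> (Suc i) (t y) = x \<odot>\<^bsub>F (Suc i)\<^esub> y \<ominus>\<^bsub>F (Suc i)\<^esub> s (\<delta> i y))"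
proof -
  interpret G: plain_module R "F i" by (rule plain_module_F)
  interpret F: plain_module R "F (Suc i)" by (rule plain_module_F)
  note d = linear_mapD[OF linear_delta[of "Suc i"]] and d' = linear_mapD[OF linear_delta[of i]]
    and sD = linear_mapD[OF s]
  have c: "s (\<delta> i y) \<in> carrier (F (Suc i))" if "y \<in> carrier (F (Suc i))" for y
    by (rule sD(1)[OF d'(1)[OF that]])
  have lin: "linear_map R (F (Suc i)) (F (Suc i)) (\<lambda>y. x \<odot>\<^bsub>F (Suc i)\<^esub> y \<ominus>\<^bsub>F (Suc i)\<^esub> s (\<delta> i y))"
    (is "linear_map _ _ _ ?h")
  proof -
    have "linear_map R (F (Suc i)) (F (Suc i)) (\<lambda>y. y)" by (simp add: linear_map_def)
    from linear_map_smult_fun[OF module_free_module this x]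
    have 1: "linear_map R (F (Suc i)) (F (Suc i)) (\<lambda>y. x \<odot>\<^bsub>F (Suc i)\<^esub> y)" .
    have m: "\<ominus> \<one> \<in> carrier R" by simp
    have "linear_map R (F (Suc i)) (F (Suc i))
      (\<lambda>y. x \<odot>\<^bsub>F (Suc i)\<^esub> y \<oplus>\<^bsub>F (Suc i)\<^esub> (\<ominus> \<one>) \<odot>\<^bsub>F (Suc i)\<^esub> s (\<delta> i y))"
      by (rule linear_map_add_fun[OF module_free_module 1
        linear_map_smult_fun[OF module_free_module linear_map_comp[OF linear_delta s] m]])
    moreover have "x \<odot>\<^bsub>F (Suc i)\<^esub> y \<oplus>\<^bsub>F (Suc i)\<^esub> (\<ominus> \<one>) \<odot>\<^bsub>F (Suc i)\<^esub> s (\<delta> i y) = ?h y"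
      if "y \<in> carrier (F (Suc i))" for y
      using F.smult_l_minus[OF one_closed c[OF that]] F.smult_one[OF c[OF that]]
      unfolding a_minus_def by (simp only:)
    ultimately show ?thesis
      using linear_map_cong[OF module_free_module, of "B (Suc i)"
        "\<lambda>y. x \<odot>\<^bsub>F (Suc i)\<^esub> y \<oplus>\<^bsub>F (Suc i)\<^esub> (\<ominus> \<one>) \<odot>\<^bsub>F (Suc i)\<^esub> s (\<delta> i y)" ?h] by blast
  qed
  note h = linear_mapD[OF lin]
  show ?thesis
  proof (rule plain_module.free_module_relation_lift[OF plain_module_F], goal_cases)
    case 1
    show ?case
      using linear_map_zero[OF module_free_module module_free_module linear_delta[of "Suc i"]]
        linear_map_zero[OF module_free_module module_free_module lin] by (simp only:)
  next
    case (2 y z v w)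
    show ?case unfolding d(2)[OF 2(3,4)] h(2)[OF 2(1,2)] 2(5,6) ..
  next
    case (3 a y v)
    show ?case unfolding d(3)[OF 3(1,3)] h(3)[OF 3(1,2)] 3(4) ..
  next
    case (4 y)
    have xy: "x \<odot>\<^bsub>F (Suc i)\<^esub> y \<in> carrier (F (Suc i))" by (rule F.smult_closed[OF x 4])
    have "\<delta> i (?h y) = \<delta> i (x \<odot>\<^bsub>F (Suc i)\<^esub> y) \<ominus>\<^bsub>F i\<^esub> \<delta> i (s (\<delta> i y))"
      by (rule linear_map_minus[OF module_free_module module_free_module linear_delta xy c[OF 4]])
    also have "\<dots> = x \<odot>\<^bsub>F i\<^esub> \<delta> i y \<ominus>\<^bsub>F i\<^esub> x \<odot>\<^bsub>F i\<^esub> \<delta> i y"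
      unfolding d'(3)[OF x 4] bspec[OF sx 4] ..
    also have "\<dots> = \<zero>\<^bsub>F i\<^esub>"
      unfolding a_minus_def by (rule G.M.r_neg[OF G.smult_closed[OF x d'(1)[OF 4]]])
    finally show ?case by (rule exact_delta[OF h(1)[OF 4]])
  qed
qed

text \<open>The identity is recorded only on boundaries, so it involves a single map and can be
  proved by induction without carrying along the preceding one.\<close>

lemma ex_homotopy:
  assumes x: "x \<in> annihilator"
  shows "\<exists>s. linear_map R (F i) (F (Suc i)) s \<and>
    (\<forall>z\<in>carrier (F (Suc i)). \<delta> i (s (\<delta> i z)) = x \<odot>\<^bsub>F i\<^esub> \<delta> i z)"
proof (induction i)
  case 0
  obtain s where s: "linear_map R (F 0) (F (Suc 0)) s" "\<forall>y\<in>carrier (F 0). \<delta> 0 (s y) = x \<odot>\<^bsub>F 0\<^esub> y"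
    using homotopy_0[OF x] by (elim exE conjE)
  then show ?case using delta_closed[of _ 0] by (intro exI[of _ s]) simp
next
  case (Suc i)
  have xR: "x \<in> carrier R" using x by (simp add: annihilator_def)
  interpret F: plain_module R "F (Suc i)" by (rule plain_module_F)
  obtain s where s: "linear_map R (F i) (F (Suc i)) s"
    "\<forall>z\<in>carrier (F (Suc i)). \<delta> i (s (\<delta> i z)) = x \<odot>\<^bsub>F i\<^esub> \<delta> i z"
    using Suc.IH by (elim exE conjE)
  obtain t where t: "linear_map R (F (Suc i)) (F (Suc (Suc i))) t"
    and tx: "\<forall>y\<in>carrier (F (Suc i)). \<delta> (Suc i) (t y) = x \<odot>\<^bsub>F (Suc i)\<^esub> y \<ominus>\<^bsub>F (Suc i)\<^esub> s (\<delta> i y)"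
    using homotopy_Suc[OF xR s] by (elim exE conjE)
  have "\<delta> (Suc i) (t (\<delta> (Suc i) z)) = x \<odot>\<^bsub>F (Suc i)\<^esub> \<delta> (Suc i) z" if z: "z \<in> carrier (F (Suc (Suc i)))" for z
  proof -
    note dz = delta_closed[OF z]
    have "s (\<delta> i (\<delta> (Suc i) z)) = \<zero>\<^bsub>F (Suc i)\<^esub>"
      unfolding delta_delta[OF z] by (rule linear_map_zero[OF module_free_module module_free_module s(1)])
    then have "\<delta> (Suc i) (t (\<delta> (Suc i) z)) = x \<odot>\<^bsub>F (Suc i)\<^esub> \<delta> (Suc i) z \<ominus>\<^bsub>F (Suc i)\<^esub> \<zero>\<^bsub>F (Suc i)\<^esub>"
      using bspec[OF tx dz] by (simp only:)
    then show ?thesis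
      using F.M.r_zero[OF F.smult_closed[OF xR dz]] F.M.add.inv_one by (simp only: a_minus_def a_inv_def)
  qed
  then show ?case using t by (intro exI[of _ t] conjI ballI)
qed

text \<open>With x = \<delta> t + s \<delta> one gets x f = (f \<delta>) t + (f s) \<delta>. The
  first term has values in J because f is a cocycle, and the second is a coboundary; in degree 0 it
  is absent.\<close>

lemma annihilator_coboundary:
  assumes x: "x \<in> annihilator" and J: "ideal J R" and f: "cocycle J i f"
  shows "coboundary J i (\<lambda>y. x \<otimes> f y)"
proof -
  have xR: "x \<in> carrier R" using x by (simp add: annihilator_def)
  have fc: "cochain i f" and fJ: "\<And>y. y \<in> carrier (F (Suc i)) \<Longrightarrow> f (\<delta> i y) \<in> J"
    using f by (simp_all add: cocycle_def)
  note fD = cochainD[OF fc]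
  show ?thesis
  proof (cases i)
    case 0
    obtain s where s: "linear_map R (F 0) (F (Suc 0)) s" "\<forall>y\<in>carrier (F 0). \<delta> 0 (s y) = x \<odot>\<^bsub>F 0\<^esub> y"
      using homotopy_0[OF x] by (elim exE conjE)
    have "x \<otimes> f y \<in> J" if y: "y \<in> carrier (F 0)" for y
      using fJ[of "s y"] linear_map_closed[OF s(1) y] bspec[OF s(2) y] fD(2)[OF xR, of y] y
      unfolding 0 by simp
    then show ?thesis unfolding 0 coboundary_0 by simp
  next
    case (Suc j)
    obtain s where s: "linear_map R (F j) (F (Suc j)) s"
      "\<forall>z\<in>carrier (F (Suc j)). \<delta> j (s (\<delta> j z)) = x \<odot>\<^bsub>F j\<^esub> \<delta> j z"
      using ex_homotopy[OF x, of j] by (elim exE conjE)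
    obtain t where t: "linear_map R (F (Suc j)) (F (Suc (Suc j))) t"
      and tx: "\<forall>y\<in>carrier (F (Suc j)). \<delta> (Suc j) (t y) = x \<odot>\<^bsub>F (Suc j)\<^esub> y \<ominus>\<^bsub>F (Suc j)\<^esub> s (\<delta> j y)"
      using homotopy_Suc[OF xR s] by (elim exE conjE)
    interpret F: plain_module R "F (Suc j)" by (rule plain_module_F)
    have "cochain j (\<lambda>y. f (s y))" by (rule linear_map_comp[OF s(1) fc[unfolded Suc]])
    moreover have "x \<otimes> f y \<ominus> f (s (\<delta> j y)) \<in> J" if y: "y \<in> carrier (F (Suc j))" for y
    proof -
      have "f (x \<odot>\<^bsub>F (Suc j)\<^esub> y \<ominus>\<^bsub>F (Suc j)\<^esub> s (\<delta> j y)) = x \<otimes> f y \<ominus> f (s (\<delta> j y))"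
        using cochain_minus[OF fc[unfolded Suc] F.smult_closed[OF xR y] linear_map_closed[OF s(1) delta_closed[OF y]]]
          cochain_smult[OF fc[unfolded Suc] xR y] by (simp only:)
      then show ?thesis
        using fJ[of "t y"] linear_map_closed[OF t y] bspec[OF tx y] unfolding Suc by (simp only:)
    qed
    ultimately show ?thesis unfolding Suc coboundary_Suc by (intro exI[of _ "\<lambda>y. f (s y)"]) simp
  qed
qed

text \<open>This is the vanishing of Ext^i(M, R/J) with J generated by the first k elements and k +
  i < n. The element \<open>x k\<close> kills this Ext, since it annihilates M. It also acts
  injectively: the kernel is the image of Ext in degree i - 1 with coefficients R/(J + x_k R), zero
  by induction, and in degree 0 regularity suffices.\<close>

lemma cocycle_imp_coboundary:
  assumes x: "\<And>k. k < n \<Longrightarrow> x k \<in> annihilator" "\<And>k. k < n \<Longrightarrow> nzd_mod (seq_ideal x k) (x k)"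
  shows "\<lbrakk>k + i < n; cocycle (seq_ideal x k) i f\<rbrakk> \<Longrightarrow> coboundary (seq_ideal x k) i f"
proof (induction i arbitrary: k f)
  case (0 k f)
  let ?J = "seq_ideal x k"
  have k: "x k \<in> annihilator" "nzd_mod ?J (x k)" using x 0(1) by simp_all
  have xR: "x i \<in> carrier R" if "i \<le> k" for i using x(1)[of i] that 0(1) by (simp add: annihilator_def)
  have J: "ideal ?J R" using xR by (simp add: seq_ideal_ideal)
  have "coboundary ?J 0 (\<lambda>y. x k \<otimes> f y)" by (rule annihilator_coboundary[OF k(1) J 0(2)])
  moreover have "f y \<in> carrier R" if "y \<in> carrier (F 0)" for y
    using 0(2) cochain_closed that unfolding cocycle_def by blast
  ultimately show ?case using k(2) by (simp add: coboundary_0 nzd_mod_def)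
next
  case (Suc i k f)
  let ?J = "seq_ideal x k"
  have k: "x k \<in> annihilator" "nzd_mod ?J (x k)" using x Suc.prems(1) by simp_all
  have xR: "x i \<in> carrier R" if "i \<le> k" for i
    using x(1)[of i] that Suc.prems(1) by (simp add: annihilator_def)
  note xk = xR[OF order_refl]
  have J: "ideal ?J R" using xR by (simp add: seq_ideal_ideal)
  have Jx: "ideal (ideal_insert (x k) ?J) R" by (rule ideal_insert_ideal[OF J xk])
  have fc: "cochain (Suc i) f" and fJ: "\<And>y. y \<in> carrier (F (Suc (Suc i))) \<Longrightarrow> f (\<delta> (Suc i) y) \<in> ?J"
    using Suc.prems(2) by (simp_all add: cocycle_def)
  have "coboundary ?J (Suc i) (\<lambda>y. x k \<otimes> f y)" by (rule annihilator_coboundary[OF k(1) J Suc.prems(2)])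
  then obtain g where g: "cochain i g" "\<forall>y\<in>carrier (F (Suc i)). x k \<otimes> f y \<ominus> g (\<delta> i y) \<in> ?J"
    unfolding coboundary_Suc by (elim exE conjE)
  have "g (\<delta> i y) \<in> ideal_insert (x k) ?J" if y: "y \<in> carrier (F (Suc i))" for y
  proof -
    have c: "f y \<in> carrier R" "g (\<delta> i y) \<in> carrier R"
      using cochain_closed[OF fc y] cochain_closed[OF g(1) delta_closed[OF y]] .
    have "g (\<delta> i y) = \<ominus> (x k \<otimes> f y \<ominus> g (\<delta> i y)) \<oplus> x k \<otimes> f y" using c xk by algebra
    then show ?thesis by (rule ideal_insertI) (use ideal_uminus[OF J bspec[OF g(2) y]] c in simp_all)
  qed
  then have "cocycle (seq_ideal x (Suc k)) i g" using g(1) by (simp add: cocycle_def)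
  then have cob: "coboundary (ideal_insert (x k) ?J) i g" using Suc.IH[of "Suc k" g] Suc.prems(1) by simp
  \<comment> \<open>The map g may be changed to a multiple of \<open>x k\<close>: as a coboundary
    modulo J + x_k R it is u \<delta> plus a multiple of \<open>x k\<close> modulo J, and u \<delta>
    disappears after composition with \<delta>. In degree 0 there is no u.\<close>
  have "\<exists>g'. cochain i g' \<and> (\<forall>y\<in>carrier (F (Suc i)). g (\<delta> i y) \<ominus> x k \<otimes> g' (\<delta> i y) \<in> ?J)"
  proof (cases i)
    case 0
    obtain g' where g': "cochain 0 g'" "\<forall>y\<in>carrier (F 0). g y \<ominus> x k \<otimes> g' y \<in> ?J"
      using cochain_divide[OF J xk g(1)[unfolded 0]] cob[unfolded 0 coboundary_0] by auto
    then show ?thesis using delta_closed[of _ 0] unfolding 0 by (intro exI[of _ g']) simp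
  next
    case (Suc j)
    obtain u where u: "cochain j u" "\<forall>y\<in>carrier (F (Suc j)). g y \<ominus> u (\<delta> j y) \<in> ideal_insert (x k) ?J"
      using cob unfolding Suc coboundary_Suc by (elim exE conjE)
    have ud: "cochain (Suc j) (\<lambda>y. u (\<delta> j y))" by (rule cochain_delta[OF u(1)])
    note gc = g(1)[unfolded Suc]
    let ?h = "\<lambda>y. \<one> \<otimes> g y \<oplus> (\<ominus> \<one>) \<otimes> u (\<delta> j y)"
    have h: "cochain (Suc j) ?h" by (rule cochain_comb[OF gc ud]) simp_all
    have h_eq: "?h y = g y \<ominus> u (\<delta> j y)" if "y \<in> carrier (F (Suc j))" for y
      using cochain_closed[OF gc that] cochain_closed[OF ud that] by (simp add: l_minus a_minus_def)
    have "?h y \<in> ideal_insert (x k) ?J" if "y \<in> carrier (F (Suc j))" for y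
      unfolding h_eq[OF that] using u(2) that by simp
    then obtain g' where g': "cochain (Suc j) g'" "\<forall>y\<in>carrier (F (Suc j)). ?h y \<ominus> x k \<otimes> g' y \<in> ?J"
      using cochain_divide[OF J xk h] by auto
    have "g (\<delta> (Suc j) y) \<ominus> x k \<otimes> g' (\<delta> (Suc j) y) \<in> ?J" if y: "y \<in> carrier (F (Suc (Suc j)))" for y
    proof -
      note dy = delta_closed[OF y]
      have "?h (\<delta> (Suc j) y) = g (\<delta> (Suc j) y)"
        using h_eq[OF dy] delta_delta[OF y] cochain_zero[OF u(1)] cochain_closed[OF gc dy]
        by (simp add: a_minus_def)
      then show ?thesis using bspec[OF g'(2) dy] by simp
    qed
    then show ?thesis unfolding Suc using g'(1) by (intro exI[of _ g'] conjI ballI)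
  qed
  then obtain g' where g': "cochain i g'" "\<forall>y\<in>carrier (F (Suc i)). g (\<delta> i y) \<ominus> x k \<otimes> g' (\<delta> i y) \<in> ?J"
    by (elim exE conjE)
  have "f y \<ominus> g' (\<delta> i y) \<in> ?J" if y: "y \<in> carrier (F (Suc i))" for y
  proof -
    have c: "f y \<in> carrier R" "g (\<delta> i y) \<in> carrier R" "g' (\<delta> i y) \<in> carrier R"
      using cochain_closed[OF fc y] cochain_closed[OF g(1) delta_closed[OF y]]
        cochain_closed[OF g'(1) delta_closed[OF y]] .
    have "x k \<otimes> (f y \<ominus> g' (\<delta> i y)) =
      (x k \<otimes> f y \<ominus> g (\<delta> i y)) \<oplus> (g (\<delta> i y) \<ominus> x k \<otimes> g' (\<delta> i y))" using c xk by algebra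
    then have "x k \<otimes> (f y \<ominus> g' (\<delta> i y)) \<in> ?J"
      using ideal_add[OF J bspec[OF g(2) y] bspec[OF g'(2) y]] by simp
    then show ?thesis using k(2) c by (simp add: nzd_mod_def)
  qed
  then show ?case unfolding coboundary_Suc using g'(1) by (intro exI[of _ g'] conjI ballI)
qed

text \<open>The iterated connecting homomorphism
  \<open>Hom(M, R/(x\<^sub>0, \<dots>)) \<rightarrow> Ext\<^sup>1(M, R/(x\<^sub>0, \<dots>)) \<rightarrow> \<dots>\<close>, dropping the last \<open>x\<^sub>k\<close> in each step. It is injective
  because the preceding \<open>Ext\<close> vanishes.\<close>

lemma connecting_step:
  assumes x: "\<And>k. k < n \<Longrightarrow> x k \<in> annihilator" "\<And>k. k < n \<Longrightarrow> nzd_mod (seq_ideal x k) (x k)"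
    and k: "k + Suc i \<le> n" and S: "S \<subseteq> carrier R"
    and f: "cocycle (seq_ideal x (Suc k)) i f"
      "\<And>s. s \<in> S \<Longrightarrow> \<not> coboundary (seq_ideal x (Suc k)) i (\<lambda>y. s \<otimes> f y)"
  shows "\<exists>g. cocycle (seq_ideal x k) (Suc i) g \<and> (\<forall>s\<in>S. \<not> coboundary (seq_ideal x k) (Suc i) (\<lambda>y. s \<otimes> g y))"
proof -
  let ?J = "seq_ideal x k"
  have xR: "x i \<in> carrier R" if "i \<le> k" for i using x(1)[of i] that k by (simp add: annihilator_def)
  note xk = xR[OF order_refl]
  have nz: "nzd_mod ?J (x k)" using x(2) k by simp
  have J: "ideal ?J R" using xR by (simp add: seq_ideal_ideal)
  have Jx: "ideal (ideal_insert (x k) ?J) R" by (rule ideal_insert_ideal[OF J xk])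
  have fc: "cochain i f" and fJ: "\<And>y. y \<in> carrier (F (Suc i)) \<Longrightarrow> f (\<delta> i y) \<in> ideal_insert (x k) ?J"
    using f(1) by (simp_all add: cocycle_def)
  have fd: "cochain (Suc i) (\<lambda>y. f (\<delta> i y))" by (rule cochain_delta[OF fc])
  \<comment> \<open>The snake lemma on representatives: f lifts a cocycle modulo J + x_k R, so f
    \<delta> is divisible by \<open>x k\<close> modulo J, and the quotient g represents the
    connecting class.\<close>
  obtain g where g: "cochain (Suc i) g" "\<forall>y\<in>carrier (F (Suc i)). f (\<delta> i y) \<ominus> x k \<otimes> g y \<in> ?J"
    using cochain_divide[OF J xk fd] fJ by auto
  have "g (\<delta> (Suc i) y) \<in> ?J" if y: "y \<in> carrier (F (Suc (Suc i)))" for y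
  proof -
    note dy = delta_closed[OF y]
    have c: "g (\<delta> (Suc i) y) \<in> carrier R" by (rule cochain_closed[OF g(1) dy])
    have "\<zero> \<ominus> x k \<otimes> g (\<delta> (Suc i) y) \<in> ?J"
      using bspec[OF g(2) dy] unfolding delta_delta[OF y] cochain_zero[OF fc] .
    then have "\<ominus> (\<zero> \<ominus> x k \<otimes> g (\<delta> (Suc i) y)) \<in> ?J" by (rule ideal_uminus[OF J])
    moreover have "\<ominus> (\<zero> \<ominus> x k \<otimes> g (\<delta> (Suc i) y)) = x k \<otimes> g (\<delta> (Suc i) y)" using c xk by algebra
    ultimately show ?thesis using nz c by (simp add: nzd_mod_def)
  qed
  then have "cocycle ?J (Suc i) g" using g(1) by (simp add: cocycle_def)
  moreover have "\<not> coboundary ?J (Suc i) (\<lambda>y. s \<otimes> g y)" if s: "s \<in> S" for s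
  proof
    assume "coboundary ?J (Suc i) (\<lambda>y. s \<otimes> g y)"
    then obtain u where u: "cochain i u" "\<forall>y\<in>carrier (F (Suc i)). s \<otimes> g y \<ominus> u (\<delta> i y) \<in> ?J"
      unfolding coboundary_Suc by (elim exE conjE)
    have sR: "s \<in> carrier R" using S s by auto
    \<comment> \<open>If s g equals u \<delta> modulo J, then (s f) \<delta> equals (x_k u) \<delta>
      modulo J, so s f - x_k u is a cocycle modulo J in degree i. It is a coboundary there because k
      + i < n, and modulo J + x_k R it agrees with s f.\<close>
    let ?h = "\<lambda>y. s \<otimes> f y \<oplus> (\<ominus> x k) \<otimes> u y"
    have h: "cochain i ?h" by (rule cochain_comb[OF fc u(1) sR]) (simp add: xk)
    have "?h (\<delta> i y) \<in> ?J" if y: "y \<in> carrier (F (Suc i))" for y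
    proof -
      note dy = delta_closed[OF y]
      have c: "f (\<delta> i y) \<in> carrier R" "u (\<delta> i y) \<in> carrier R" "g y \<in> carrier R"
        using cochain_closed[OF fc dy] cochain_closed[OF u(1) dy] cochain_closed[OF g(1) y] .
      have "?h (\<delta> i y) = s \<otimes> (f (\<delta> i y) \<ominus> x k \<otimes> g y) \<oplus> x k \<otimes> (s \<otimes> g y \<ominus> u (\<delta> i y))"
        using c sR xk by algebra
      then show ?thesis
        using ideal_add[OF J ideal_mult[OF J sR bspec[OF g(2) y]] ideal_mult[OF J xk bspec[OF u(2) y]]] by simp
    qed
    then have "cocycle ?J i ?h" using h by (simp add: cocycle_def)
    then have hb: "coboundary ?J i ?h" using cocycle_imp_coboundary[OF x] k by simp
    have sub: "s \<otimes> f y \<ominus> w \<in> ideal_insert (x k) ?J"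
      if y: "y \<in> carrier (F i)" and w: "w \<in> carrier R" and e: "?h y \<ominus> w \<in> ?J" for y w
    proof -
      have c: "f y \<in> carrier R" "u y \<in> carrier R" using cochain_closed[OF fc y] cochain_closed[OF u(1) y] .
      have "s \<otimes> f y \<ominus> w = (?h y \<ominus> w) \<oplus> x k \<otimes> u y" using c sR xk w by algebra
      then show ?thesis by (rule ideal_insertI) (use e c in simp_all)
    qed
    have "coboundary (ideal_insert (x k) ?J) i (\<lambda>y. s \<otimes> f y)"
    proof (cases i)
      case 0
      have "s \<otimes> f y \<in> ideal_insert (x k) ?J" if y: "y \<in> carrier (F i)" for y
      proof -
        have "?h y \<in> ?J" using hb y unfolding 0 coboundary_0 by simp
        then have "s \<otimes> f y \<ominus> \<zero> \<in> ideal_insert (x k) ?J"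
          using ideal_carrier[OF J] by (intro sub[OF y]) (simp_all add: a_minus_def)
        then show ?thesis using sR cochain_closed[OF fc y] by (simp add: a_minus_def)
      qed
      then show ?thesis unfolding 0 coboundary_0 by simp
    next
      case (Suc j)
      obtain v where v: "cochain j v" "\<forall>y\<in>carrier (F (Suc j)). ?h y \<ominus> v (\<delta> j y) \<in> ?J"
        using hb unfolding Suc coboundary_Suc by (elim exE conjE)
      have "s \<otimes> f y \<ominus> v (\<delta> j y) \<in> ideal_insert (x k) ?J" if y: "y \<in> carrier (F (Suc j))" for y
        using sub[unfolded Suc, OF y cochain_closed[OF v(1) delta_closed[OF y]] bspec[OF v(2) y]] .
      then show ?thesis unfolding Suc coboundary_Suc using v(1) by (intro exI[of _ v] conjI ballI)
    qed
    then show False using f(2)[OF s] by simp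
  qed
  ultimately show ?thesis by (intro exI[of _ g] conjI ballI)
qed

text \<open>The degree i rises from 0 to n while the ideal shrinks from n generators to none.
  Injectivity is stated for all multiples of one class by elements of S, because with S = R - P this
  is what membership of P in the support demands.\<close>

lemma connecting_iterate:
  assumes x: "\<And>k. k < n \<Longrightarrow> x k \<in> annihilator" "\<And>k. k < n \<Longrightarrow> nzd_mod (seq_ideal x k) (x k)"
    and S: "S \<subseteq> carrier R"
    and f: "cocycle (seq_ideal x n) 0 f" "\<And>s. s \<in> S \<Longrightarrow> \<not> coboundary (seq_ideal x n) 0 (\<lambda>y. s \<otimes> f y)"
  shows "\<exists>g. cocycle {\<zero>} n g \<and> (\<forall>s\<in>S. \<not> coboundary {\<zero>} n (\<lambda>y. s \<otimes> g y))"
proof -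
  have "\<exists>g. cocycle (seq_ideal x (n - i)) i g \<and> (\<forall>s\<in>S. \<not> coboundary (seq_ideal x (n - i)) i (\<lambda>y. s \<otimes> g y))"
    if "i \<le> n" for i
    using that
  proof (induction i)
    case 0
    then show ?case using f by auto
  next
    case (Suc i)
    then obtain g where g: "cocycle (seq_ideal x (Suc (n - Suc i))) i g"
      "\<forall>s\<in>S. \<not> coboundary (seq_ideal x (Suc (n - Suc i))) i (\<lambda>y. s \<otimes> g y)"
      by (auto simp: Suc_diff_Suc simp del: seq_ideal.simps)
    show ?case by (rule connecting_step[of n x "n - Suc i" i S g]) (use x S g Suc.prems in simp_all)
  qed
  from this[of n] show ?thesis by simp
qed

end

section \<open>Finitely generated modules\<close>

context plain_module
begin

lemma annihilator_ideal: "ideal annihilator R"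
proof (rule cring_idealI)
  fix a b assume "a \<in> annihilator" "b \<in> annihilator"
  then show "a \<oplus> b \<in> annihilator" by (simp add: annihilator_def smult_l_distr)
next
  fix a b assume "a \<in> carrier R" "b \<in> annihilator"
  then show "a \<otimes> b \<in> annihilator" by (simp add: annihilator_def smult_assoc1)
qed (auto simp: annihilator_def)

lemma submodule_zero_closed: "submodule H R M \<Longrightarrow> \<zero>\<^bsub>M\<^esub> \<in> H"
  using subgroup.one_closed[OF submodule.axioms(1)] by fastforce

definition span :: "'m set \<Rightarrow> 'm set"
  where "span S = \<Inter>{H. submodule H R M \<and> S \<subseteq> H}"

lemma span_minimal: "\<lbrakk>submodule H R M; S \<subseteq> H\<rbrakk> \<Longrightarrow> span S \<subseteq> H"
  by (auto simp: span_def)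

lemma span_superset: "S \<subseteq> span S"
  by (auto simp: span_def)

lemma submodule_span:
  assumes "S \<subseteq> carrier M"
  shows "submodule (span S) R M"
proof (rule submoduleI)
  show "span S \<subseteq> carrier M" by (rule span_minimal[OF carrier_is_submodule assms])
  show "\<zero>\<^bsub>M\<^esub> \<in> span S" by (auto simp: span_def submodule_zero_closed)
  show "\<ominus>\<^bsub>M\<^esub> x \<in> span S" if "x \<in> span S" for x
    using that by (auto simp: span_def intro: submoduleE(3))
  show "x \<oplus>\<^bsub>M\<^esub> y \<in> span S" if "x \<in> span S" "y \<in> span S" for x y
    using that by (auto simp: span_def intro: submoduleE(5))
  show "a \<odot>\<^bsub>M\<^esub> x \<in> span S" if "a \<in> carrier R" "x \<in> span S" for a x
    using that by (auto simp: span_def intro: submoduleE(4))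
qed

lemma span_insert:
  assumes S: "S \<subseteq> carrier M" and g: "g \<in> carrier M" and m: "m \<in> span (insert g S)"
  shows "\<exists>h\<in>span S. \<exists>r\<in>carrier R. m = h \<oplus>\<^bsub>M\<^esub> r \<odot>\<^bsub>M\<^esub> g"
proof -
  note N = submodule_span[OF S]
  note ND = submoduleE[OF N]
  have NM: "h \<in> carrier M" if "h \<in> span S" for h using ND(1) that by auto
  let ?K = "{h \<oplus>\<^bsub>M\<^esub> r \<odot>\<^bsub>M\<^esub> g | h r. h \<in> span S \<and> r \<in> carrier R}"
  have KI: "h \<oplus>\<^bsub>M\<^esub> r \<odot>\<^bsub>M\<^esub> g \<in> ?K" if "h \<in> span S" "r \<in> carrier R" for h r using that by blast
  have "submodule ?K R M"
  proof (rule submoduleI)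
    show "?K \<subseteq> carrier M" using NM g by auto
    show "\<zero>\<^bsub>M\<^esub> \<in> ?K" using KI[OF submodule_zero_closed[OF N] R.zero_closed] g by simp
    fix x assume "x \<in> ?K"
    then obtain h r where x: "h \<in> span S" "r \<in> carrier R" "x = h \<oplus>\<^bsub>M\<^esub> r \<odot>\<^bsub>M\<^esub> g" by auto
    have "\<ominus>\<^bsub>M\<^esub> x = \<ominus>\<^bsub>M\<^esub> h \<oplus>\<^bsub>M\<^esub> (\<ominus> r) \<odot>\<^bsub>M\<^esub> g"
      unfolding x(3) using NM[OF x(1)] x(2) g by (simp add: M.minus_add smult_l_minus)
    then show "\<ominus>\<^bsub>M\<^esub> x \<in> ?K" using KI[OF ND(3)[OF x(1)] R.a_inv_closed[OF x(2)]] by simp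
    fix a assume a: "a \<in> carrier R"
    have "a \<odot>\<^bsub>M\<^esub> x = a \<odot>\<^bsub>M\<^esub> h \<oplus>\<^bsub>M\<^esub> (a \<otimes> r) \<odot>\<^bsub>M\<^esub> g"
      unfolding x(3) using NM[OF x(1)] x(2) g a by (simp add: smult_r_distr smult_assoc1)
    then show "a \<odot>\<^bsub>M\<^esub> x \<in> ?K" using KI[OF ND(4)[OF a x(1)] R.m_closed[OF a x(2)]] by simp
  next
    fix x y assume "x \<in> ?K" "y \<in> ?K"
    then obtain h r k t where x: "h \<in> span S" "r \<in> carrier R" "x = h \<oplus>\<^bsub>M\<^esub> r \<odot>\<^bsub>M\<^esub> g"
      and y: "k \<in> span S" "t \<in> carrier R" "y = k \<oplus>\<^bsub>M\<^esub> t \<odot>\<^bsub>M\<^esub> g" by auto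
    have "x \<oplus>\<^bsub>M\<^esub> y = (h \<oplus>\<^bsub>M\<^esub> k) \<oplus>\<^bsub>M\<^esub> (r \<oplus> t) \<odot>\<^bsub>M\<^esub> g"
      unfolding x(3) y(3) using NM[OF x(1)] NM[OF y(1)] x(2) y(2) g by (simp add: smult_l_distr M.a_ac)
    then show "x \<oplus>\<^bsub>M\<^esub> y \<in> ?K" using KI[OF ND(5)[OF x(1) y(1)] R.a_closed[OF x(2) y(2)]] by simp
  qed
  moreover have "insert g S \<subseteq> ?K"
  proof (rule insert_subsetI)
    show "g \<in> ?K" using KI[OF submodule_zero_closed[OF N] R.one_closed] g by simp
    show "S \<subseteq> ?K"
    proof
      fix x assume "x \<in> S"
      then have "x \<in> span S" using span_superset by auto
      then show "x \<in> ?K" using KI[OF _ R.zero_closed] NM g by fastforce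
    qed
  qed
  ultimately have "m \<in> ?K" using span_minimal m by blast
  then show ?thesis by blast
qed

text \<open>If N and M agree at P on generators, one denominator serves for all of M: take the
  product of the finitely many multipliers.\<close>

lemma ex_uniform_multiplier:
  assumes P: "primeideal P R" and A: "finite A" "A \<subseteq> carrier M" "span A = carrier M"
    and N: "submodule N R M" and ex: "\<And>a. a \<in> A \<Longrightarrow> \<exists>s\<in>carrier R - P. s \<odot>\<^bsub>M\<^esub> a \<in> N"
  shows "\<exists>s\<in>carrier R - P. \<forall>m\<in>carrier M. s \<odot>\<^bsub>M\<^esub> m \<in> N"
proof -
  note ND = submoduleE[OF N]
  have "\<exists>s\<in>carrier R - P. \<forall>a\<in>A'. s \<odot>\<^bsub>M\<^esub> a \<in> N" if "finite A'" "A' \<subseteq> A" for A'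
    using that
  proof (induction A' rule: finite_induct)
    case empty
    have "\<one> \<in> carrier R - P" using primeidealD(2)[OF P] by simp
    then show ?case by (intro bexI[of _ \<one>]) simp_all
  next
    case (insert a A')
    then obtain s where s: "s \<in> carrier R - P" "\<forall>a\<in>A'. s \<odot>\<^bsub>M\<^esub> a \<in> N" by auto
    obtain t where t: "t \<in> carrier R - P" "t \<odot>\<^bsub>M\<^esub> a \<in> N" using ex[of a] insert.prems by auto
    have st: "s \<otimes> t \<in> carrier R - P" using primeidealD(3)[OF P, of s t] s(1) t(1) by auto
    have "(s \<otimes> t) \<odot>\<^bsub>M\<^esub> b \<in> N" if b: "b \<in> insert a A'" for b
    proof -
      have bM: "b \<in> carrier M" using b insert.prems A(2) by auto
      have sR: "s \<in> carrier R" and tR: "t \<in> carrier R" using s(1) t(1) by simp_all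
      show ?thesis
      proof (cases "b = a")
        case True
        then show ?thesis using smult_assoc1[OF sR tR bM] ND(4)[OF sR t(2)] by simp
      next
        case False
        then have "s \<odot>\<^bsub>M\<^esub> b \<in> N" using b s(2) by simp
        then show ?thesis using smult_assoc1[OF tR sR bM] ND(4)[OF tR] m_comm[OF sR tR] by simp
      qed
    qed
    then show ?case using st by (intro bexI[of _ "s \<otimes> t"]) simp_all
  qed
  then obtain s where s: "s \<in> carrier R - P" "\<forall>a\<in>A. s \<odot>\<^bsub>M\<^esub> a \<in> N" using A(1) by blast
  have sR: "s \<in> carrier R" using s(1) by simp
  have "submodule {m \<in> carrier M. s \<odot>\<^bsub>M\<^esub> m \<in> N} R M"
  proof (rule submoduleI)
    show "\<zero>\<^bsub>M\<^esub> \<in> {m \<in> carrier M. s \<odot>\<^bsub>M\<^esub> m \<in> N}" using submodule_zero_closed[OF N] sR by simp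
    fix a x assume a: "a \<in> carrier R" and x: "x \<in> {m \<in> carrier M. s \<odot>\<^bsub>M\<^esub> m \<in> N}"
    then have "s \<odot>\<^bsub>M\<^esub> (a \<odot>\<^bsub>M\<^esub> x) = a \<odot>\<^bsub>M\<^esub> (s \<odot>\<^bsub>M\<^esub> x)"
      using sR by (simp add: m_comm flip: smult_assoc1)
    then show "a \<odot>\<^bsub>M\<^esub> x \<in> {m \<in> carrier M. s \<odot>\<^bsub>M\<^esub> m \<in> N}" using ND(4)[OF a] a x by simp
  qed (use sR ND(3,5) in \<open>auto simp: smult_r_minus smult_r_distr\<close>)
  then have "span A \<subseteq> {m \<in> carrier M. s \<odot>\<^bsub>M\<^esub> m \<in> N}" by (rule span_minimal) (use A(2) s(2) in auto)
  then show ?thesis using s(1) A(3) by (intro bexI[of _ s]) auto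
qed

lemma submodule_singleton_zero: "submodule {\<zero>\<^bsub>M\<^esub>} R M"
  by (rule submoduleI) auto

lemma finitely_generated_span:
  assumes "finitely_generated_module R M"
  obtains A where "finite A" "A \<subseteq> carrier M" "span A = carrier M"
proof -
  obtain A where A: "A \<subseteq> carrier M" "finite A" "\<And>H. submodule H R M \<and> A \<subseteq> H \<Longrightarrow> H = carrier M"
    using assms by (auto simp: finitely_generated_module_def)
  have "span A = carrier M" using A(3) submodule_span[OF A(1)] span_superset by simp
  then show ?thesis using that A by simp
qed

text \<open>If M vanishes at P, clearing denominators uniformly gives an annihilator of M outside P.
  Finite generation is essential for this direction.\<close>

lemma supp_eq_primes_over_annihilator:
  assumes fg: "finitely_generated_module R M"
  shows "P \<in> supp R M \<longleftrightarrow> primeideal P R \<and> annihilator \<subseteq> P"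
proof
  assume P: "primeideal P R \<and> annihilator \<subseteq> P"
  show "P \<in> supp R M"
  proof (rule ccontr)
    assume "P \<notin> supp R M"
    then have "\<exists>s\<in>carrier R - P. s \<odot>\<^bsub>M\<^esub> m \<in> {\<zero>\<^bsub>M\<^esub>}" if "m \<in> carrier M" for m
      using that P by (auto simp: supp_iff)
    moreover obtain A where "finite A" "A \<subseteq> carrier M" "span A = carrier M"
      using finitely_generated_span[OF fg] .
    ultimately obtain s where "s \<in> carrier R - P" "\<forall>m\<in>carrier M. s \<odot>\<^bsub>M\<^esub> m \<in> {\<zero>\<^bsub>M\<^esub>}"
      using ex_uniform_multiplier[of P A "{\<zero>\<^bsub>M\<^esub>}"] P submodule_singleton_zero by blast
    then have "s \<in> annihilator" "s \<notin> P" by (simp_all add: annihilator_def)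
    then show False using P by auto
  qed
next
  assume "P \<in> supp R M"
  then show "primeideal P R \<and> annihilator \<subseteq> P" using annihilator_subset_supp by (auto simp: supp_iff)
qed

text \<open>Some quotient \<open>M / \<langle>S\<rangle>\<close> becomes nonzero cyclic, with generator \<open>g\<close>, when localized at \<open>P\<close>.\<close>

lemma ex_locally_cyclic_quotient:
  assumes fg: "finitely_generated_module R M" and P: "P \<in> supp R M"
  shows "\<exists>N g s. submodule N R M \<and> g \<in> carrier M \<and> s \<in> carrier R - P \<and>
    (\<forall>m\<in>carrier M. \<exists>h\<in>N. \<exists>r\<in>carrier R. s \<odot>\<^bsub>M\<^esub> m = h \<oplus>\<^bsub>M\<^esub> r \<odot>\<^bsub>M\<^esub> g) \<and>
    (\<forall>r\<in>carrier R. r \<odot>\<^bsub>M\<^esub> g \<in> N \<longrightarrow> r \<in> P)"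
proof -
  have Pp: "primeideal P R" using P by (simp add: supp_iff)
  obtain A where A: "finite A" "A \<subseteq> carrier M" "span A = carrier M" using finitely_generated_span[OF fg] .
  \<comment> \<open>The sets of generators whose quotient is still nonzero at P. For one of largest
    size, adjoining any further generator g makes the quotient vanish at P, so at P the quotient is
    generated by g.\<close>
  let ?Q = "\<lambda>S. S \<subseteq> A \<and> (\<exists>m\<in>carrier M. \<forall>s\<in>carrier R - P. s \<odot>\<^bsub>M\<^esub> m \<notin> span S)"
  have "span {} \<subseteq> {\<zero>\<^bsub>M\<^esub>}" by (rule span_minimal[OF submodule_singleton_zero]) simp
  then have 1: "?Q {}" using P by (auto simp: supp_iff)
  have 2: "\<forall>T. ?Q T \<longrightarrow> card T < Suc (card A)" by (simp add: less_Suc_eq_le card_mono[OF A(1)])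
  obtain S where S': "?Q S \<and> (\<forall>T. ?Q T \<longrightarrow> card T \<le> card S)"
    using ex_has_greatest_nat[of ?Q, OF 1 2] by (rule exE)
  note S = conjunct1[OF S'] and max' = conjunct2[OF S']
  have max: "card T \<le> card S" if "?Q T" for T using max' that by simp
  from S obtain m0 where m0: "m0 \<in> carrier M" "\<forall>s\<in>carrier R - P. s \<odot>\<^bsub>M\<^esub> m0 \<notin> span S" by auto
  have SM: "S \<subseteq> carrier M" using S A(2) by auto
  note N = submodule_span[OF SM]
  note ND = submoduleE[OF N]
  have NM: "h \<in> carrier M" if "h \<in> span S" for h using ND(1) that by auto
  have "S \<noteq> A"
  proof
    assume "S = A"
    then have "\<one> \<odot>\<^bsub>M\<^esub> m0 \<in> span S" using A(3) m0(1) by simp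
    then show False using m0(2) primeidealD(2)[OF Pp] by blast
  qed
  then obtain g where g: "g \<in> A" "g \<notin> S" using S by auto
  have gM: "g \<in> carrier M" using g A(2) by auto
  have "card (insert g S) = Suc (card S)" using g(2) S A(1) finite_subset by (intro card_insert_disjoint) auto
  then have "\<not> ?Q (insert g S)" using max[of "insert g S"] by linarith
  then have ex: "\<exists>s\<in>carrier R - P. s \<odot>\<^bsub>M\<^esub> m \<in> span (insert g S)" if "m \<in> carrier M" for m
    using that g(1) S by auto
  have "submodule (span (insert g S)) R M" using SM gM by (intro submodule_span) simp
  then obtain s where s: "s \<in> carrier R - P" "\<forall>m\<in>carrier M. s \<odot>\<^bsub>M\<^esub> m \<in> span (insert g S)"
    using ex_uniform_multiplier[OF Pp A] ex A(2) by blast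
  have span: "\<exists>h\<in>span S. \<exists>r\<in>carrier R. s \<odot>\<^bsub>M\<^esub> m = h \<oplus>\<^bsub>M\<^esub> r \<odot>\<^bsub>M\<^esub> g" if "m \<in> carrier M" for m
    by (rule span_insert[OF SM gM]) (use s(2) that in simp)
  \<comment> \<open>Otherwise r s, which is outside P, would carry m0 into the span of S: s m0 is an
    element of the span plus a multiple of g, and r g lies in the span.\<close>
  have "r \<in> P" if r: "r \<in> carrier R" "r \<odot>\<^bsub>M\<^esub> g \<in> span S" for r
  proof (rule ccontr)
    assume "r \<notin> P"
    have sR: "s \<in> carrier R" using s(1) by simp
    obtain h a where ha: "h \<in> span S" "a \<in> carrier R" "s \<odot>\<^bsub>M\<^esub> m0 = h \<oplus>\<^bsub>M\<^esub> a \<odot>\<^bsub>M\<^esub> g"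
      using span[OF m0(1)] by auto
    have "(r \<otimes> s) \<odot>\<^bsub>M\<^esub> m0 = r \<odot>\<^bsub>M\<^esub> h \<oplus>\<^bsub>M\<^esub> (r \<otimes> a) \<odot>\<^bsub>M\<^esub> g"
      using smult_assoc1[OF r(1) sR m0(1)] ha NM[OF ha(1)] r(1) gM by (simp add: smult_r_distr smult_assoc1)
    also have "(r \<otimes> a) \<odot>\<^bsub>M\<^esub> g = a \<odot>\<^bsub>M\<^esub> (r \<odot>\<^bsub>M\<^esub> g)"
      using smult_assoc1[OF ha(2) r(1) gM] m_comm[OF r(1) ha(2)] by simp
    finally have "(r \<otimes> s) \<odot>\<^bsub>M\<^esub> m0 \<in> span S" using ND(5)[OF ND(4)[OF r(1) ha(1)] ND(4)[OF ha(2) r(2)]] by simp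
    moreover have "r \<otimes> s \<in> carrier R - P"
      using primeidealD(3)[OF Pp r(1) sR] \<open>r \<notin> P\<close> s(1) r(1) by auto
    ultimately show False using m0(2) by blast
  qed
  then show ?thesis using N gM s(1) span
    by (intro exI[of _ "span S"] exI[of _ g] exI[of _ s] conjI ballI impI) simp_all
qed

end

text \<open>The map sends m to r y0, where s m = h + r g with h in N. The coefficient r is
  determined modulo P, because elements carrying g into N lie in P, and r y0 is then determined
  modulo J since P = (J : y0). The multiplier s compensates for M/N being cyclic only at P.\<close>

lemma (in resolved_module) ex_hom_cocycle:
  assumes fg: "finitely_generated_module R M" and P: "P \<in> supp R M"
    and J: "ideal J R" and y0: "y0 \<in> carrier R" "P = colon J y0"
  shows "\<exists>f. cocycle J 0 f \<and> (\<forall>t\<in>carrier R - P. \<not> coboundary J 0 (\<lambda>y. t \<otimes> f y))"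
proof -
  have Pp: "primeideal P R" using P by (simp add: supp_iff)
  note PD = idealD[OF primeidealD(1)[OF Pp]] and JD = idealD[OF J]
  have "\<exists>N g s. submodule N R M \<and> g \<in> carrier M \<and> s \<in> carrier R - P \<and>
    (\<forall>m\<in>carrier M. \<exists>h\<in>N. \<exists>r\<in>carrier R. s \<odot>\<^bsub>M\<^esub> m = h \<oplus>\<^bsub>M\<^esub> r \<odot>\<^bsub>M\<^esub> g) \<and>
    (\<forall>r\<in>carrier R. r \<odot>\<^bsub>M\<^esub> g \<in> N \<longrightarrow> r \<in> P)"
    by (rule ex_locally_cyclic_quotient[OF fg P])
  then obtain N g s where N: "submodule N R M" and g: "g \<in> carrier M" and s: "s \<in> carrier R - P"
    and cyc: "\<forall>m\<in>carrier M. \<exists>h\<in>N. \<exists>r\<in>carrier R. s \<odot>\<^bsub>M\<^esub> m = h \<oplus>\<^bsub>M\<^esub> r \<odot>\<^bsub>M\<^esub> g"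
    and ann: "\<forall>r\<in>carrier R. r \<odot>\<^bsub>M\<^esub> g \<in> N \<longrightarrow> r \<in> P" by (elim exE conjE)
  have sR: "s \<in> carrier R" using s by simp
  note ND = submoduleE[OF N]
  have NM: "h \<in> carrier M" if "h \<in> N" for h using ND(1) that by auto
  \<comment> \<open>A relation, as h and r are not unique and v is only fixed modulo J; freeness of
    \<open>F 0\<close> extracts a linear map from it.\<close>
  let ?r = "\<lambda>y v. \<exists>h\<in>N. \<exists>r\<in>carrier R. \<exists>j\<in>J. s \<odot>\<^bsub>M\<^esub> \<epsilon> y = h \<oplus>\<^bsub>M\<^esub> r \<odot>\<^bsub>M\<^esub> g \<and> v = j \<oplus> r \<otimes> y0"
  note e = linear_mapD[OF linear_eps]
  have "\<exists>f. cochain 0 f \<and> (\<forall>y\<in>carrier (F 0). ?r y (f y))"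
  proof (rule plain_module.free_module_relation_lift[OF plain_module_self], goal_cases)
    case 1
    have "\<epsilon> \<zero>\<^bsub>F 0\<^esub> = \<zero>\<^bsub>M\<^esub>" by (rule linear_map_zero[OF module_free_module module_axioms linear_eps])
    then show ?case using submodule_zero_closed[OF N] JD(3) sR g y0(1)
      by (intro bexI[of _ "\<zero>\<^bsub>M\<^esub>"] bexI[of _ \<zero>]) simp_all
  next
    case (2 y z v w)
    obtain h r j where 3: "h \<in> N" "r \<in> carrier R" "j \<in> J" "s \<odot>\<^bsub>M\<^esub> \<epsilon> y = h \<oplus>\<^bsub>M\<^esub> r \<odot>\<^bsub>M\<^esub> g" "v = j \<oplus> r \<otimes> y0"
      using 2(5) by (elim bexE conjE)
    obtain h' r' j' where 4: "h' \<in> N" "r' \<in> carrier R" "j' \<in> J" "s \<odot>\<^bsub>M\<^esub> \<epsilon> z = h' \<oplus>\<^bsub>M\<^esub> r' \<odot>\<^bsub>M\<^esub> g" "w = j' \<oplus> r' \<otimes> y0"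
      using 2(6) by (elim bexE conjE)
    have c: "j \<in> carrier R" "j' \<in> carrier R" using JD(2) 3(3) 4(3) by simp_all
    have "s \<odot>\<^bsub>M\<^esub> \<epsilon> (y \<oplus>\<^bsub>F 0\<^esub> z) = s \<odot>\<^bsub>M\<^esub> \<epsilon> y \<oplus>\<^bsub>M\<^esub> s \<odot>\<^bsub>M\<^esub> \<epsilon> z"
      using e(2)[OF 2(1,2)] smult_r_distr[OF sR e(1)[OF 2(1)] e(1)[OF 2(2)]] by simp
    also have "\<dots> = (h \<oplus>\<^bsub>M\<^esub> h') \<oplus>\<^bsub>M\<^esub> (r \<oplus> r') \<odot>\<^bsub>M\<^esub> g"
      unfolding 3(4) 4(4) using NM[OF 3(1)] NM[OF 4(1)] 3(2) 4(2) g by (simp add: smult_l_distr M.a_ac)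
    finally have "s \<odot>\<^bsub>M\<^esub> \<epsilon> (y \<oplus>\<^bsub>F 0\<^esub> z) = (h \<oplus>\<^bsub>M\<^esub> h') \<oplus>\<^bsub>M\<^esub> (r \<oplus> r') \<odot>\<^bsub>M\<^esub> g" .
    moreover have "v \<oplus> w = (j \<oplus> j') \<oplus> (r \<oplus> r') \<otimes> y0"
      unfolding 3(5) 4(5) using c 3(2) 4(2) y0(1) by algebra
    ultimately show ?case unfolding self_module_simps
      by (intro bexI[OF _ ND(5)[OF 3(1) 4(1)]] bexI[OF _ R.a_closed[OF 3(2) 4(2)]] bexI[OF _ JD(4)[OF 3(3) 4(3)]] conjI)
  next
    case (3 a y v)
    obtain h r j where 4: "h \<in> N" "r \<in> carrier R" "j \<in> J" "s \<odot>\<^bsub>M\<^esub> \<epsilon> y = h \<oplus>\<^bsub>M\<^esub> r \<odot>\<^bsub>M\<^esub> g" "v = j \<oplus> r \<otimes> y0"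
      using 3(4) by (elim bexE conjE)
    have c: "j \<in> carrier R" using JD(2) 4(3) by simp
    have "s \<odot>\<^bsub>M\<^esub> \<epsilon> (a \<odot>\<^bsub>F 0\<^esub> y) = a \<odot>\<^bsub>M\<^esub> (s \<odot>\<^bsub>M\<^esub> \<epsilon> y)"
      using e(3)[OF 3(1,2)] e(1)[OF 3(2)] sR 3(1) by (simp add: m_comm flip: smult_assoc1)
    also have "\<dots> = a \<odot>\<^bsub>M\<^esub> h \<oplus>\<^bsub>M\<^esub> (a \<otimes> r) \<odot>\<^bsub>M\<^esub> g"
      unfolding 4(4) using NM[OF 4(1)] 4(2) g 3(1) by (simp add: smult_r_distr smult_assoc1)
    finally have "s \<odot>\<^bsub>M\<^esub> \<epsilon> (a \<odot>\<^bsub>F 0\<^esub> y) = a \<odot>\<^bsub>M\<^esub> h \<oplus>\<^bsub>M\<^esub> (a \<otimes> r) \<odot>\<^bsub>M\<^esub> g" .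
    moreover have "a \<otimes> v = a \<otimes> j \<oplus> (a \<otimes> r) \<otimes> y0"
      unfolding 4(5) using c 4(2) y0(1) 3(1) by algebra
    ultimately show ?case unfolding self_module_simps
      by (intro bexI[OF _ ND(4)[OF 3(1) 4(1)]] bexI[OF _ m_closed[OF 3(1) 4(2)]] bexI[OF _ JD(7)[OF 3(1) 4(3)]] conjI)
  next
    case (4 y)
    obtain h r where hr: "h \<in> N" "r \<in> carrier R" "s \<odot>\<^bsub>M\<^esub> \<epsilon> y = h \<oplus>\<^bsub>M\<^esub> r \<odot>\<^bsub>M\<^esub> g"
      using bspec[OF cyc e(1)[OF 4]] by (elim bexE)
    have "?r y (\<zero> \<oplus> r \<otimes> y0)" using hr JD(3)
      by (intro bexI[OF _ hr(1)] bexI[OF _ hr(2)] bexI[of _ \<zero>]) simp_all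
    then show ?case unfolding self_module_simps
      by (rule bexI) (use hr(2) y0(1) in simp)
  qed
  then obtain f where f: "cochain 0 f" and rel: "\<forall>y\<in>carrier (F 0). ?r y (f y)" by (elim exE conjE)
  have "f (\<delta> 0 z) \<in> J" if z: "z \<in> carrier (F (Suc 0))" for z
  proof -
    have "?r (\<delta> 0 z) (f (\<delta> 0 z))" using rel delta_closed[OF z] by (rule bspec)
    then obtain h r j where 1: "h \<in> N" "r \<in> carrier R" "j \<in> J"
      "s \<odot>\<^bsub>M\<^esub> \<epsilon> (\<delta> 0 z) = h \<oplus>\<^bsub>M\<^esub> r \<odot>\<^bsub>M\<^esub> g" "f (\<delta> 0 z) = j \<oplus> r \<otimes> y0" by (elim bexE conjE)
    have "h \<oplus>\<^bsub>M\<^esub> r \<odot>\<^bsub>M\<^esub> g = \<zero>\<^bsub>M\<^esub>" using 1(4) eps_delta[OF z] sR by simp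
    then have "r \<odot>\<^bsub>M\<^esub> g = \<ominus>\<^bsub>M\<^esub> h"
      using M.minus_equality[of "r \<odot>\<^bsub>M\<^esub> g" h] NM[OF 1(1)] 1(2) g by (simp add: M.a_comm)
    then have "r \<odot>\<^bsub>M\<^esub> g \<in> N" using ND(3)[OF 1(1)] by simp
    then have "r \<in> P" using ann 1(2) by simp
    then have "r \<otimes> y0 \<in> J" using y0(2) by (simp add: colon_def)
    then show ?thesis unfolding 1(5) by (rule JD(4)[OF 1(3)])
  qed
  then have "cocycle J 0 f" using f by (simp add: cocycle_def)
  moreover have "\<not> coboundary J 0 (\<lambda>y. t \<otimes> f y)" if t: "t \<in> carrier R - P" for t
  proof
    assume cob: "coboundary J 0 (\<lambda>y. t \<otimes> f y)"
    have tR: "t \<in> carrier R" using t by simp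
    have "g \<in> \<epsilon> ` carrier (F 0)" unfolding eps_image by (rule g)
    then obtain y where y: "y \<in> carrier (F 0)" "g = \<epsilon> y" by (elim imageE)
    have "?r y (f y)" using rel y(1) by (rule bspec)
    then obtain h r j where 1: "h \<in> N" "r \<in> carrier R" "j \<in> J"
      "s \<odot>\<^bsub>M\<^esub> g = h \<oplus>\<^bsub>M\<^esub> r \<odot>\<^bsub>M\<^esub> g" "f y = j \<oplus> r \<otimes> y0" unfolding y(2) by (elim bexE conjE)
    have jR: "j \<in> carrier R" using JD(2) 1(3) .
    \<comment> \<open>Evaluate at a lift of g: s - r carries g into N and so lies in P. Hence r is
      outside P like s, and t r y0 cannot lie in J for t outside P.\<close>
    have "(s \<ominus> r) \<odot>\<^bsub>M\<^esub> g = (h \<oplus>\<^bsub>M\<^esub> r \<odot>\<^bsub>M\<^esub> g) \<oplus>\<^bsub>M\<^esub> \<ominus>\<^bsub>M\<^esub> (r \<odot>\<^bsub>M\<^esub> g)"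
      unfolding a_minus_def using sR 1(2) g by (simp add: smult_l_distr smult_l_minus 1(4))
    also have "\<dots> = h" using NM[OF 1(1)] 1(2) g by (simp add: M.a_assoc M.r_neg)
    finally have "(s \<ominus> r) \<odot>\<^bsub>M\<^esub> g \<in> N" using 1(1) by simp
    then have sr: "s \<ominus> r \<in> P" using ann sR 1(2) by simp
    have "t \<otimes> f y \<in> J" using cob y(1) by (simp add: coboundary_0)
    moreover have "t \<otimes> f y = t \<otimes> j \<oplus> (t \<otimes> r) \<otimes> y0" unfolding 1(5) using jR 1(2) y0(1) tR by algebra
    ultimately have "(t \<otimes> r) \<otimes> y0 \<in> J"
      using ideal_add_cancel(2)[OF J JD(7)[OF tR 1(3)]] tR 1(2) y0(1) by simp
    then have "t \<otimes> r \<in> P" using y0(2) tR 1(2) by (simp add: colon_def)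
    then have "r \<in> P" using primeidealD(3)[OF Pp tR 1(2)] t by simp
    moreover have "s = (s \<ominus> r) \<oplus> r" using sR 1(2) by algebra
    ultimately have "s \<in> P" using PD(4)[OF sr] by metis
    then show False using s by simp
  qed
  ultimately show ?thesis by (intro exI[of _ f] conjI ballI)
qed

section \<open>Support of Ext\<close>

lemma (in plain_module) submodule_of_submodule:
  assumes Z: "submodule Z R M" and H: "submodule H R M" "H \<subseteq> Z"
  shows "submodule H R (M\<lparr>carrier := Z\<rparr>)"
proof -
  interpret Z: module R "M\<lparr>carrier := Z\<rparr>" by (rule submodule.submodule_is_module[OF Z module_axioms])
  show ?thesis
    by (rule Z.module_incl_imp_submodule) (use H submodule.submodule_is_module[OF H(1) module_axioms] in simp_all)
qed

lemma (in plain_module) supp_subquotient_iff: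
  assumes Z: "submodule Z R M" and H: "submodule H R M" "H \<subseteq> Z"
  shows "P \<in> supp R (quot_module (M\<lparr>carrier := Z\<rparr>) H) \<longleftrightarrow>
    primeideal P R \<and> (\<exists>m\<in>Z. \<forall>s\<in>carrier R - P. s \<odot>\<^bsub>M\<^esub> m \<notin> H)"
proof -
  interpret Z: plain_module R "M\<lparr>carrier := Z\<rparr>"
    by (rule plain_module.intro[OF submodule.submodule_is_module[OF Z module_axioms]])
  show ?thesis using Z.supp_quot_module_iff[OF submodule_of_submodule[OF Z H], of P] by simp
qed

context resolved_module
begin

abbreviation cochain_module :: "nat \<Rightarrow> ('a, ('b \<Rightarrow> 'a) \<Rightarrow> 'a) module"
  where "cochain_module i \<equiv> hom_module R (F i) (self_module R)"

lemma plain_module_cochain_module: "plain_module R (cochain_module i)"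
  by (rule plain_module.intro[OF module_hom_module[OF module_free_module module_self_module[OF is_cring]]])

lemma linear_dual_differential:
  "linear_map R (cochain_module i) (cochain_module (Suc i)) (dual_differential R B \<delta> i)"
  unfolding linear_map_def
proof (intro conjI ballI funcsetI)
  fix f assume f: "f \<in> carrier (cochain_module i)"
  then have fc: "cochain i f" by (simp add: mod_hom_iff)
  show "dual_differential R B \<delta> i f \<in> carrier (cochain_module (Suc i))"
    using restrict_mod_hom[OF module_free_module cochain_delta[OF fc]]
    by (simp add: dual_differential_def compose_def)
  show "dual_differential R B \<delta> i (a \<odot>\<^bsub>cochain_module i\<^esub> f) =
      a \<odot>\<^bsub>cochain_module (Suc i)\<^esub> dual_differential R B \<delta> i f" for a
    by (rule ext) (simp add: dual_differential_def compose_def delta_closed)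
  fix g assume "g \<in> carrier (cochain_module i)"
  show "dual_differential R B \<delta> i (f \<oplus>\<^bsub>cochain_module i\<^esub> g) =
      dual_differential R B \<delta> i f \<oplus>\<^bsub>cochain_module (Suc i)\<^esub> dual_differential R B \<delta> i g"
    by (rule ext) (simp add: dual_differential_def compose_def delta_closed)
qed

lemma dual_differential_eq_iff:
  "dual_differential R B \<delta> i f = (\<lambda>y\<in>carrier (F (Suc i)). h y) \<longleftrightarrow>
    (\<forall>y\<in>carrier (F (Suc i)). f (\<delta> i y) = h y)"
  unfolding dual_differential_def compose_def by (rule restrict_eq_iff)

lemma cocycles_iff:
  "f \<in> mod_ker (cochain_module i) (cochain_module (Suc i)) (dual_differential R B \<delta> i) \<longleftrightarrow>
    f \<in> extensional (carrier (F i)) \<and> cocycle {\<zero>} i f"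
  using dual_differential_eq_iff[of i f "\<lambda>_. \<zero>"]
  by (auto simp: mod_ker_def mod_hom_iff cocycle_def)

lemma cochain_extend:
  assumes "cochain i f"
  shows "restrict f (carrier (F i)) \<in> mod_hom R (F i) (self_module R)"
    "cochain i (restrict f (carrier (F i)))"
  using restrict_mod_hom[OF module_free_module assms] by (simp_all add: mod_hom_iff)

lemma coboundaries_iff:
  assumes "cochain i f"
  shows "(\<lambda>y\<in>carrier (F i). f y) \<in> (case i of 0 \<Rightarrow> {\<zero>\<^bsub>cochain_module 0\<^esub>}
      | Suc j \<Rightarrow> dual_differential R B \<delta> j ` carrier (cochain_module j)) \<longleftrightarrow> coboundary {\<zero>} i f"
proof (cases i)
  case 0
  have "(\<lambda>y\<in>carrier (F 0). f y) = (\<lambda>y\<in>carrier (F 0). \<zero>) \<longleftrightarrow> (\<forall>y\<in>carrier (F 0). f y = \<zero>)"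
    by (rule restrict_eq_iff)
  then show ?thesis unfolding 0 by (simp add: coboundary_0)
next
  case (Suc j)
  have minus: "f y \<ominus> g (\<delta> j y) \<in> {\<zero>} \<longleftrightarrow> g (\<delta> j y) = f y" if "cochain j g" "y \<in> carrier (F (Suc j))" for g y
    using cochain_closed[OF that(1) delta_closed[OF that(2)]] cochain_closed[OF assms, of y] that(2)
    by (auto simp: Suc r_right_minus_eq)
  have "(\<lambda>y\<in>carrier (F (Suc j)). f y) \<in> dual_differential R B \<delta> j ` carrier (cochain_module j) \<longleftrightarrow>
    (\<exists>g\<in>carrier (cochain_module j). \<forall>y\<in>carrier (F (Suc j)). g (\<delta> j y) = f y)"
    unfolding image_iff by (simp only: eq_commute[of "restrict f _"] dual_differential_eq_iff)
  also have "\<dots> \<longleftrightarrow> (\<exists>g. cochain j g \<and> (\<forall>y\<in>carrier (F (Suc j)). g (\<delta> j y) = f y))"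
  proof
    assume "\<exists>g. cochain j g \<and> (\<forall>y\<in>carrier (F (Suc j)). g (\<delta> j y) = f y)"
    then obtain g where g: "cochain j g" "\<forall>y\<in>carrier (F (Suc j)). g (\<delta> j y) = f y" by (elim exE conjE)
    show "\<exists>g\<in>carrier (cochain_module j). \<forall>y\<in>carrier (F (Suc j)). g (\<delta> j y) = f y"
      using cochain_extend(1)[OF g(1)] g(2) delta_closed
      by (intro bexI[of _ "restrict g (carrier (F j))"]) simp_all
  qed (auto simp: mod_hom_iff)
  also have "\<dots> \<longleftrightarrow> coboundary {\<zero>} (Suc j) f"
    unfolding coboundary_Suc by (rule iff_exI, rule conj_cong[OF refl], rule ball_cong[OF refl]) (simp only: minus)
  finally show ?thesis unfolding Suc by simp
qed

text \<open>With J = {0} the representatives are genuine cocycles with values in R, so this is the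
  elementwise criterion for a subquotient. Restriction to the carrier passes to the extensional maps
  required by \<open>hom_module\<close>.\<close>

lemma supp_hom_cohomology_iff:
  "P \<in> supp R (hom_cohomology R B \<delta> (self_module R) i) \<longleftrightarrow> primeideal P R \<and>
    (\<exists>f. cocycle {\<zero>} i f \<and> (\<forall>s\<in>carrier R - P. \<not> coboundary {\<zero>} i (\<lambda>y. s \<otimes> f y)))"
proof -
  let ?C = "cochain_module i"
  let ?Z = "mod_ker ?C (cochain_module (Suc i)) (dual_differential R B \<delta> i)"
  let ?H = "case i of 0 \<Rightarrow> {\<zero>\<^bsub>cochain_module 0\<^esub>}
    | Suc j \<Rightarrow> dual_differential R B \<delta> j ` carrier (cochain_module j)"
  note C = plain_module.axioms[OF plain_module_cochain_module]
  interpret C: plain_module R ?C by (rule plain_module_cochain_module)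
  have Z: "submodule ?Z R ?C" by (rule submodule_mod_ker[OF C C linear_dual_differential])
  have H: "submodule ?H R ?C"
  proof (cases i)
    case 0
    then show ?thesis using C.submodule_singleton_zero by (simp del: hom_module_simps)
  next
    case (Suc j)
    then show ?thesis using submodule_image[OF C C linear_dual_differential[of j]] by (simp del: hom_module_simps)
  qed
  have HZ: "?H \<subseteq> ?Z"
  proof (cases i)
    case 0
    then show ?thesis using C.submodule_zero_closed[OF Z] by (simp del: hom_module_simps)
  next
    case (Suc j)
    have "dual_differential R B \<delta> j g \<in> ?Z" if "g \<in> carrier (cochain_module j)" for g
    proof -
      have gc: "cochain j g" using that by (simp add: mod_hom_iff)
      have dd: "dual_differential R B \<delta> j g \<in> mod_hom R (F i) (self_module R)"
        using linear_map_closed[OF linear_dual_differential that] Suc by simp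
      moreover have "dual_differential R B \<delta> j g (\<delta> i y) = \<zero>" if y: "y \<in> carrier (F (Suc i))" for y
      proof -
        have "dual_differential R B \<delta> j g (\<delta> i y) = g (\<delta> j (\<delta> i y))"
          using delta_closed[OF y] Suc by (simp add: dual_differential_def compose_def)
        also have "\<dots> = g \<zero>\<^bsub>F j\<^esub>" using delta_delta[of y j] y unfolding Suc by simp
        also have "\<dots> = \<zero>" by (rule cochain_zero[OF gc])
        finally show ?thesis .
      qed
      ultimately show ?thesis unfolding cocycles_iff by (simp add: mod_hom_iff cocycle_def)
    qed
    then show ?thesis unfolding Suc by auto
  qed
  have "hom_cohomology R B \<delta> (self_module R) i = quot_module (?C\<lparr>carrier := ?Z\<rparr>) ?H"
    by (simp add: hom_cohomology_def Let_def)
  then have "P \<in> supp R (hom_cohomology R B \<delta> (self_module R) i) \<longleftrightarrow> primeideal P R \<and>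
    (\<exists>f\<in>?Z. \<forall>s\<in>carrier R - P. s \<odot>\<^bsub>?C\<^esub> f \<notin> ?H)"
    using C.supp_subquotient_iff[OF Z H HZ, of P] by (simp only:)
  moreover have smult: "s \<odot>\<^bsub>?C\<^esub> f \<in> ?H \<longleftrightarrow> coboundary {\<zero>} i (\<lambda>y. s \<otimes> f y)"
    if "cochain i f" "s \<in> carrier R" for s f
    using coboundaries_iff[OF cochain_scale[OF that]] by simp
  moreover have "(\<exists>f\<in>?Z. \<forall>s\<in>carrier R - P. s \<odot>\<^bsub>?C\<^esub> f \<notin> ?H) \<longleftrightarrow>
    (\<exists>f. cocycle {\<zero>} i f \<and> (\<forall>s\<in>carrier R - P. \<not> coboundary {\<zero>} i (\<lambda>y. s \<otimes> f y)))"
  proof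
    assume "\<exists>f\<in>?Z. \<forall>s\<in>carrier R - P. s \<odot>\<^bsub>?C\<^esub> f \<notin> ?H"
    then obtain f where f: "f \<in> ?Z" "\<forall>s\<in>carrier R - P. s \<odot>\<^bsub>?C\<^esub> f \<notin> ?H" by (elim bexE)
    have "cocycle {\<zero>} i f" using f(1) by (simp only: cocycles_iff)
    then show "\<exists>f. cocycle {\<zero>} i f \<and> (\<forall>s\<in>carrier R - P. \<not> coboundary {\<zero>} i (\<lambda>y. s \<otimes> f y))"
      using f(2) smult[of f] unfolding cocycle_def by (intro exI[of _ f]) auto
  next
    assume "\<exists>f. cocycle {\<zero>} i f \<and> (\<forall>s\<in>carrier R - P. \<not> coboundary {\<zero>} i (\<lambda>y. s \<otimes> f y))"
    then obtain f where f: "cocycle {\<zero>} i f" "\<forall>s\<in>carrier R - P. \<not> coboundary {\<zero>} i (\<lambda>y. s \<otimes> f y)"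
      by (elim exE conjE)
    let ?f = "restrict f (carrier (F i))"
    have fc: "cochain i f" using f(1) by (simp add: cocycle_def)
    have "cocycle {\<zero>} i ?f" using f(1) cochain_extend(2)[OF fc] delta_closed[of _ i] by (simp add: cocycle_def)
    then have "?f \<in> ?Z" by (simp add: cocycles_iff)
    moreover have "s \<odot>\<^bsub>?C\<^esub> ?f \<notin> ?H" if s: "s \<in> carrier R - P" for s
    proof -
      have "s \<odot>\<^bsub>?C\<^esub> ?f = s \<odot>\<^bsub>?C\<^esub> f" by (rule ext) simp
      then show ?thesis using smult[OF fc, of s] f(2) s by simp
    qed
    ultimately show "\<exists>f\<in>?Z. \<forall>s\<in>carrier R - P. s \<odot>\<^bsub>?C\<^esub> f \<notin> ?H" by (intro bexI[of _ ?f] ballI)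
  qed
  ultimately show ?thesis by simp
qed

end

section \<open>Attained suprema and the support of Ext\<close>

lemma Sup_enat_in_set:
  fixes A :: "enat set"
  assumes "Sup A = enat d" "A \<noteq> {}"
  shows "enat d \<in> A"
proof -
  \<comment> \<open>An infinite set of extended naturals has supremum \<infinity>, so here the
    supremum is a maximum.\<close>
  have "finite A" using assms by (simp add: Sup_enat_def split: if_splits)
  then show ?thesis using assms Max_in[of A] by (simp add: Sup_enat_def)
qed

lemma chain_dim_ge:
  assumes "\<And>i. i \<le> n \<Longrightarrow> P i \<in> X" "\<And>i. i < n \<Longrightarrow> P i \<subset> P (Suc i)"
  shows "enat n \<le> chain_dim X"
  unfolding chain_dim_def by (rule Sup_upper) (use assms in blast)

text \<open>The value is taken positive because the empty set also has supremum 0; a positive value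
  ensures that the supremum is attained by an actual chain.\<close>

lemma chain_dim_eq_Suc_imp_chain:
  assumes "chain_dim X = enat (Suc n)"
  shows "\<exists>P. (\<forall>i\<le>Suc n. P i \<in> X) \<and> (\<forall>i<Suc n. P i \<subset> P (Suc i))"
proof -
  let ?A = "{enat n | n. \<exists>P. (\<forall>i\<le>n. P i \<in> X) \<and> (\<forall>i<n. P i \<subset> P (Suc i))}"
  have A: "Sup ?A = enat (Suc n)" using assms by (simp add: chain_dim_def)
  moreover have "?A \<noteq> {}"
  proof
    assume "?A = {}"
    then have "Sup ?A = 0" by (simp only: Sup_enat_def if_True simp_thms)
    then show False using A by (simp add: zero_enat_def)
  qed
  ultimately have "enat (Suc n) \<in> ?A" by (rule Sup_enat_in_set)
  then show ?thesis by simp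
qed

lemma depth_eq_imp_regular_sequence:
  assumes "depth \<mm> R = enat (Suc n)"
  shows "\<exists>xs. length xs = Suc n \<and> regular_sequence R xs \<and> set xs \<subseteq> \<mm>"
proof -
  let ?A = "{enat (length xs) | xs. regular_sequence R xs \<and> set xs \<subseteq> \<mm>}"
  have A: "Sup ?A = enat (Suc n)" using assms by (simp add: depth_def)
  moreover have "?A \<noteq> {}"
  proof
    assume "?A = {}"
    then have "Sup ?A = 0" by (simp only: Sup_enat_def if_True simp_thms)
    then show False using A by (simp add: zero_enat_def)
  qed
  ultimately have "enat (Suc n) \<in> ?A" by (rule Sup_enat_in_set)
  then show ?thesis by auto
qed

theorem corollary2p11:
  fixes R :: "('a, 'c) ring_scheme" and \<mm> :: "'a set" and M :: "('a, 'm) module" and d :: nat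
  assumes "noetherian_local_ring \<mm> R"
    and "cohen_macaulay_local_ring \<mm> R"
    and "krull_dim R = enat d"
    and "gorenstein_on_punctured_spectrum \<mm> R"
    and "finitely_generated_module R M"
    and "module_dim R M = 1"
  shows "supp R (Ext_module R M (self_module R) (d - 1)) = supp R M \<and>
    module_dim R (Ext_module R M (self_module R) (d - 1)) = 1"
proof -
  interpret L: noetherian_local_ring \<mm> R by fact
  interpret M: plain_module R M
    using assms(5) by (intro plain_module.intro) (simp add: finitely_generated_module_def)
  obtain B :: "nat \<Rightarrow> ('a + 'm) list set" and \<delta>
    where choice: "(SOME (B, \<delta>). \<exists>\<epsilon>. free_resolution R M B \<epsilon> \<delta>) = (B, \<delta>)" by (rule prod.exhaust)
  \<comment> \<open>Existence is required for bases of exactly the type used by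
    \<open>Ext_module\<close>, so that the chosen pair is a resolution.\<close>
  have "\<exists>Bd :: (nat \<Rightarrow> ('a + 'm) list set) \<times> _. case Bd of (B, \<delta>) \<Rightarrow> \<exists>\<epsilon>. free_resolution R M B \<epsilon> \<delta>"
    using M.ex_free_resolution by auto
  from someI_ex[OF this] obtain \<epsilon> where res: "free_resolution R M B \<epsilon> \<delta>" unfolding choice by auto
  interpret res: resolved_module R M B \<epsilon> \<delta> by unfold_locales (rule res)
  let ?E = "Ext_module R M (self_module R) (d - 1)"
  have E: "?E = hom_cohomology R B \<delta> (self_module R) (d - 1)" by (simp add: Ext_module_def choice)
  note supp_M = M.supp_eq_primes_over_annihilator[OF assms(5)]
  note supp_E = res.supp_hom_cohomology_iff[of _ "d - 1", folded E]
  have dim_M: "chain_dim (supp R M) = enat (Suc 0)" using assms(6) by (simp add: module_dim_def one_enat_def)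
  from chain_dim_eq_Suc_imp_chain[OF this] obtain Q
    where Q: "\<forall>i\<le>Suc 0. Q i \<in> supp R M" "\<forall>i<Suc 0. Q i \<subset> Q (Suc i)" by (elim exE conjE)
  have Q01: "Q 0 \<in> supp R M" "Q 1 \<in> supp R M" "Q 0 \<subset> Q 1" using Q by simp_all
  \<comment> \<open>The chain of length 1 in the support of M shows d > 0, so the subtraction d - 1
    is not truncated.\<close>
  have "enat (Suc 0) \<le> krull_dim R"
    unfolding krull_dim_def by (rule chain_dim_ge[of _ Q]) (use Q in \<open>simp_all add: supp_def\<close>)
  then obtain n where n: "d = Suc n" using assms(3) by (cases d) (simp_all add: enat_0_iff)
  \<comment> \<open>Otherwise P, Q' and the maximal ideal would form a chain of length 2 over the
    annihilator, that is, in the support of M.\<close>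
  have max: "Q' = \<mm>" if "primeideal P R" "primeideal Q' R" "M.annihilator \<subseteq> P" "P \<subset> Q'" for P Q'
  proof (rule ccontr)
    assume "Q' \<noteq> \<mm>"
    then have "Q' \<subset> \<mm>" using L.prime_subset_max[OF that(2)] by auto
    then have "enat 2 \<le> chain_dim (supp R M)"
      using that L.max_prime
      by (intro chain_dim_ge[of _ "\<lambda>i. if i = 0 then P else if i = 1 then Q' else \<mm>"])
        (auto simp: supp_M less_2_cases_iff)
    then show False using dim_M by simp
  qed
  have ann: "ideal M.annihilator R" "M.annihilator \<subseteq> \<mm>"
    using M.annihilator_ideal Q01(1) supp_M L.prime_subset_max by auto
  have "depth \<mm> R = enat (Suc n)" using assms(2,3) n by (simp add: cohen_macaulay_local_ring_def)
  from depth_eq_imp_regular_sequence[OF this] obtain xs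
    where xs: "length xs = Suc n" "regular_sequence R xs" "set xs \<subseteq> \<mm>" by (elim exE conjE)
  have "L.depth_ge (Suc n) {\<zero>\<^bsub>R\<^esub>}"
  proof (rule L.depth_ge_of_seq)
    fix k assume k: "k < Suc n"
    show "xs ! k \<in> \<mm>" using xs k nth_mem[of k xs] by auto
    show "L.nzd_mod (L.seq_ideal ((!) xs) k) (xs ! k)"
      using L.regular_sequence_imp_nzd_mod[OF xs(2)] xs(1) k by simp
  qed
  then have "\<exists>x. (\<forall>k<n. x k \<in> M.annihilator \<and> L.nzd_mod (L.seq_ideal x k) (x k)) \<and>
    L.depth_ge 1 (L.seq_ideal x n)"
    by (rule L.ex_regular_seq_in_ideal[OF ann]) (rule max)
  then obtain x where "\<forall>k<n. x k \<in> M.annihilator \<and> L.nzd_mod (L.seq_ideal x k) (x k)"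
      and depth: "L.depth_ge 1 (L.seq_ideal x n)" by (elim exE conjE)
  then have x: "\<And>k. k < n \<Longrightarrow> x k \<in> M.annihilator" "\<And>k. k < n \<Longrightarrow> L.nzd_mod (L.seq_ideal x k) (x k)"
    by simp_all
  have J: "ideal (L.seq_ideal x n) R" using x(1) L.ideal_carrier[OF ann(1)] by (intro L.seq_ideal_ideal) simp
  have sub: "P \<in> supp R M" if P: "P \<in> supp R ?E" for P
  proof (rule ccontr)
    assume notin: "P \<notin> supp R M"
    obtain f where Pp: "primeideal P R" and f: "res.cocycle {\<zero>\<^bsub>R\<^esub>} (d - 1) f"
      "\<forall>s\<in>carrier R - P. \<not> res.coboundary {\<zero>\<^bsub>R\<^esub>} (d - 1) (\<lambda>y. s \<otimes>\<^bsub>R\<^esub> f y)"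
      using P unfolding supp_E by (elim exE conjE)
    then obtain s where s: "s \<in> M.annihilator" "s \<notin> P" using notin supp_M by auto
    then have "s \<in> carrier R - P" by (simp add: M.annihilator_def)
    then show False using res.annihilator_coboundary[OF s(1) L.zeroideal f(1)] f(2) by simp
  qed
  have nonmax: "P \<in> supp R ?E" if P: "P \<in> supp R M" "P \<noteq> \<mm>" for P
  proof -
    have Pp: "primeideal P R" "M.annihilator \<subseteq> P" using P(1) supp_M by simp_all
    have "P \<in> L.ass_primes (L.seq_ideal x n)"
    proof (rule L.ass_prime_of_regular_seq)
      show "krull_dim R = enat (Suc n)" using assms(3) n by simp
      show "x k \<in> P" if "k < n" for k using x(1)[OF that] Pp(2) by auto
      show "Q = \<mm>" if "primeideal Q R" "P \<subset> Q" for Q using max[OF Pp(1) that(1) Pp(2) that(2)] .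
    qed (fact x(2) depth Pp(1) P(2))+
    then obtain y0 where y0: "y0 \<in> carrier R" "P = L.colon (L.seq_ideal x n) y0"
      by (auto simp: L.ass_primes_def)
    obtain f where f: "res.cocycle (L.seq_ideal x n) 0 f"
      "\<forall>s\<in>carrier R - P. \<not> res.coboundary (L.seq_ideal x n) 0 (\<lambda>y. s \<otimes>\<^bsub>R\<^esub> f y)"
      using res.ex_hom_cocycle[OF assms(5) P(1) J y0] by (elim exE conjE)
    have "\<exists>g. res.cocycle {\<zero>\<^bsub>R\<^esub>} n g \<and>
      (\<forall>s\<in>carrier R - P. \<not> res.coboundary {\<zero>\<^bsub>R\<^esub>} n (\<lambda>y. s \<otimes>\<^bsub>R\<^esub> g y))"
      by (rule res.connecting_iterate[OF x _ f(1)]) (use f(2) in simp_all)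
    then show ?thesis unfolding supp_E using Pp(1) by (simp add: n)
  qed
  have "supp R ?E = supp R M"
  proof (intro equalityI subsetI sub)
    fix P assume P: "P \<in> supp R M"
    show "P \<in> supp R ?E"
    proof (cases "P = \<mm>")
      case True
      \<comment> \<open>The bottom \<open>Q 0\<close> of the chain is not maximal, so it is already
        in the support of Ext. The class found for it also works for the maximal ideal, because
        fewer multipliers lie outside the larger prime.\<close>
      have "primeideal (Q 0) R" "primeideal (Q 1) R" using Q01 supp_M by simp_all
      then have Q0: "Q 0 \<subseteq> \<mm>" "Q 0 \<noteq> \<mm>" using Q01(3) L.prime_subset_max[of "Q 1"] by auto
      obtain f where "res.cocycle {\<zero>\<^bsub>R\<^esub>} (d - 1) f"
        "\<forall>s\<in>carrier R - Q 0. \<not> res.coboundary {\<zero>\<^bsub>R\<^esub>} (d - 1) (\<lambda>y. s \<otimes>\<^bsub>R\<^esub> f y)"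
        using nonmax[OF Q01(1) Q0(2)] unfolding supp_E by (elim exE conjE)
      then show ?thesis unfolding True supp_E using L.max_prime Q0(1) by (intro conjI exI[of _ f]) auto
    qed (rule nonmax[OF P])
  qed
  then show ?thesis using assms(6) by (simp add: module_dim_def)
qed

end
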